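(* Let $\lambda\in P^+$, let $w_\lambda\in W$ be the unique shortest element with $\overline\lambda:=w_\lambda\cdot\lambda\in\mathcal O$, fix a reduced expression $w_\lambda=s_{i_1}\cdots s_{i_m}$, and put $$c_\lambda=\frac{|W_0|}{|W_0\cdot\lambda|}\prod_{j=1}^m(a_{i_j},\widetilde{\lambda_{(j)}}),\qquad \lambda_{(j)}=s_{i_{j-1}}\cdots s_{i_1}\cdot\overline\lambda .$$ Let $\mathcal P=\mathbb Z_{+}[k_\alpha]$ be the set of polynomials in the parameters $k_\alpha$ with non-negative integral coefficients. Then $c_\lambda\in\mathcal P$, and all coefficients of $c_\lambda P_\lambda$ (in its expansion in the exponentials $e^\mu$, $\mu\in P$) belong to $\mathcal P$, where $P_\lambda$ is the Heckman–Opdam polynomial.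
   Context: Let $R_0$ be the root system of a (complex) simple Lie algebra, and let $V_0$ be the real Euclidean space spanned by $R_0$, with $W_0$-invariant inner product $(\cdot,\cdot)$. Put $\alpha^\vee=2\alpha/(\alpha,\alpha)$. Fix positive roots $R_0^+$ with simple roots $\alpha_1,\dots,\alpha_n$, and let $\beta$ be the highest short root (if all roots have the same length, all are considered short). Let $V=\mathbb R\delta\oplus V_0$ be the space of affine linear functions on $V_0$, via $(r\delta+x,y)=r+(x,y)$ for $r\in\mathbb R$, $x,y\in V_0$. Put $a_0=\delta-\beta^\vee$ and $a_i=\alpha_i^\vee$ for $1\le i\le n$; let $s_i$ be the orthogonal (affine) reflection of $V_0$ in the hyperplane $\{x: (a_i,x)=0\}$, so $s_0\cdot x=x-((\beta^\vee,x)-1)\beta$ and $s_i\cdot x=x-(\alpha_i^\vee,x)\alpha_i$ for $i\ge1$. Let $W$ be the Coxeter group generated by $s_0,\dots,s_n$ (the dual affine Weyl group) and $W_0$ the finite Weyl group generated by $s_1,\dots,s_n$. The length of an element of $W$ is the length of a shortest (reduced) expression in the $s_i$. $P\subset V_0$ is the weight lattice, which is preserved by $W$, and $P^+$ is the set of dominant weights. Let $k_\alpha$ ($\alpha\in R_0$) be parameters (indeterminates) with $k_{w\cdot\alpha}=k_\alpha$ for $w\in W_0$ (one indeterminate per $W_0$-orbit of roots), and $\mathbb F=\mathbb R(k_\alpha)$ the field of rational functions in them. Let $\mathcal R$ be the $\mathbb F$-span of the exponentials $e^\mu$, $\mu\in P$ (the group algebra of $P$ over $\mathbb F$); $W$ acts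 $\mathbb F$-linearly on $\mathcal R$ by $w\,e^\mu=e^{w\cdot\mu}$. All pairings are extended $\mathbb F$-linearly. Each $W$-orbit in $P$ contains exactly one element of $\mathcal O=\{\lambda\in P: (\alpha^\vee,\lambda)\in\{0,1\}\ \text{for all }\alpha\in R_0^+\}$. For $t\in\mathbb R$ put $\varepsilon_t=1$ if $t>0$ and $\varepsilon_t=-1$ if $t\le0$. For $\lambda\in P$ put $\widetilde\lambda=\lambda+\frac12\sum_{\alpha\in R_0^+}k_\alpha\,\varepsilon_{(\alpha^\vee,\lambda)}\,\alpha\in\mathbb F\otimes V_0$. Heckman–Opdam (generalized Jacobi) polynomials: for $\lambda\in P^+$ let $m_\lambda=\sum_{\mu\in W_0\cdot\lambda}e^\mu$, and let $\rho=\frac12\sum_{\alpha\in R_0^+}k_\alpha\alpha$. For $y\in V_0$ let $\partial_y e^\mu=(y,\mu)e^\mu$. Let $L=\sum_i\partial_{\xi_i}^2+\sum_{\alpha\in R_0^+}k_\alpha\frac{1+e^{-\alpha}}{1-e^{-\alpha}}\partial_\alpha$, with $\{\xi_i\}$ an orthonormal basis of $V_0$; $L$ preserves $\mathcal R^{W_0}$. Then $P_\lambda\in\mathcal R^{W_0}$ is the unique element of the form $P_\lambda=m_\lambda+\sum_{\mu\in P^+,\,\mu<\lambda}d_{\mu}m_\mu$ with $d_\mu\in\mathbb F$ (where $\mu<\lambda$ means that $\lambda-\mu$ is a nonzero sum of positive roots) such that $LP_\lambda=(\lambda,\lambda+2\rho)P_\lambda$. *)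

theory Defs
  imports
    "HOL-Analysis.Analysis"
    "HOL-Library.Poly_Mapping"
    "HOL-Computational_Algebra.Fraction_Field"
begin

section \<open>Root systems\<close>

definition coroot :: "'a::euclidean_space \<Rightarrow> 'a" where
  "coroot x = (2 / (x \<bullet> x)) *\<^sub>R x"

definition reflection :: "'a::euclidean_space \<Rightarrow> 'a \<Rightarrow> 'a" where
  "reflection x y = y - (coroot x \<bullet> y) *\<^sub>R x"

text \<open>The ambient space is the Euclidean type itself. The root systems of complex simple Lie
  algebras are exactly the reduced, crystallographic, irreducible ones.\<close>

definition root_system :: "'a::euclidean_space set \<Rightarrow> bool" where
  "root_system R \<longleftrightarrow>
     finite R \<and> 0 \<notin> R \<and> span R = UNIV \<and>
     (\<forall>x\<in>R. reflection x ` R = R) \<and>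
     (\<forall>x\<in>R. \<forall>y\<in>R. coroot x \<bullet> y \<in> \<int>) \<and>
     (\<forall>x\<in>R. \<forall>t. t *\<^sub>R x \<in> R \<longrightarrow> t = 1 \<or> t = -1)"

definition irreducible_roots :: "'a::euclidean_space set \<Rightarrow> bool" where
  "irreducible_roots R \<longleftrightarrow>
     R \<noteq> {} \<and>
     \<not> (\<exists>A B. A \<noteq> {} \<and> B \<noteq> {} \<and> A \<inter> B = {} \<and> A \<union> B = R \<and> (\<forall>x\<in>A. \<forall>y\<in>B. x \<bullet> y = 0))"

text \<open>Simple roots are enumerated as \<open>\<alpha> 1, \<dots>, \<alpha> n\<close> with \<open>n\<close> the dimension; the
  value of \<open>\<alpha>\<close> at other arguments is irrelevant. The choice of simple roots determines the
  positive roots.\<close>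

definition nonneg_comb :: "(nat \<Rightarrow> 'a::euclidean_space) \<Rightarrow> 'a \<Rightarrow> bool" where
  "nonneg_comb \<alpha> x \<longleftrightarrow> (\<exists>c::nat \<Rightarrow> nat. x = (\<Sum>i = 1..DIM('a). real (c i) *\<^sub>R \<alpha> i))"

definition simple_roots :: "'a::euclidean_space set \<Rightarrow> (nat \<Rightarrow> 'a) \<Rightarrow> bool" where
  "simple_roots R \<alpha> \<longleftrightarrow>
     \<alpha> ` {1..DIM('a)} \<subseteq> R \<and> inj_on \<alpha> {1..DIM('a)} \<and> independent (\<alpha> ` {1..DIM('a)}) \<and>
     (\<forall>x\<in>R. nonneg_comb \<alpha> x \<or> nonneg_comb \<alpha> (- x))"

definition pos_roots :: "'a::euclidean_space set \<Rightarrow> (nat \<Rightarrow> 'a) \<Rightarrow> 'a set" where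
  "pos_roots R \<alpha> = {x \<in> R. nonneg_comb \<alpha> x}"

definition sum_of_pos_roots :: "'a::euclidean_space set \<Rightarrow> (nat \<Rightarrow> 'a) \<Rightarrow> 'a \<Rightarrow> bool" where
  "sum_of_pos_roots R \<alpha> x \<longleftrightarrow> (\<exists>c::'a \<Rightarrow> nat. x = (\<Sum>y\<in>pos_roots R \<alpha>. real (c y) *\<^sub>R y))"

definition short_roots :: "'a::euclidean_space set \<Rightarrow> 'a set" where
  "short_roots R = {x \<in> R. \<forall>y\<in>R. norm x \<le> norm y}"

definition highest_short_root :: "'a::euclidean_space set \<Rightarrow> (nat \<Rightarrow> 'a) \<Rightarrow> 'a" where
  "highest_short_root R \<alpha> =
     (THE b. b \<in> short_roots R \<and> (\<forall>x\<in>short_roots R. sum_of_pos_roots R \<alpha> (b - x)))"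

definition weight_lattice :: "'a::euclidean_space set \<Rightarrow> 'a set" where
  "weight_lattice R = {x. \<forall>y\<in>R. coroot y \<bullet> x \<in> \<int>}"

definition dominant_weights :: "'a::euclidean_space set \<Rightarrow> (nat \<Rightarrow> 'a) \<Rightarrow> 'a set" where
  "dominant_weights R \<alpha> = {x \<in> weight_lattice R. \<forall>y\<in>pos_roots R \<alpha>. coroot y \<bullet> x \<ge> 0}"

definition dominance_less :: "'a::euclidean_space set \<Rightarrow> (nat \<Rightarrow> 'a) \<Rightarrow> 'a \<Rightarrow> 'a \<Rightarrow> bool" where
  "dominance_less R \<alpha> \<mu> \<nu> \<longleftrightarrow> \<nu> - \<mu> \<noteq> 0 \<and> sum_of_pos_roots R \<alpha> (\<nu> - \<mu>)"


section \<open>Affine functions and the dual affine Weyl group\<close>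

text \<open>The pair \<open>(r, x)\<close> stands for the affine function \<open>r\<delta> + x\<close>, that is
  \<open>y \<mapsto> r + (x, y)\<close>.\<close>

definition aff_eval :: "real \<times> 'a::euclidean_space \<Rightarrow> 'a \<Rightarrow> real" where
  "aff_eval a y = fst a + snd a \<bullet> y"

text \<open>Orthogonal reflection in the zero set of an affine function with nonzero gradient.\<close>

definition aff_reflection :: "real \<times> 'a::euclidean_space \<Rightarrow> 'a \<Rightarrow> 'a" where
  "aff_reflection a y = y - aff_eval a y *\<^sub>R coroot (snd a)"

definition simple_aff :: "'a::euclidean_space set \<Rightarrow> (nat \<Rightarrow> 'a) \<Rightarrow> nat \<Rightarrow> real \<times> 'a" where
  "simple_aff R \<alpha> i =
     (if i = 0 then (1, - coroot (highest_short_root R \<alpha>)) else (0, coroot (\<alpha> i)))"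

definition simple_refl :: "'a::euclidean_space set \<Rightarrow> (nat \<Rightarrow> 'a) \<Rightarrow> nat \<Rightarrow> 'a \<Rightarrow> 'a" where
  "simple_refl R \<alpha> i = aff_reflection (simple_aff R \<alpha> i)"

text \<open>The list \<open>[i\<^sub>1, \<dots>, i\<^sub>m]\<close> denotes the composition of the reflections with indices
  \<open>i\<^sub>1, \<dots>, i\<^sub>m\<close>, the last one being applied first. As the generators are involutions,
  these compositions form the group they generate.\<close>

definition word_map :: "'a::euclidean_space set \<Rightarrow> (nat \<Rightarrow> 'a) \<Rightarrow> nat list \<Rightarrow> 'a \<Rightarrow> 'a" where
  "word_map R \<alpha> js = foldr (simple_refl R \<alpha>) js"

definition affine_weyl :: "'a::euclidean_space set \<Rightarrow> (nat \<Rightarrow> 'a) \<Rightarrow> ('a \<Rightarrow> 'a) set" where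
  "affine_weyl R \<alpha> = {word_map R \<alpha> js | js. set js \<subseteq> {0..DIM('a)}}"

definition finite_weyl :: "'a::euclidean_space set \<Rightarrow> (nat \<Rightarrow> 'a) \<Rightarrow> ('a \<Rightarrow> 'a) set" where
  "finite_weyl R \<alpha> = {word_map R \<alpha> js | js. set js \<subseteq> {1..DIM('a)}}"

definition finite_orbit :: "'a::euclidean_space set \<Rightarrow> (nat \<Rightarrow> 'a) \<Rightarrow> 'a \<Rightarrow> 'a set" where
  "finite_orbit R \<alpha> x = (\<lambda>w. w x) ` finite_weyl R \<alpha>"

definition weyl_length :: "'a::euclidean_space set \<Rightarrow> (nat \<Rightarrow> 'a) \<Rightarrow> ('a \<Rightarrow> 'a) \<Rightarrow> nat" where
  "weyl_length R \<alpha> w =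
     (LEAST m. \<exists>js. set js \<subseteq> {0..DIM('a)} \<and> word_map R \<alpha> js = w \<and> length js = m)"

definition reduced_expression ::
    "'a::euclidean_space set \<Rightarrow> (nat \<Rightarrow> 'a) \<Rightarrow> nat list \<Rightarrow> ('a \<Rightarrow> 'a) \<Rightarrow> bool" where
  "reduced_expression R \<alpha> js w \<longleftrightarrow>
     set js \<subseteq> {0..DIM('a)} \<and> word_map R \<alpha> js = w \<and> length js = weyl_length R \<alpha> w"

definition orbit_reps :: "'a::euclidean_space set \<Rightarrow> (nat \<Rightarrow> 'a) \<Rightarrow> 'a set" where
  "orbit_reps R \<alpha> = {x \<in> weight_lattice R. \<forall>y\<in>pos_roots R \<alpha>. coroot y \<bullet> x \<in> {0, 1}}"

text \<open>In the affine Weyl group of an irreducible root system, every weight \<open>\<nu>\<close> has exactly one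
  element \<open>w\<close> with this property.\<close>

definition shortest_to_rep ::
    "'a::euclidean_space set \<Rightarrow> (nat \<Rightarrow> 'a) \<Rightarrow> 'a \<Rightarrow> ('a \<Rightarrow> 'a) \<Rightarrow> bool" where
  "shortest_to_rep R \<alpha> \<nu> w \<longleftrightarrow>
     w \<in> affine_weyl R \<alpha> \<and> w \<nu> \<in> orbit_reps R \<alpha> \<and>
     (\<forall>v\<in>affine_weyl R \<alpha>. v \<nu> \<in> orbit_reps R \<alpha> \<longrightarrow> weyl_length R \<alpha> w \<le> weyl_length R \<alpha> v)"


section \<open>Parameters\<close>

text \<open>The field of real rational functions in indeterminates indexed by \<open>'i\<close>. A labelling
  \<open>\<kappa>\<close> below identifies the type \<open>'i\<close> with the set of orbits of roots, so that there is exactly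
  one indeterminate per orbit. The order on \<open>'i\<close> is only needed for the type class instance
  making polynomials an integral domain.\<close>

type_synonym 'i ratfun = "(('i \<Rightarrow>\<^sub>0 nat) \<Rightarrow>\<^sub>0 real) fract"

definition orbit_labelling ::
    "'a::euclidean_space set \<Rightarrow> (nat \<Rightarrow> 'a) \<Rightarrow> ('a \<Rightarrow> 'i) \<Rightarrow> bool" where
  "orbit_labelling R \<alpha> \<kappa> \<longleftrightarrow>
     (\<forall>x\<in>R. \<forall>y\<in>R. \<kappa> x = \<kappa> y \<longleftrightarrow> y \<in> finite_orbit R \<alpha> x) \<and> \<kappa> ` R = UNIV"

definition const :: "real \<Rightarrow> 'i::linorder ratfun" where
  "const r = Fract (Poly_Mapping.single 0 r) 1"

definition param :: "('a \<Rightarrow> 'i::linorder) \<Rightarrow> 'a \<Rightarrow> 'i ratfun" where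
  "param \<kappa> x = Fract (Poly_Mapping.single (Poly_Mapping.single (\<kappa> x) 1) 1) 1"

definition nonneg_int_polys :: "'i::linorder ratfun set" where
  "nonneg_int_polys = {Fract p 1 | p. \<forall>m. Poly_Mapping.lookup p m \<in> \<nat>}"


section \<open>Extension of scalars\<close>

text \<open>Elements of \<open>\<bbbF> \<otimes> V\<^sub>0\<close> are given by their coordinates with respect to the orthonormal
  basis \<^const>\<open>Basis\<close>; values outside of it are irrelevant.\<close>

definition pairing :: "'a::euclidean_space \<Rightarrow> ('a \<Rightarrow> 'i::linorder ratfun) \<Rightarrow> 'i ratfun" where
  "pairing x \<eta> = (\<Sum>b\<in>Basis. const (x \<bullet> b) * \<eta> b)"

definition aff_pairing ::
    "real \<times> 'a::euclidean_space \<Rightarrow> ('a \<Rightarrow> 'i::linorder ratfun) \<Rightarrow> 'i ratfun" where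
  "aff_pairing a \<eta> = const (fst a) + pairing (snd a) \<eta>"

definition sign_eps :: "real \<Rightarrow> real" where
  "sign_eps t = (if t > 0 then 1 else -1)"

text \<open>The coordinate at \<open>b\<close> of \<open>\<nu>\<close> shifted by half the sum of \<open>k\<^sub>\<gamma> \<epsilon> \<gamma>\<close>, where \<open>\<epsilon>\<close> is the sign at
  \<open>(\<gamma>\<^sup>\<or>, \<nu>)\<close>.\<close>

definition shifted ::
    "'a::euclidean_space set \<Rightarrow> (nat \<Rightarrow> 'a) \<Rightarrow> ('a \<Rightarrow> 'i::linorder) \<Rightarrow> 'a \<Rightarrow> 'a \<Rightarrow> 'i ratfun" where
  "shifted R \<alpha> \<kappa> \<nu> b =
     const (\<nu> \<bullet> b) +
     const (1/2) *
       (\<Sum>\<gamma>\<in>pos_roots R \<alpha>. param \<kappa> \<gamma> * const (sign_eps (coroot \<gamma> \<bullet> \<nu>)) * const (\<gamma> \<bullet> b))"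

definition rho ::
    "'a::euclidean_space set \<Rightarrow> (nat \<Rightarrow> 'a) \<Rightarrow> ('a \<Rightarrow> 'i::linorder) \<Rightarrow> 'a \<Rightarrow> 'i ratfun" where
  "rho R \<alpha> \<kappa> b = const (1/2) * (\<Sum>\<gamma>\<in>pos_roots R \<alpha>. param \<kappa> \<gamma> * const (\<gamma> \<bullet> b))"


section \<open>The group algebra of the weight lattice\<close>

text \<open>Elements of the group algebra are finitely supported functions with support in the weight
  lattice; the product of \<^typ>\<open>'a \<Rightarrow>\<^sub>0 'b\<close> is convolution.\<close>

definition group_algebra ::
    "'a::euclidean_space set \<Rightarrow> ('a \<Rightarrow>\<^sub>0 'i::linorder ratfun) set" where
  "group_algebra R = {f. Poly_Mapping.keys f \<subseteq> weight_lattice R}"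

definition expo :: "'a::euclidean_space \<Rightarrow> 'a \<Rightarrow>\<^sub>0 'i::linorder ratfun" where
  "expo \<mu> = Poly_Mapping.single \<mu> 1"

definition scale ::
    "'i::linorder ratfun \<Rightarrow> ('a::euclidean_space \<Rightarrow>\<^sub>0 'i ratfun) \<Rightarrow> 'a \<Rightarrow>\<^sub>0 'i ratfun" where
  "scale c f = Poly_Mapping.map (\<lambda>x. c * x) f"

definition weyl_act ::
    "('a::euclidean_space \<Rightarrow> 'a) \<Rightarrow> ('a \<Rightarrow>\<^sub>0 'i::linorder ratfun) \<Rightarrow> 'a \<Rightarrow>\<^sub>0 'i ratfun" where
  "weyl_act w f = (\<Sum>\<mu>\<in>Poly_Mapping.keys f. scale (Poly_Mapping.lookup f \<mu>) (expo (w \<mu>)))"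

definition invariants ::
    "'a::euclidean_space set \<Rightarrow> (nat \<Rightarrow> 'a) \<Rightarrow> ('a \<Rightarrow>\<^sub>0 'i::linorder ratfun) set" where
  "invariants R \<alpha> = {f \<in> group_algebra R. \<forall>w\<in>finite_weyl R \<alpha>. weyl_act w f = f}"

definition dderiv ::
    "'a::euclidean_space \<Rightarrow> ('a \<Rightarrow>\<^sub>0 'i::linorder ratfun) \<Rightarrow> 'a \<Rightarrow>\<^sub>0 'i ratfun" where
  "dderiv y f =
     (\<Sum>\<mu>\<in>Poly_Mapping.keys f. scale (Poly_Mapping.lookup f \<mu> * const (y \<bullet> \<mu>)) (expo \<mu>))"

definition orbit_sum ::
    "'a::euclidean_space set \<Rightarrow> (nat \<Rightarrow> 'a) \<Rightarrow> 'a \<Rightarrow> 'a \<Rightarrow>\<^sub>0 'i::linorder ratfun" where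
  "orbit_sum R \<alpha> \<nu> = (\<Sum>\<mu>\<in>finite_orbit R \<alpha> \<nu>. expo \<mu>)"

text \<open>The quotient of \<open>f\<close> by \<open>1 - e\<^sup>-\<^sup>\<gamma>\<close>. It is unique when it exists, and it exists for
  \<open>f = (1 + e\<^sup>-\<^sup>\<gamma>) \<partial>\<^sub>\<gamma> g\<close> with \<open>g\<close> invariant, the only case relevant to the operator below.\<close>

definition root_quotient ::
    "'a::euclidean_space set \<Rightarrow> 'a \<Rightarrow> ('a \<Rightarrow>\<^sub>0 'i::linorder ratfun) \<Rightarrow> 'a \<Rightarrow>\<^sub>0 'i ratfun" where
  "root_quotient R \<gamma> f = (THE q. q \<in> group_algebra R \<and> (1 - expo (- \<gamma>)) * q = f)"

definition HO_operator ::
    "'a::euclidean_space set \<Rightarrow> (nat \<Rightarrow> 'a) \<Rightarrow> ('a \<Rightarrow> 'i::linorder) \<Rightarrow>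
     ('a \<Rightarrow>\<^sub>0 'i ratfun) \<Rightarrow> 'a \<Rightarrow>\<^sub>0 'i ratfun" where
  "HO_operator R \<alpha> \<kappa> f =
     (\<Sum>\<xi>\<in>Basis. dderiv \<xi> (dderiv \<xi> f)) +
     (\<Sum>\<gamma>\<in>pos_roots R \<alpha>.
        scale (param \<kappa> \<gamma>) (root_quotient R \<gamma> ((1 + expo (- \<gamma>)) * dderiv \<gamma> f)))"

text \<open>The dominant weights below a given one are finite in number, so that the sum below is a
  genuine finite sum.\<close>

definition is_HO_polynomial ::
    "'a::euclidean_space set \<Rightarrow> (nat \<Rightarrow> 'a) \<Rightarrow> ('a \<Rightarrow> 'i::linorder) \<Rightarrow> 'a \<Rightarrow>
     ('a \<Rightarrow>\<^sub>0 'i ratfun) \<Rightarrow> bool" where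
  "is_HO_polynomial R \<alpha> \<kappa> \<nu> p \<longleftrightarrow>
     p \<in> invariants R \<alpha> \<and>
     (\<exists>d. p = orbit_sum R \<alpha> \<nu> +
        (\<Sum>\<mu> | \<mu> \<in> dominant_weights R \<alpha> \<and> dominance_less R \<alpha> \<mu> \<nu>.
           scale (d \<mu>) (orbit_sum R \<alpha> \<mu>))) \<and>
     HO_operator R \<alpha> \<kappa> p =
       scale (pairing \<nu> (\<lambda>b. const (\<nu> \<bullet> b) + const 2 * rho R \<alpha> \<kappa> b)) p"

definition HO_polynomial ::
    "'a::euclidean_space set \<Rightarrow> (nat \<Rightarrow> 'a) \<Rightarrow> ('a \<Rightarrow> 'i::linorder) \<Rightarrow> 'a \<Rightarrow>
     'a \<Rightarrow>\<^sub>0 'i ratfun" where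
  "HO_polynomial R \<alpha> \<kappa> \<nu> = (THE p. is_HO_polynomial R \<alpha> \<kappa> \<nu> p)"


section \<open>The normalizing constant\<close>

text \<open>For \<open>w = s\<^bsub>i\<^sub>1\<^esub> \<cdots> s\<^bsub>i\<^sub>m\<^esub>\<close> given by \<open>js\<close>, the weight
  \<open>\<nu>\<^bsub>(j+1)\<^esub> = s\<^bsub>i\<^sub>j\<^esub> \<cdots> s\<^bsub>i\<^sub>1\<^esub> w \<nu>\<close>; note that \<^const>\<open>fold\<close> applies
  the first index of the list first.\<close>

definition intermediate_weight ::
    "'a::euclidean_space set \<Rightarrow> (nat \<Rightarrow> 'a) \<Rightarrow> nat list \<Rightarrow> 'a \<Rightarrow> nat \<Rightarrow> 'a" where
  "intermediate_weight R \<alpha> js \<nu> j =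
     fold (simple_refl R \<alpha>) (take j js) (word_map R \<alpha> js \<nu>)"

definition c_const ::
    "'a::euclidean_space set \<Rightarrow> (nat \<Rightarrow> 'a) \<Rightarrow> ('a \<Rightarrow> 'i::linorder) \<Rightarrow> nat list \<Rightarrow> 'a \<Rightarrow>
     'i ratfun" where
  "c_const R \<alpha> \<kappa> js \<nu> =
     of_nat (card (finite_weyl R \<alpha>)) / of_nat (card (finite_orbit R \<alpha> \<nu>)) *
     (\<Prod>j<length js.
        aff_pairing (simple_aff R \<alpha> (js ! j))
          (shifted R \<alpha> \<kappa> (intermediate_weight R \<alpha> js \<nu> j)))"

end

theory Submission
  imports Defs
begin

text \<open>
Put \<open>T\<^sub>x = (1 - s\<^sub>x)/(1 - e\<^sup>-\<^sup>x) - 1/2\<close>. The Cherednik operators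
\<open>D\<^sub>y = \<partial>\<^sub>y + (\<Sum>x. k\<^sub>x (x, y) T\<^sub>x)\<close> satisfy
\<open>D\<^sub>y s\<^sub>i = s\<^sub>i D\<^sub>z - k\<^sub>i (y, \<alpha>\<^sub>i)\<close> with \<open>z = s\<^sub>i y\<close>, and this holds for the affine
reflection \<open>s\<^sub>0\<close> as well when \<open>D\<close> is extended to affine functions. Hence if \<open>f\<close> is a joint
eigenvector with eigenvalues \<open>(y, \<mu>~)\<close>, where \<open>\<mu>~\<close> is the shifted weight, then
\<open>(a\<^sub>i, \<mu>~) s\<^sub>i f + k\<^sub>i f\<close> is one for the weight \<open>s\<^sub>i \<mu>\<close>. The exponential of the orbit
representative is an eigenvector, so a reduced word leads to an eigenvector for the dominant weight
\<open>\<nu>\<close>; its coefficients are polynomials with non-negative integral coefficients, because along a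
reduced word the factors \<open>(a\<^sub>i, \<mu>~)\<close> are. Symmetrizing yields an invariant eigenvector of the sum
of the \<open>D\<^sub>\<xi> D\<^sub>\<xi>\<close>, which on invariants differs from the Heckman--Opdam operator by a constant, and
triangularity identifies it with the normalized Heckman--Opdam polynomial.
\<close>

section \<open>Polynomials in the parameters\<close>

text \<open>The recursion only adds and multiplies, so the work lies in three controls. The scalar
  of a step lies in \<open>nonneg_int_polys\<close> when the affine function is positive at the
  unshifted weight; that a reduced word takes only such steps is seen by counting the hyperplanes
  between a weight and the fundamental alcove, since no letter changes the count by more than one.
  The coefficient at the current weight has to be multiplied by exactly this scalar, so that
  precisely the constant of the theorem appears; for this the eigenvector must not contain the
  exponential of the next weight. Finally, the support of the last eigenvector has to lie below the
  dominant weight. The latter two controls come from one principle: the operators are triangular for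
  the order by norm and then by height, and their joint diagonal entries at different weights
  differ, because they already differ when all parameters are set to zero. Symmetrization
  contributes the order of the stabilizer of the weight, which is the quotient of orders in front of
  the product.\<close>

lemma const_0 [simp]: "const 0 = 0"
  by (simp add: const_def Zero_fract_def)

lemma const_1 [simp]: "const 1 = 1"
  by (simp add: const_def One_fract_def)

lemma const_add: "const (x + y) = const x + const y"
  by (simp add: const_def single_add)

lemma const_uminus: "const (- x) = - const x"
  by (simp add: const_def single_uminus)

lemma const_diff: "const (x - y) = const x - const y"
  by (simp add: const_def single_diff)

lemma const_mult: "const (x * y) = const x * const y"
  by (simp add: const_def mult_single)

lemma const_sum: "const (sum f A) = (\<Sum>x\<in>A. const (f x))"
  by (induction A rule: infinite_finite_induct) (simp_all add: const_add)

lemma const_of_nat: "const (real n) = of_nat n"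
  by (induction n) (simp_all add: const_add)

lemma const_half_add: "const (1/2) * x + const (1/2) * x = (x :: 'i::linorder ratfun)"
proof -
  have "const (1/2) + const (1/2) = (1 :: 'i ratfun)"
    by (simp flip: const_add)
  then show ?thesis
    by (metis distrib_right mult_1)
qed

lemma sum_in_Nats:
  "(\<And>x. x \<in> A \<Longrightarrow> f x \<in> (\<nat> :: 'b::semiring_1 set)) \<Longrightarrow> sum f A \<in> \<nat>"
  by (induction A rule: infinite_finite_induct) simp_all

lemma Nats_Sum_any: "(\<And>x. f x \<in> (\<nat> :: 'b::semiring_1 set)) \<Longrightarrow> Sum_any f \<in> \<nat>"
  unfolding Sum_any.expand_set by (rule sum_in_Nats)

lemma nonneg_int_polysI: "(\<And>m. Poly_Mapping.lookup p m \<in> \<nat>) \<Longrightarrow> Fract p 1 \<in> nonneg_int_polys"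
  unfolding nonneg_int_polys_def by blast

lemma nonneg_int_polys_single:
  assumes "r \<in> \<nat>" shows "Fract (Poly_Mapping.single m r) 1 \<in> nonneg_int_polys"
  by (rule nonneg_int_polysI) (use assms in \<open>simp add: lookup_single when_def\<close>)

lemma nonneg_int_polys_0: "0 \<in> nonneg_int_polys"
  using nonneg_int_polys_single[of 0 0] by (simp add: Zero_fract_def)

lemma nonneg_int_polys_const: "r \<in> \<nat> \<Longrightarrow> const r \<in> nonneg_int_polys"
  unfolding const_def by (rule nonneg_int_polys_single)

lemma nonneg_int_polys_of_nat: "of_nat n \<in> nonneg_int_polys"
  by (metis const_of_nat nonneg_int_polys_const of_nat_in_Nats)

lemma nonneg_int_polys_param: "param \<kappa> x \<in> nonneg_int_polys"
  unfolding param_def by (rule nonneg_int_polys_single) simp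

lemma nonneg_int_polys_add:
  assumes "x \<in> nonneg_int_polys" "y \<in> nonneg_int_polys"
  shows "x + y \<in> nonneg_int_polys"
proof -
  obtain p q where "x = Fract p 1" "y = Fract q 1"
    "\<And>m. Poly_Mapping.lookup p m \<in> \<nat>" "\<And>m. Poly_Mapping.lookup q m \<in> \<nat>"
    using assms unfolding nonneg_int_polys_def by blast
  then show ?thesis
    using nonneg_int_polysI[of "p + q"] by (simp add: lookup_add)
qed

lemma nonneg_int_polys_mult:
  assumes "x \<in> nonneg_int_polys" "y \<in> nonneg_int_polys"
  shows "x * y \<in> nonneg_int_polys"
proof -
  obtain p q where *: "x = Fract p 1" "y = Fract q 1"
    "\<And>m. Poly_Mapping.lookup p m \<in> \<nat>" "\<And>m. Poly_Mapping.lookup q m \<in> \<nat>"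
    using assms unfolding nonneg_int_polys_def by blast
  have "Poly_Mapping.lookup (p * q) m \<in> \<nat>" for m
    unfolding lookup_mult
    by (intro Nats_Sum_any Nats_mult) (auto simp: * when_def)
  then show ?thesis
    using nonneg_int_polysI[of "p * q"] * by simp
qed

lemma nonneg_int_polys_sum:
  "(\<And>x. x \<in> A \<Longrightarrow> f x \<in> nonneg_int_polys) \<Longrightarrow> sum f A \<in> nonneg_int_polys"
  by (induction A rule: infinite_finite_induct) (simp_all add: nonneg_int_polys_0 nonneg_int_polys_add)

lemma nonneg_int_polys_prod:
  "(\<And>x. x \<in> A \<Longrightarrow> f x \<in> nonneg_int_polys) \<Longrightarrow> prod f A \<in> nonneg_int_polys"
  by (induction A rule: infinite_finite_induct)
    (use nonneg_int_polys_of_nat[of 1] in \<open>simp_all add: nonneg_int_polys_mult\<close>)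

text \<open>Evaluation with all parameters zero, as a relation because it makes sense only on
  polynomials. It serves to show that scalars are nonzero and that eigenvalues at different weights
  are distinct.\<close>

definition has_const_term :: "'i::linorder ratfun \<Rightarrow> real \<Rightarrow> bool" where
  "has_const_term q x \<longleftrightarrow> (\<exists>p. q = Fract p 1 \<and> Poly_Mapping.lookup p 0 = x)"

lemma has_const_term_unique: "has_const_term q x \<Longrightarrow> has_const_term q y \<Longrightarrow> x = y"
  by (auto simp: has_const_term_def eq_fract)

lemma has_const_term_0: "has_const_term 0 0"
  unfolding has_const_term_def by (rule exI[of _ 0]) (simp add: Zero_fract_def)

lemma has_const_term_const: "has_const_term (const x) x"
  unfolding has_const_term_def const_def by auto

lemma has_const_term_add:
  assumes "has_const_term p x" "has_const_term q y"
  shows "has_const_term (p + q) (x + y)"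
proof -
  obtain p' q' where "p = Fract p' 1" "Poly_Mapping.lookup p' 0 = x"
    "q = Fract q' 1" "Poly_Mapping.lookup q' 0 = y"
    using assms unfolding has_const_term_def by blast
  then show ?thesis
    unfolding has_const_term_def by (intro exI[of _ "p' + q'"]) (simp add: lookup_add)
qed

lemma has_const_term_sum:
  "(\<And>i. i \<in> A \<Longrightarrow> has_const_term (f i) (g i)) \<Longrightarrow> has_const_term (sum f A) (sum g A)"
  by (induction A rule: infinite_finite_induct)
    (simp_all add: has_const_term_0 has_const_term_add)

lemma has_const_term_const_mult: 
  assumes "has_const_term p x" shows "has_const_term (const c * p) (c * x)"
proof -
  obtain q where "p = Fract q 1" "Poly_Mapping.lookup q 0 = x"
    using assms unfolding has_const_term_def by blast
  then show ?thesis
    unfolding has_const_term_def const_def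
    by (intro exI[of _ "Poly_Mapping.single 0 c * q"])
      (simp flip: mult_map_scale_conv_mult add: map.rep_eq when_def)
qed

lemma has_const_term_param: "has_const_term (param \<kappa> x) 0"
proof -
  have "Poly_Mapping.single (\<kappa> x) (1::nat) \<noteq> 0"
    by (metis lookup_single_eq lookup_zero one_neq_zero)
  then show ?thesis
    unfolding has_const_term_def param_def
    by (intro exI[of _ "Poly_Mapping.single (Poly_Mapping.single (\<kappa> x) 1) 1"])
      (simp add: lookup_single_not_eq)
qed

lemma has_const_term_param_mult: "has_const_term (param \<kappa> x * const r) 0"
  using has_const_term_const_mult[OF has_const_term_param, of r] by (simp add: mult.commute)

section \<open>Reflections and positive roots\<close>

lemma coroot_minus [simp]: "coroot (- x) = - coroot x"
  by (simp add: coroot_def)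

lemma coroot_inner_self: "x \<noteq> 0 \<Longrightarrow> coroot x \<bullet> x = 2"
  by (simp add: coroot_def)

lemma coroot_inner: "coroot x \<bullet> y = 2 * (x \<bullet> y) / (x \<bullet> x)"
  by (simp add: coroot_def)

lemma coroot_coroot [simp]: "coroot (coroot x) = x"
  by (cases "x = 0") (simp_all add: coroot_def)

lemma coroot_inner_pos_iff: "x \<noteq> 0 \<Longrightarrow> coroot x \<bullet> y > 0 \<longleftrightarrow> x \<bullet> y > 0"
  by (simp add: coroot_inner zero_less_divide_iff) (metis inner_ge_zero not_less)

lemma coroot_inner_nonneg_iff: "x \<noteq> 0 \<Longrightarrow> coroot x \<bullet> y \<ge> 0 \<longleftrightarrow> x \<bullet> y \<ge> 0"
  using coroot_inner_pos_iff[of x "- y"] by (simp add: not_less flip: not_less)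

lemma coroot_inner_eq_0_iff: "x \<noteq> 0 \<Longrightarrow> coroot x \<bullet> y = 0 \<longleftrightarrow> x \<bullet> y = 0"
  by (simp add: coroot_inner)

lemma reflection_minus [simp]: "reflection (- x) = reflection x"
  by (auto simp: reflection_def)

lemma reflection_self [simp]: "reflection x x = - x"
  by (cases "x = 0") (simp_all add: reflection_def coroot_inner_self scaleR_2)

lemma linear_reflection: "linear (reflection x)"
  by (rule linearI) (simp_all add: reflection_def algebra_simps)

lemmas reflection_add = linear_add[OF linear_reflection]
  and reflection_diff = linear_diff[OF linear_reflection]
  and reflection_uminus = linear_neg[OF linear_reflection]
  and reflection_scaleR = linear_cmul[OF linear_reflection]

lemma reflection_reflection [simp]: "reflection x (reflection x y) = y"
  by (cases "x = 0") (simp_all add: reflection_def inner_diff_right coroot_inner_self algebra_simps)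

lemma inner_reflection_reflection [simp]: "reflection x y \<bullet> reflection x z = y \<bullet> z"
proof (cases "x = 0")
  case False
  then show ?thesis
    by (simp add: reflection_def coroot_def inner_diff_right inner_diff_left inner_commute field_simps)
qed (simp add: reflection_def)

lemma inner_reflection_swap: "reflection x y \<bullet> z = y \<bullet> reflection x z"
  using inner_reflection_reflection[of x "reflection x y" z] by simp

lemma coroot_reflection: "coroot (reflection x y) = reflection x (coroot y)"
  by (simp add: coroot_def reflection_scaleR)

lemma norm_reflection [simp]: "norm (reflection x y) = norm y"
  by (simp add: norm_eq_sqrt_inner)

lemma reflection_eq_self_iff: "reflection x y = y \<longleftrightarrow> x \<bullet> y = 0"
  by (cases "x = 0") (auto simp: reflection_def coroot_inner)

locale weyl_data =
  fixes R :: "'a::euclidean_space set" and \<alpha> :: "nat \<Rightarrow> 'a" and \<kappa> :: "'a \<Rightarrow> 'i::linorder"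
  assumes root_system: "root_system R"
    and irreducible: "irreducible_roots R"
    and simple: "simple_roots R \<alpha>"
    and labelling: "orbit_labelling R \<alpha> \<kappa>"
begin

abbreviation pos :: "'a set" where "pos \<equiv> pos_roots R \<alpha>"
abbreviation wts :: "'a set" where "wts \<equiv> weight_lattice R"

lemma finite_R: "finite R" and zero_notin_R: "0 \<notin> R"
  and coroot_Ints: "x \<in> R \<Longrightarrow> y \<in> R \<Longrightarrow> coroot x \<bullet> y \<in> \<int>"
  and multiple_root: "x \<in> R \<Longrightarrow> t *\<^sub>R x \<in> R \<Longrightarrow> t = 1 \<or> t = -1"
  and span_R: "span R = UNIV"
  and reflection_image: "x \<in> R \<Longrightarrow> reflection x ` R = R"
  using root_system unfolding root_system_def by blast+

lemma reflection_root: "x \<in> R \<Longrightarrow> y \<in> R \<Longrightarrow> reflection x y \<in> R"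
  using reflection_image by blast

lemma uminus_root: "x \<in> R \<Longrightarrow> - x \<in> R"
  using reflection_root[of x x] by simp

section \<open>Coordinates with respect to the simple roots\<close>

definition idx :: "nat set" where "idx = {1..DIM('a)}"

lemma finite_idx [simp]: "finite idx"
  by (simp add: idx_def)

lemma nonneg_comb_def': "nonneg_comb \<alpha> x \<longleftrightarrow> (\<exists>c::nat \<Rightarrow> nat. x = (\<Sum>i\<in>idx. real (c i) *\<^sub>R \<alpha> i))"
  unfolding nonneg_comb_def idx_def ..

lemma simple_root: "i \<in> idx \<Longrightarrow> \<alpha> i \<in> R"
  and inj_simple: "inj_on \<alpha> idx"
  and independent_simple: "independent (\<alpha> ` idx)"
  and root_sign: "x \<in> R \<Longrightarrow> nonneg_comb \<alpha> x \<or> nonneg_comb \<alpha> (- x)"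
  using simple unfolding simple_roots_def idx_def by blast+

lemma span_simple: "span (\<alpha> ` idx) = UNIV"
proof -
  have "card (\<alpha> ` idx) = DIM('a)"
    using inj_simple by (simp add: card_image) (simp add: idx_def)
  then have "UNIV \<subseteq> span (\<alpha> ` idx)"
    by (intro card_ge_dim_independent[OF _ independent_simple]) auto
  then show ?thesis by blast
qed

definition coef :: "nat \<Rightarrow> 'a \<Rightarrow> real" where
  "coef i x = representation (\<alpha> ` idx) x (\<alpha> i)"

lemma linear_coef: "linear (coef i)"
  unfolding coef_def
  by (rule linearI) (simp_all add: representation_add representation_scale independent_simple span_simple)

lemmas coef_add = linear_add[OF linear_coef]
  and coef_diff = linear_diff[OF linear_coef]
  and coef_uminus = linear_neg[OF linear_coef]
  and coef_scaleR = linear_cmul[OF linear_coef, simplified]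
  and coef_sum = linear_sum[OF linear_coef]
  and coef_0 = linear_0[OF linear_coef]

lemma coef_simple:
  "i \<in> idx \<Longrightarrow> j \<in> idx \<Longrightarrow> coef i (\<alpha> j) = (if i = j then 1 else 0)"
  unfolding coef_def using representation_basis[OF independent_simple, of "\<alpha> j"] inj_simple
  by (auto simp: inj_on_def)

lemma coef_expand: "(\<Sum>i\<in>idx. coef i x *\<^sub>R \<alpha> i) = x"
proof -
  have "(\<Sum>b\<in>\<alpha> ` idx. representation (\<alpha> ` idx) x b *\<^sub>R b) = x"
    by (rule sum_representation_eq) (auto simp: independent_simple span_simple)
  then show ?thesis
    by (simp add: coef_def sum.reindex[OF inj_simple])
qed

lemma inner_coef: "x \<bullet> y = (\<Sum>i\<in>idx. coef i x * (\<alpha> i \<bullet> y))"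
  by (subst coef_expand[of x, symmetric]) (simp add: inner_sum_left)

lemma coef_comb:
  "j \<in> idx \<Longrightarrow> coef j (\<Sum>i\<in>idx. c i *\<^sub>R \<alpha> i) = c j"
  by (simp add: coef_sum coef_scaleR coef_simple if_distrib[of "\<lambda>x. _ * x"] sum.delta cong: if_cong)

lemma nonneg_comb_iff: "nonneg_comb \<alpha> x \<longleftrightarrow> (\<forall>i\<in>idx. coef i x \<in> \<nat>)"
proof
  assume "nonneg_comb \<alpha> x"
  then show "\<forall>i\<in>idx. coef i x \<in> \<nat>"
    unfolding nonneg_comb_def' by (auto simp del: sum.cl_ivl_Suc simp: coef_comb)
next
  assume *: "\<forall>i\<in>idx. coef i x \<in> \<nat>"
  have "x = (\<Sum>i\<in>idx. real (nat \<lfloor>coef i x\<rfloor>) *\<^sub>R \<alpha> i)"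
    by (subst coef_expand[of x, symmetric], rule sum.cong)
      (use * in \<open>auto elim!: Nats_cases\<close>)
  then show "nonneg_comb \<alpha> x"
    unfolding nonneg_comb_def' by (intro exI)
qed

lemma nonneg_comb_0: "nonneg_comb \<alpha> 0"
  by (simp add: nonneg_comb_iff coef_0)

lemma nonneg_comb_add: "nonneg_comb \<alpha> x \<Longrightarrow> nonneg_comb \<alpha> y \<Longrightarrow> nonneg_comb \<alpha> (x + y)"
  by (simp add: nonneg_comb_iff coef_add)

lemma nonneg_comb_scale: "nonneg_comb \<alpha> x \<Longrightarrow> r \<in> \<nat> \<Longrightarrow> nonneg_comb \<alpha> (r *\<^sub>R x)"
  by (simp add: nonneg_comb_iff coef_scaleR)

lemma nonneg_comb_sum:
  "(\<And>i. i \<in> A \<Longrightarrow> nonneg_comb \<alpha> (f i)) \<Longrightarrow> nonneg_comb \<alpha> (sum f A)"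
  by (induction A rule: infinite_finite_induct) (simp_all add: nonneg_comb_0 nonneg_comb_add)

lemma nonneg_comb_coef_nonneg:
  "nonneg_comb \<alpha> x \<Longrightarrow> i \<in> idx \<Longrightarrow> coef i x \<ge> 0"
  unfolding nonneg_comb_iff by (auto elim!: Nats_cases)

lemma nonneg_comb_antisym: "nonneg_comb \<alpha> x \<Longrightarrow> nonneg_comb \<alpha> (- x) \<Longrightarrow> x = 0"
  using nonneg_comb_coef_nonneg[of x] nonneg_comb_coef_nonneg[of "- x"]
  by (subst coef_expand[symmetric], intro sum.neutral) (fastforce simp: coef_uminus)

lemma finite_pos: "finite pos"
  using finite_R by (auto simp: pos_roots_def)

lemma posD: "x \<in> pos \<Longrightarrow> x \<in> R" "x \<in> pos \<Longrightarrow> nonneg_comb \<alpha> x"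
  by (simp_all add: pos_roots_def)

lemma pos_nonzero: "x \<in> pos \<Longrightarrow> x \<noteq> 0"
  using zero_notin_R posD by blast

lemma simple_pos: "i \<in> idx \<Longrightarrow> \<alpha> i \<in> pos"
  by (simp add: pos_roots_def simple_root nonneg_comb_iff coef_simple)

lemma simple_nonzero: "i \<in> idx \<Longrightarrow> \<alpha> i \<noteq> 0"
  using simple_pos pos_nonzero by blast

lemma pos_or_neg: "x \<in> R \<Longrightarrow> x \<in> pos \<or> - x \<in> pos"
  using root_sign uminus_root by (auto simp: pos_roots_def)

lemma pos_not_neg: "x \<in> pos \<Longrightarrow> - x \<notin> pos"
  using nonneg_comb_antisym pos_nonzero posD by blast

text \<open>All coordinates of a root have the same sign, so a single positive one decides.\<close>

lemma posI_coef: "x \<in> R \<Longrightarrow> i \<in> idx \<Longrightarrow> coef i x > 0 \<Longrightarrow> x \<in> pos"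
  using pos_or_neg[of x] nonneg_comb_coef_nonneg[of "- x" i] posD(2) by (force simp: coef_uminus)

text \<open>Simple roots are positive and positive roots are combinations of simple ones. Dominance
  thereby becomes a condition on coordinates.\<close>

lemma sum_of_pos_roots_iff: "sum_of_pos_roots R \<alpha> x \<longleftrightarrow> nonneg_comb \<alpha> x"
proof
  assume "sum_of_pos_roots R \<alpha> x"
  then show "nonneg_comb \<alpha> x"
    unfolding sum_of_pos_roots_def
    using posD(2) by (auto intro!: nonneg_comb_sum nonneg_comb_scale)
next
  assume "nonneg_comb \<alpha> x"
  then obtain c :: "nat \<Rightarrow> nat" where x: "x = (\<Sum>i\<in>idx. real (c i) *\<^sub>R \<alpha> i)"
    unfolding nonneg_comb_def' by blast
  define d where "d y = (if y \<in> \<alpha> ` idx then c (inv_into idx \<alpha> y) else 0)" for y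
  have "(\<Sum>y\<in>pos. real (d y) *\<^sub>R y) = (\<Sum>y\<in>\<alpha> ` idx. real (d y) *\<^sub>R y)"
    by (rule sum.mono_neutral_right) (use finite_pos simple_pos in \<open>auto simp: d_def\<close>)
  also have "\<dots> = x"
    unfolding x by (subst sum.reindex[OF inj_simple])
      (auto simp: d_def inv_into_f_f[OF inj_simple] intro!: sum.cong)
  finally show "sum_of_pos_roots R \<alpha> x"
    unfolding sum_of_pos_roots_def by metis
qed

text \<open>The height of a root, extended linearly to all vectors. It separates weights of equal
  norm and drives the inductions over orbits; being real-valued, it enters those through the number
  of elements on one side of it.\<close>

definition ht :: "'a \<Rightarrow> real" where "ht x = (\<Sum>i\<in>idx. coef i x)"

lemma linear_ht: "linear ht"
  unfolding ht_def by (intro linear_compose_sum ballI linear_coef)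

lemmas ht_add = linear_add[OF linear_ht]
  and ht_diff = linear_diff[OF linear_ht]
  and ht_scaleR = linear_cmul[OF linear_ht, simplified]

lemma ht_pos: "x \<in> pos \<Longrightarrow> ht x > 0"
proof -
  assume x: "x \<in> pos"
  then obtain i where i: "i \<in> idx" "coef i x \<noteq> 0"
    using coef_expand[of x] pos_nonzero[OF x] by (metis (no_types, lifting) scale_eq_0_iff sum.neutral)
  then show ?thesis
    unfolding ht_def using nonneg_comb_coef_nonneg[OF posD(2)[OF x]]
    by (intro sum_pos2[OF _ i(1)]) (force simp: order_less_le)+
qed

text \<open>The reflection changes only the coordinate at \<open>i\<close>. A positive root other
  than \<open>\<alpha> i\<close> has another nonzero coordinate, since the only multiples of
  \<open>\<alpha> i\<close> in \<open>R\<close> are itself and its negative; that coordinate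
  survives and fixes the sign.\<close>

lemma simple_reflection_pos:
  assumes i: "i \<in> idx" and x: "x \<in> pos" "x \<noteq> \<alpha> i"
  shows "reflection (\<alpha> i) x \<in> pos"
proof -
  have "\<exists>j\<in>idx. j \<noteq> i \<and> coef j x \<noteq> 0"
  proof (rule ccontr)
    assume "\<not> ?thesis"
    then have "x = (\<Sum>j\<in>idx. if j = i then coef i x *\<^sub>R \<alpha> i else 0)"
      by (subst coef_expand[of x, symmetric], intro sum.cong) auto
    then have *: "x = coef i x *\<^sub>R \<alpha> i"
      using i by simp
    then have "coef i x = 1 \<or> coef i x = -1"
      using multiple_root[OF simple_root[OF i], of "coef i x"] posD(1)[OF x(1)] by metis
    then show False
      using * x nonneg_comb_coef_nonneg[OF posD(2)[OF x(1)] i] by auto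
  qed
  then obtain j where j: "j \<in> idx" "j \<noteq> i" "coef j x \<noteq> 0" by blast
  have "coef j (reflection (\<alpha> i) x) = coef j x"
    using i j by (simp add: reflection_def coef_diff coef_scaleR coef_simple)
  moreover have "coef j x > 0"
    using j nonneg_comb_coef_nonneg[OF posD(2)[OF x(1)]] by (force simp: order_less_le)
  ultimately show ?thesis
    using posI_coef[of _ j] reflection_root simple_root[OF i] posD(1)[OF x(1)] j by simp
qed

lemma simple_obtuse:
  assumes "i \<in> idx" "j \<in> idx" "i \<noteq> j"
  shows "\<alpha> i \<bullet> \<alpha> j \<le> 0"
proof -
  have "\<alpha> j \<noteq> \<alpha> i"
    using assms inj_simple by (auto dest: inj_onD)
  then have "reflection (\<alpha> i) (\<alpha> j) \<in> pos"
    using simple_reflection_pos simple_pos assms by blast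
  then have "coef i (reflection (\<alpha> i) (\<alpha> j)) \<ge> 0"
    using assms nonneg_comb_coef_nonneg posD by blast
  then have "coroot (\<alpha> i) \<bullet> \<alpha> j \<le> 0"
    using assms by (simp add: reflection_def coef_diff coef_scaleR coef_simple)
  then show ?thesis
    using coroot_inner_pos_iff[OF simple_nonzero[OF assms(1)], of "\<alpha> j"] by linarith
qed

lemma exists_simple_inner_pos:
  assumes "x \<in> pos" shows "\<exists>i\<in>idx. \<alpha> i \<bullet> x > 0"
proof (rule ccontr)
  assume "\<not> ?thesis"
  then have "x \<bullet> x \<le> 0"
    using nonneg_comb_coef_nonneg[OF posD(2)[OF assms]]
    by (subst inner_coef) (auto intro!: sum_nonpos mult_nonneg_nonpos simp: not_less)
  then show False
    using pos_nonzero[OF assms] by (metis inner_gt_zero_iff not_less)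
qed

end

section \<open>The finite Weyl group\<close>

lemma finite_has_max:
  fixes f :: "'b \<Rightarrow> real"
  assumes "finite A" "A \<noteq> {}"
  obtains y where "y \<in> A" "\<And>z. z \<in> A \<Longrightarrow> f z \<le> f y"
proof -
  have "Max (f ` A) \<in> f ` A"
    using assms by simp
  then obtain y where "y \<in> A" "f y = Max (f ` A)" by auto
  then show ?thesis
    using that assms by (metis Max_ge finite_imageI imageI)
qed

context weyl_data
begin

text \<open>The sign at index 0 brings all simple affine functions to the form
  \<open>(refl_off i, coroot (refl_vec i))\<close>, so that \<open>s\<^sub>0\<close> can be treated
  together with the finite reflections.\<close>

definition refl_vec :: "nat \<Rightarrow> 'a" where
  "refl_vec i = (if i = 0 then - highest_short_root R \<alpha> else \<alpha> i)"

definition refl_off :: "nat \<Rightarrow> real" where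
  "refl_off i = (if i = 0 then 1 else 0)"

abbreviation S :: "nat \<Rightarrow> 'a \<Rightarrow> 'a" where "S \<equiv> simple_refl R \<alpha>"
abbreviation W0 :: "('a \<Rightarrow> 'a) set" where "W0 \<equiv> finite_weyl R \<alpha>"
abbreviation wm :: "nat list \<Rightarrow> 'a \<Rightarrow> 'a" where "wm \<equiv> word_map R \<alpha>"

lemma simple_aff_eq: "simple_aff R \<alpha> i = (refl_off i, coroot (refl_vec i))"
  by (simp add: simple_aff_def refl_vec_def refl_off_def)

lemma S_eq: "S i x = reflection (refl_vec i) x - refl_off i *\<^sub>R refl_vec i"
  by (simp add: simple_refl_def aff_reflection_def simple_aff_eq aff_eval_def reflection_def
      scaleR_add_left inner_commute)

lemma zero_notin_idx: "0 \<notin> idx"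
  by (simp add: idx_def)

lemma S_idx: "i \<in> idx \<Longrightarrow> S i = reflection (\<alpha> i)"
  using zero_notin_idx by (auto simp: S_eq refl_vec_def refl_off_def fun_eq_iff)

lemma S_S [simp]: "S i (S i x) = x"
  by (simp add: S_eq reflection_diff reflection_scaleR)

lemma wm_Nil [simp]: "wm [] = id"
  by (simp add: word_map_def fun_eq_iff)

lemma wm_Cons [simp]: "wm (j # js) = S j \<circ> wm js"
  by (simp add: word_map_def)

lemma wm_append: "wm (js @ ks) = wm js \<circ> wm ks"
  by (induction js) (auto simp: fun_eq_iff)

lemma wm_rev: "wm js \<circ> wm (rev js) = id"
  by (induction js) (auto simp: fun_eq_iff wm_append)

lemma W0_def': "W0 = {wm js | js. set js \<subseteq> idx}"
  by (simp add: finite_weyl_def idx_def)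

lemma W0_id: "id \<in> W0"
  unfolding W0_def' using wm_Nil by (metis (mono_tags, lifting) empty_set empty_subsetI mem_Collect_eq)

lemma W0_comp: "v \<in> W0 \<Longrightarrow> w \<in> W0 \<Longrightarrow> v \<circ> w \<in> W0"
  unfolding W0_def' by clarify (metis Un_least set_append wm_append)

lemma W0_simple: "i \<in> idx \<Longrightarrow> reflection (\<alpha> i) \<in> W0"
  unfolding W0_def' by (intro CollectI exI[of _ "[i]"]) (simp add: S_idx)

lemma W0_inverse: "w \<in> W0 \<Longrightarrow> \<exists>v\<in>W0. v \<circ> w = id \<and> w \<circ> v = id"
proof -
  assume "w \<in> W0"
  then obtain js where "w = wm js" "set js \<subseteq> idx"
    by (auto simp: W0_def')
  moreover from this have "wm (rev js) \<in> W0"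
    unfolding W0_def' by (intro CollectI exI[of _ "rev js"]) simp
  ultimately show ?thesis
    using wm_rev[of js] wm_rev[of "rev js"] by (intro bexI[of _ "wm (rev js)"]) simp_all
qed

lemma W0_induct [consumes 1, case_names id step]:
  assumes "w \<in> W0" "P id" "\<And>i w. i \<in> idx \<Longrightarrow> w \<in> W0 \<Longrightarrow> P w \<Longrightarrow> P (reflection (\<alpha> i) \<circ> w)"
  shows "P w"
proof -
  have "P (wm js)" if "set js \<subseteq> idx" for js
    using that
  proof (induction js)
    case (Cons j js)
    then have "P (reflection (\<alpha> j) \<circ> wm js)"
      by (intro assms(3)) (auto simp: W0_def')
    then show ?case
      using Cons.prems by (simp add: S_idx o_def)
  qed (simp add: assms(2))
  then show ?thesis
    using assms(1) by (auto simp: W0_def')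
qed

lemma W0_linear: "w \<in> W0 \<Longrightarrow> linear w"
proof (induction rule: W0_induct)
  case (step i w)
  then show ?case by (intro linear_compose linear_reflection)
qed (rule linear_id)

lemma W0_inner: "w \<in> W0 \<Longrightarrow> w x \<bullet> w y = x \<bullet> y"
  by (induction rule: W0_induct) auto

lemma W0_norm: "w \<in> W0 \<Longrightarrow> norm (w x) = norm x"
  by (simp add: norm_eq_sqrt_inner W0_inner)

lemma W0_root: "w \<in> W0 \<Longrightarrow> x \<in> R \<Longrightarrow> w x \<in> R"
  by (induction rule: W0_induct) (auto intro: reflection_root simple_root)

lemma W0_coroot: "w \<in> W0 \<Longrightarrow> coroot (w x) = w (coroot x)"
  by (induction rule: W0_induct) (auto simp: coroot_reflection)

lemma W0_inj: "w \<in> W0 \<Longrightarrow> inj w"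
  using W0_inverse by (metis comp_eq_dest_lhs id_apply injI comp_def)

lemma wts_coroot_Ints: "x \<in> wts \<Longrightarrow> y \<in> R \<Longrightarrow> coroot y \<bullet> x \<in> \<int>"
  by (simp add: weight_lattice_def)

lemma wts_add: "x \<in> wts \<Longrightarrow> y \<in> wts \<Longrightarrow> x + y \<in> wts"
  by (simp add: weight_lattice_def inner_add_right)

lemma wts_diff: "x \<in> wts \<Longrightarrow> y \<in> wts \<Longrightarrow> x - y \<in> wts"
  by (simp add: weight_lattice_def inner_diff_right)

lemma wts_scale: "x \<in> wts \<Longrightarrow> r \<in> \<int> \<Longrightarrow> r *\<^sub>R x \<in> wts"
  by (simp add: weight_lattice_def)

lemma root_wts: "x \<in> R \<Longrightarrow> x \<in> wts"
  by (simp add: weight_lattice_def coroot_Ints)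

lemma wts_reflection: "x \<in> wts \<Longrightarrow> y \<in> R \<Longrightarrow> reflection y x \<in> wts"
  unfolding reflection_def by (intro wts_diff wts_scale wts_coroot_Ints root_wts[of y])

lemma wts_W0: "w \<in> W0 \<Longrightarrow> x \<in> wts \<Longrightarrow> w x \<in> wts"
  by (induction rule: W0_induct) (auto intro: wts_reflection simple_root)

text \<open>The elements are linear and \<open>R\<close> spans, so each is determined by its
  restriction to the finite set \<open>R\<close>, which it maps into itself.\<close>

lemma finite_W0: "finite W0"
proof (rule finite_imageD)
  show "finite ((\<lambda>w. restrict w R) ` W0)"
    by (rule finite_subset[OF _ finite_PiE[OF finite_R, of "\<lambda>_. R"]])
      (auto simp: finite_R W0_root)
  show "inj_on (\<lambda>w. restrict w R) W0"
  proof (rule inj_onI)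
    fix v w assume vw: "v \<in> W0" "w \<in> W0" "restrict v R = restrict w R"
    then have "v x = w x" if "x \<in> R" for x
      using that by (metis restrict_apply')
    then show "v = w"
      using linear_eq_on_span[OF W0_linear[OF vw(1)] W0_linear[OF vw(2)], of R] span_R by auto
  qed
qed

text \<open>Unless the root is simple, a simple reflection with positive pairing lowers its height
  and keeps it positive.\<close>

lemma pos_W0_conj_simple: "x \<in> pos \<Longrightarrow> \<exists>w\<in>W0. \<exists>i\<in>idx. x = w (\<alpha> i)"
proof (induction "card {y\<in>pos. ht y < ht x}" arbitrary: x rule: less_induct)
  case less
  obtain i where i: "i \<in> idx" "\<alpha> i \<bullet> x > 0"
    using exists_simple_inner_pos less by blast
  show ?case
  proof (cases "x = \<alpha> i")
    case True
    then show ?thesis using i W0_id by (metis id_apply)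
  next
    case False
    define y where "y = reflection (\<alpha> i) x"
    have y: "y \<in> pos"
      using simple_reflection_pos i less False by (simp add: y_def)
    have "ht y = ht x - (coroot (\<alpha> i) \<bullet> x) * ht (\<alpha> i)"
      by (simp add: y_def reflection_def ht_diff ht_scaleR)
    moreover have "(coroot (\<alpha> i) \<bullet> x) * ht (\<alpha> i) > 0"
      using i by (intro mult_pos_pos ht_pos simple_pos) (simp add: coroot_inner_pos_iff simple_nonzero)
    ultimately have lt: "ht y < ht x" by simp
    have "{z\<in>pos. ht z < ht y} \<subset> {z\<in>pos. ht z < ht x}"
      using lt y by fastforce
    then have "card {z\<in>pos. ht z < ht y} < card {z\<in>pos. ht z < ht x}"
      by (intro psubset_card_mono) (simp_all add: finite_pos)
    then obtain w j where "w \<in> W0" "j \<in> idx" "y = w (\<alpha> j)"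
      using less(1) y by blast
    moreover have "x = reflection (\<alpha> i) y"
      by (simp add: y_def)
    ultimately show ?thesis
      using W0_comp[OF W0_simple[OF i(1)]] by (metis comp_apply)
  qed
qed

lemma W0_reflection_conj: "w \<in> W0 \<Longrightarrow> v \<in> W0 \<Longrightarrow> v \<circ> w = id \<Longrightarrow> w \<circ> v = id \<Longrightarrow>
    reflection (w x) = w \<circ> reflection x \<circ> v"
proof
  fix y
  assume *: "w \<in> W0" "v \<in> W0" "v \<circ> w = id" "w \<circ> v = id"
  then have [simp]: "w (v y) = y" by (metis comp_apply id_apply)
  have "w (coroot x) \<bullet> y = coroot x \<bullet> v y"
    using W0_inner[OF *(1), of "coroot x" "v y"] by simp
  then show "reflection (w x) y = (w \<circ> reflection x \<circ> v) y"
    using * by (simp add: reflection_def W0_coroot linear_diff[OF W0_linear] linear_cmul[OF W0_linear])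
qed

lemma reflection_W0: "x \<in> R \<Longrightarrow> reflection x \<in> W0"
proof -
  have "reflection x \<in> W0" if "x \<in> pos" for x
  proof -
    obtain w i where wi: "w \<in> W0" "i \<in> idx" "x = w (\<alpha> i)"
      using pos_W0_conj_simple[OF \<open>x \<in> pos\<close>] by blast
    then obtain v where "v \<in> W0" "v \<circ> w = id" "w \<circ> v = id"
      using W0_inverse by blast
    then show ?thesis
      using W0_reflection_conj[OF wi(1)] wi W0_simple W0_comp by metis
  qed
  then show "x \<in> R \<Longrightarrow> ?thesis"
    using pos_or_neg[of x] by force
qed

lemma label_W0: "x \<in> R \<Longrightarrow> w \<in> W0 \<Longrightarrow> \<kappa> (w x) = \<kappa> x"
  using labelling W0_root unfolding orbit_labelling_def finite_orbit_def
  by (metis (no_types, lifting) imageI)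

lemma label_reflection: "x \<in> R \<Longrightarrow> y \<in> R \<Longrightarrow> \<kappa> (reflection y x) = \<kappa> x"
  by (simp add: label_W0 reflection_W0)

lemma label_uminus: "x \<in> R \<Longrightarrow> \<kappa> (- x) = \<kappa> x"
  using label_reflection[of x x] by simp

lemma param_W0: "x \<in> R \<Longrightarrow> w \<in> W0 \<Longrightarrow> param \<kappa> (w x) = param \<kappa> x"
  by (simp add: param_def label_W0)

lemma param_uminus: "x \<in> R \<Longrightarrow> param \<kappa> (- x) = param \<kappa> x"
  by (simp add: param_def label_uminus)

section \<open>Dominant weights and orbits of the finite Weyl group\<close>

definition dominant :: "'a \<Rightarrow> bool" where
  "dominant x \<longleftrightarrow> (\<forall>i\<in>idx. \<alpha> i \<bullet> x \<ge> 0)"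

lemma dominant_nonneg_comb: "dominant x \<Longrightarrow> nonneg_comb \<alpha> y \<Longrightarrow> y \<bullet> x \<ge> 0"
  by (subst inner_coef) (auto simp: dominant_def intro!: sum_nonneg mult_nonneg_nonneg nonneg_comb_coef_nonneg)

lemma dominant_pos: "dominant x \<Longrightarrow> y \<in> pos \<Longrightarrow> y \<bullet> x \<ge> 0"
  using dominant_nonneg_comb posD by blast

lemma dominant_weights_iff: "x \<in> dominant_weights R \<alpha> \<longleftrightarrow> x \<in> wts \<and> dominant x"
proof -
  have "(\<forall>y\<in>pos. coroot y \<bullet> x \<ge> 0) \<longleftrightarrow> dominant x"
    using dominant_pos[of x] simple_pos coroot_inner_nonneg_iff pos_nonzero
    unfolding dominant_def by metis
  then show ?thesis
    by (simp add: dominant_weights_def)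
qed

text \<open>Following \<open>\<alpha> i\<close> through the word from the right, some letter
  \<open>j\<close> makes its image negative. Just before, the image must be
  \<open>\<alpha> j\<close>, the only positive root that \<open>j\<close> makes negative. Hence that
  letter equals a conjugate of the reflection in \<open>\<alpha> i\<close> and can be
  deleted.\<close>

lemma exchange:
  assumes "i \<in> idx" "set js \<subseteq> idx" "- wm js (\<alpha> i) \<in> pos"
  shows "\<exists>ks. set ks \<subseteq> idx \<and> length ks < length js \<and> wm ks = wm js \<circ> reflection (\<alpha> i)"
  using assms(2,3)
proof (induction js)
  case Nil
  then show ?case
    using pos_not_neg simple_pos assms(1) by auto
next
  case (Cons j js)
  have w: "wm js \<in> W0"
    using Cons.prems by (auto simp: W0_def')
  show ?case
  proof (cases "wm js (\<alpha> i) \<in> pos")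
    case True
    have "wm js (\<alpha> i) = \<alpha> j"
    proof (rule ccontr)
      assume "wm js (\<alpha> i) \<noteq> \<alpha> j"
      then have "reflection (\<alpha> j) (wm js (\<alpha> i)) \<in> pos"
        using simple_reflection_pos True Cons.prems by simp
      then show False
        using Cons.prems pos_not_neg by (auto simp: S_idx)
    qed
    moreover obtain v where v: "v \<in> W0" "v \<circ> wm js = id" "wm js \<circ> v = id"
      using W0_inverse[OF w] by blast
    ultimately have "S j = wm js \<circ> reflection (\<alpha> i) \<circ> v"
      using W0_reflection_conj[OF w v, of "\<alpha> i"] Cons.prems by (simp add: S_idx)
    then have "wm (j # js) \<circ> reflection (\<alpha> i) = wm js"
      using v(2) by (auto simp: fun_eq_iff)
    then show ?thesis
      using Cons.prems by (intro exI[of _ js]) (auto simp: fun_eq_iff)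
  next
    case False
    then have "- wm js (\<alpha> i) \<in> pos"
      using pos_or_neg W0_root[OF w] simple_root assms(1) by blast
    moreover have "set js \<subseteq> idx"
      using Cons.prems by simp
    ultimately obtain ks where
        "set ks \<subseteq> idx" "length ks < length js" "wm ks = wm js \<circ> reflection (\<alpha> i)"
      using Cons.IH by blast
    then show ?thesis
      using Cons.prems by (intro exI[of _ "j # ks"]) (auto simp: fun_eq_iff)
  qed
qed

text \<open>Induction on the length of a word for \<open>w\<close>. Its last letter either fixes
  \<open>x\<close> and is dropped, or the exchange property yields a shorter word for the same
  element.\<close>

lemma dominant_orbit_unique:
  assumes "w \<in> W0" "dominant x" "dominant (w x)"
  shows "w x = x"
proof -
  have "wm js x = x" if "set js \<subseteq> idx" "dominant (wm js x)" for js
    using that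
  proof (induction "length js" arbitrary: js rule: less_induct)
    case less
    show ?case
    proof (cases js rule: rev_cases)
      case (snoc ks i)
      have i: "i \<in> idx" "set ks \<subseteq> idx"
        using less snoc by auto
      have w: "wm js \<in> W0" "wm ks \<in> W0"
        using i less.prems unfolding W0_def' by blast+
      have js: "wm js = wm ks \<circ> reflection (\<alpha> i)"
        by (simp add: snoc wm_append S_idx i)
      show ?thesis
      proof (cases "\<alpha> i \<bullet> x = 0")
        case True
        then have "wm js x = wm ks x"
          using reflection_eq_self_iff[of "\<alpha> i" x] by (simp add: js)
        then show ?thesis
          using less snoc i by simp
      next
        case False
        then have "\<alpha> i \<bullet> x > 0"
          using assms(2) i(1) unfolding dominant_def by force
        then have *: "wm js (\<alpha> i) \<bullet> wm js x > 0"
          using W0_inner[OF w(1)] by simp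
        \<comment> \<open>A negative root cannot pair positively with the dominant vector
          \<open>wm js x\<close>. So the image of \<open>\<alpha> i\<close> under the whole word is
          positive, and under \<open>ks\<close> negative, as \<open>exchange\<close>
          requires.\<close>
        have "- wm js (\<alpha> i) \<notin> pos"
          using * dominant_pos[OF less.prems(2), of "- wm js (\<alpha> i)"] by auto
        then have "- wm ks (\<alpha> i) \<in> pos"
          using pos_or_neg[OF W0_root[OF w(1) simple_root[OF i(1)]]]
          by (simp add: js linear_neg[OF W0_linear[OF w(2)]])
        then obtain ls where ls: "set ls \<subseteq> idx" "length ls < length ks"
          "wm ls = wm ks \<circ> reflection (\<alpha> i)"
          using exchange i by blast
        then have "wm ls x = x"
          using less.hyps[of ls] less.prems(2) snoc js by simp
        then show ?thesis
          using ls js by simp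
      qed
    qed simp
  qed
  then show ?thesis
    using assms by (auto simp: W0_def')
qed

abbreviation orb :: "'a \<Rightarrow> 'a set" where "orb \<equiv> finite_orbit R \<alpha>"

lemma orb_iff: "y \<in> orb x \<longleftrightarrow> (\<exists>w\<in>W0. y = w x)"
  by (auto simp: finite_orbit_def)

lemma finite_orb: "finite (orb x)"
  by (simp add: finite_orbit_def finite_W0)

lemma orb_self: "x \<in> orb x"
  unfolding orb_iff using W0_id by (metis id_apply)

lemma orb_W0: "w \<in> W0 \<Longrightarrow> y \<in> orb x \<Longrightarrow> w y \<in> orb x"
  unfolding orb_iff using W0_comp by (metis comp_apply)

lemma simple_reflection_ht_less:
  assumes "i \<in> idx" "\<alpha> i \<bullet> x < 0" shows "ht x < ht (reflection (\<alpha> i) x)"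
proof -
  have "coroot (\<alpha> i) \<bullet> x < 0"
    using assms(2) coroot_inner_nonneg_iff[OF simple_nonzero[OF assms(1)], of x] by linarith
  then have "(coroot (\<alpha> i) \<bullet> x) * ht (\<alpha> i) < 0"
    using ht_pos[OF simple_pos] assms by (simp add: mult_neg_pos)
  then show ?thesis
    by (simp add: reflection_def ht_diff ht_scaleR)
qed

lemma exists_dominant_orb: "\<exists>y\<in>orb x. dominant y"
proof -
  obtain y where y: "y \<in> orb x" "\<And>z. z \<in> orb x \<Longrightarrow> ht z \<le> ht y"
    by (rule finite_has_max[OF finite_orb[of x], of ht]) (use orb_self in auto)
  have "dominant y"
    unfolding dominant_def
  proof (rule ballI, rule ccontr)
    fix i assume i: "i \<in> idx" "\<not> \<alpha> i \<bullet> y \<ge> 0"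
    then have "ht y < ht (reflection (\<alpha> i) y)"
      by (intro simple_reflection_ht_less) auto
    then show False
      using y(2)[OF orb_W0[OF W0_simple[OF i(1)] y(1)]] by simp
  qed
  then show ?thesis using y by blast
qed

lemma dominant_orb_unique: "y \<in> orb x \<Longrightarrow> dominant x \<Longrightarrow> dominant y \<Longrightarrow> y = x"
  using dominant_orbit_unique by (auto simp: orb_iff)

text \<open>Each reflection in a simple root with negative pairing adds a non-negative integral
  multiple of that root and raises the height. The climb ends at a dominant element of the orbit,
  which is \<open>x\<close> by uniqueness.\<close>

lemma dominant_diff_orb:
  assumes "x \<in> wts" "dominant x" "y \<in> orb x"
  shows "nonneg_comb \<alpha> (x - y)"
  using assms(3)
proof (induction "card {z\<in>orb x. ht z > ht y}" arbitrary: y rule: less_induct)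
  case less
  show ?case
  proof (cases "dominant y")
    case True
    then show ?thesis
      using dominant_orb_unique[OF less(2) assms(2)] by (simp add: nonneg_comb_0)
  next
    case False
    then obtain i where i: "i \<in> idx" "\<alpha> i \<bullet> y < 0"
      by (auto simp: dominant_def not_le)
    define z where "z = reflection (\<alpha> i) y"
    have z: "z \<in> orb x" and lt: "ht y < ht z"
      using orb_W0[OF W0_simple[OF i(1)] less(2)] simple_reflection_ht_less[OF i]
      by (simp_all add: z_def)
    have "{u\<in>orb x. ht u > ht z} \<subset> {u\<in>orb x. ht u > ht y}"
      using lt z by fastforce
    then have "card {u\<in>orb x. ht u > ht z} < card {u\<in>orb x. ht u > ht y}"
      by (intro psubset_card_mono) (simp_all add: finite_orb)
    then have "nonneg_comb \<alpha> (x - z)"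
      using less(1) z by blast
    moreover have "nonneg_comb \<alpha> ((- (coroot (\<alpha> i) \<bullet> y)) *\<^sub>R \<alpha> i)"
    proof (rule nonneg_comb_scale)
      have "y \<in> wts"
        using less(2) assms(1) wts_W0 unfolding orb_iff by blast
      then have "coroot (\<alpha> i) \<bullet> y \<in> \<int>" 
        using wts_coroot_Ints simple_root i by blast
      moreover have "coroot (\<alpha> i) \<bullet> y \<le> 0"
        using i coroot_inner_pos_iff[OF simple_nonzero, of i y] by force
      ultimately show "- (coroot (\<alpha> i) \<bullet> y) \<in> \<nat>"
        by (simp add: Nats_altdef2)
      show "nonneg_comb \<alpha> (\<alpha> i)"
        using simple_pos[OF i(1)] posD by blast
    qed
    ultimately have "nonneg_comb \<alpha> ((x - z) + (- (coroot (\<alpha> i) \<bullet> y)) *\<^sub>R \<alpha> i)"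
      by (rule nonneg_comb_add)
    then show ?thesis
      by (simp add: z_def reflection_def algebra_simps)
  qed
qed

end

section \<open>The highest short root\<close>

context weyl_data
begin

text \<open>Connectedness of the Dynkin diagram. If \<open>J\<close> is orthogonal to its
  complement, the roots supported on \<open>J\<close> and those supported off \<open>J\<close> form
  a union stable under simple reflections. It contains the simple roots, hence all roots, and would
  contradict irreducibility.\<close>

lemma root_decomposition:
  assumes "J \<subseteq> idx" "\<And>i j. i \<in> J \<Longrightarrow> j \<in> idx - J \<Longrightarrow> \<alpha> i \<bullet> \<alpha> j = 0"
  shows "J = {} \<or> J = idx"
proof (rule ccontr)
  assume J: "\<not> ?thesis"
  define A where "A = {x\<in>R. \<forall>j\<in>idx - J. coef j x = 0}"
  define B where "B = {x\<in>R. \<forall>j\<in>J. coef j x = 0}"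
  have orth: "\<alpha> i \<bullet> x = 0" if "x \<in> A" "i \<in> idx - J" for x i
    using that assms(2)[of _ i]
    by (subst inner_commute, subst inner_coef) (auto simp: A_def intro!: sum.neutral)
  have orth': "\<alpha> i \<bullet> x = 0" if "x \<in> B" "i \<in> J" for x i
    using that assms(2)[of i]
    by (subst inner_commute, subst inner_coef) (auto simp: B_def inner_commute intro!: sum.neutral)
  have closed: "w x \<in> A \<union> B" if "w \<in> W0" "x \<in> A \<union> B" for w x
    using that
  proof (induction rule: W0_induct)
    case (step i w)
    then consider "w x \<in> A" "i \<in> J" | "w x \<in> A" "i \<in> idx - J" | "w x \<in> B" "i \<in> J"
      | "w x \<in> B" "i \<in> idx - J" by blast
    then show ?case
    proof cases
      case 1
      then show ?thesis
        using reflection_root simple_root step(1) assms(1)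
        by (auto simp: A_def reflection_def coef_diff coef_scaleR coef_simple)
    next
      case 2
      then show ?thesis using 2 reflection_eq_self_iff[THEN iffD2, OF orth[OF 2]] by simp
    next
      case 3
      then show ?thesis using 3 reflection_eq_self_iff[THEN iffD2, OF orth'[OF 3]] by simp
    next
      case 4
      then show ?thesis
        using reflection_root simple_root step(1) assms(1)
        by (auto simp: B_def reflection_def coef_diff coef_scaleR coef_simple subset_iff)
    qed
  qed simp
  have simp_AB: "\<alpha> i \<in> A \<union> B" if "i \<in> idx" for i
    using that assms(1) by (auto simp: A_def B_def simple_root coef_simple subset_iff)
  have 1: "x \<in> A \<union> B" if "x \<in> pos" for x
    using pos_W0_conj_simple[OF that] closed simp_AB by blast
  have 2: "- x \<in> A \<union> B" if "x \<in> A \<union> B" for x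
    using that by (auto simp: A_def B_def coef_uminus uminus_root)
  have "x \<in> A \<union> B" if "x \<in> R" for x
    using pos_or_neg[OF that] 1[of x] 1[of "- x"] 2[of "- x"] by auto
  then have "A \<union> B = R"
    by (auto simp: A_def B_def)
  moreover have "A \<inter> B = {}"
  proof -
    have "x = 0" if "x \<in> A" "x \<in> B" for x
      using that by (subst coef_expand[symmetric]) (auto simp: A_def B_def intro!: sum.neutral)
    then show ?thesis
      using zero_notin_R by (auto simp: A_def)
  qed
  moreover have "x \<bullet> y = 0" if "x \<in> A" "y \<in> B" for x y
    using that orth'[OF that(2)] by (subst inner_coef) (auto simp: A_def intro!: sum.neutral)
  moreover have "A \<noteq> {}" "B \<noteq> {}"
  proof -
    obtain i j where "i \<in> J" "j \<in> idx - J"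
      using J assms(1) by blast
    then have "\<alpha> i \<in> A" "\<alpha> j \<in> B"
      using assms(1) by (auto simp: A_def B_def simple_root coef_simple subset_iff)
    then show "A \<noteq> {}" "B \<noteq> {}" by blast+
  qed
  ultimately have
    "\<exists>A B. A \<noteq> {} \<and> B \<noteq> {} \<and> A \<inter> B = {} \<and> A \<union> B = R \<and> (\<forall>x\<in>A. \<forall>y\<in>B. x \<bullet> y = 0)"
    by (intro exI[of _ A] exI[of _ B] conjI ballI)
  then show False
    using irreducible unfolding irreducible_roots_def by simp
qed

lemma dominant_root_pos: "x \<in> R \<Longrightarrow> dominant x \<Longrightarrow> x \<in> pos"
  using pos_or_neg[of x] dominant_pos[of x "- x"] zero_notin_R
  by (metis inner_gt_zero_iff inner_minus_left neg_0_le_iff_le not_less)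

text \<open>For \<open>i\<close> with vanishing coordinate, the pairing of \<open>x\<close> with
  \<open>\<alpha> i\<close> is non-negative by dominance and a sum of non-positive terms by
  obtuseness. All terms vanish, so such indices are orthogonal to the others.\<close>

lemma dominant_root_coef_pos:
  assumes x: "x \<in> R" "dominant x" and "i \<in> idx"
  shows "coef i x > 0"
proof -
  have nn: "coef j x \<ge> 0" if "j \<in> idx" for j
    using nonneg_comb_coef_nonneg that posD(2) dominant_root_pos x by blast
  define J where "J = {i\<in>idx. coef i x = 0}"
  have "\<alpha> i \<bullet> \<alpha> j = 0" if ij: "i \<in> J" "j \<in> idx - J" for i j
  proof -
    have le: "coef j x * (\<alpha> j \<bullet> \<alpha> i) \<le> 0" if "j \<in> idx" for j
      using that nn[of j] simple_obtuse[of j i] ij(1)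
      by (cases "j = i") (auto simp: J_def intro: mult_nonneg_nonpos)
    have "0 \<le> (\<Sum>j\<in>idx. coef j x * (\<alpha> j \<bullet> \<alpha> i))"
      using x(2) ij by (subst inner_coef[symmetric]) (auto simp: dominant_def inner_commute J_def)
    moreover have "(\<Sum>j\<in>idx. coef j x * (\<alpha> j \<bullet> \<alpha> i)) \<le> coef j x * (\<alpha> j \<bullet> \<alpha> i)"
      using ij le by (subst sum.remove[of _ j]) (auto intro!: sum_nonpos)
    ultimately have "coef j x * (\<alpha> j \<bullet> \<alpha> i) \<ge> 0"
      by (rule order_trans)
    then have "coef j x * (\<alpha> j \<bullet> \<alpha> i) = 0"
      using le[of j] ij(2) by (intro antisym) auto
    then show ?thesis
      using ij by (simp add: J_def inner_commute)
  qed
  then have "J = {} \<or> J = idx"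
    by (intro root_decomposition) (auto simp: J_def)
  moreover have "J \<noteq> idx"
  proof
    assume "J = idx"
    then have "x = 0"
      by (subst coef_expand[symmetric]) (auto simp: J_def intro!: sum.neutral)
    then show False using x zero_notin_R by simp
  qed
  ultimately show ?thesis
    using nn[OF \<open>i \<in> idx\<close>] \<open>i \<in> idx\<close> by (force simp: J_def)
qed

lemma dominant_root_inner_pos:
  assumes x: "x \<in> R" "dominant x" and y: "dominant y" "y \<noteq> 0"
  shows "x \<bullet> y > 0"
proof -
  have "\<exists>i\<in>idx. \<alpha> i \<bullet> y \<noteq> 0"
  proof (rule ccontr)
    assume "\<not> ?thesis"
    then have "y \<bullet> y = 0"
      by (subst inner_coef) (auto intro!: sum.neutral)
    then show False using y by simp
  qed
  then obtain i where i: "i \<in> idx" "\<alpha> i \<bullet> y > 0"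
    using y(1) unfolding dominant_def by force
  have "(\<Sum>j\<in>idx. coef j x * (\<alpha> j \<bullet> y)) > 0"
    using i y(1) dominant_root_coef_pos[OF x]
    by (intro sum_pos2[of _ i]) (auto simp: dominant_def less_imp_le)
  then show ?thesis
    by (subst inner_coef)
qed

text \<open>Cauchy-Schwarz is strict, because equality would make \<open>y\<close> a multiple of
  \<open>x\<close>. By integrality only -1, 0 and 1 remain.\<close>

lemma coroot_short_bound:
  assumes "x \<in> R" "y \<in> R" "norm y \<le> norm x" "y \<noteq> x" "y \<noteq> - x"
  shows "\<bar>coroot x \<bullet> y\<bar> < 2"
proof -
  have "x \<noteq> 0" "y \<noteq> 0" using assms zero_notin_R by auto
  have "\<bar>x \<bullet> y\<bar> \<noteq> norm x * norm y"
  proof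
    assume "\<bar>x \<bullet> y\<bar> = norm x * norm y"
    then have "norm x *\<^sub>R y = norm y *\<^sub>R x \<or> norm x *\<^sub>R y = - norm y *\<^sub>R x"
      by (simp only: norm_cauchy_schwarz_abs_eq)
    then obtain s where "norm x *\<^sub>R y = s *\<^sub>R x" by blast
    then have "inverse (norm x) *\<^sub>R (norm x *\<^sub>R y) = inverse (norm x) *\<^sub>R (s *\<^sub>R x)"
      by simp
    then obtain t where "y = t *\<^sub>R x"
      using \<open>x \<noteq> 0\<close> by simp
    then show False
      using multiple_root[of x t] assms by auto
  qed
  then have "\<bar>x \<bullet> y\<bar> < norm x * norm y"
    using Cauchy_Schwarz_ineq2[of x y] by simp
  also have "\<dots> \<le> norm x * norm x"
    using assms by (intro mult_left_mono) auto
  also have "\<dots> = x \<bullet> x"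
    by (simp add: dot_square_norm power2_eq_square)
  finally show ?thesis
    using \<open>x \<noteq> 0\<close> by (simp add: coroot_inner abs_mult pos_divide_less_eq)
qed

text \<open>Two such roots would pair to 1 and hence differ by a root. Dominance of both and
  equality of norms force this difference to have norm zero.\<close>

lemma short_dominant_unique:
  assumes "x \<in> short_roots R" "y \<in> short_roots R" "dominant x" "dominant y"
  shows "x = y"
proof (rule ccontr)
  assume "x \<noteq> y"
  have xy: "x \<in> R" "y \<in> R" "norm x = norm y"
    using assms by (auto simp: short_roots_def intro: order_antisym)
  have "x \<bullet> y > 0"
    using dominant_root_inner_pos assms xy zero_notin_R by metis
  have "y \<noteq> - x"
    using \<open>x \<bullet> y > 0\<close> by (metis inner_ge_zero inner_minus_right neg_0_less_iff_less not_less)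
  then have "\<bar>coroot x \<bullet> y\<bar> < 2"
    using coroot_short_bound xy \<open>x \<noteq> y\<close> by auto
  moreover have "coroot x \<bullet> y > 0"
    using coroot_inner_pos_iff \<open>x \<bullet> y > 0\<close> xy zero_notin_R by metis
  ultimately have "coroot x \<bullet> y = 1"
    using coroot_Ints[OF xy(1,2)] by (auto elim!: Ints_cases)
  then have "y - x \<in> R"
    using reflection_root[OF xy(1,2)] by (simp add: reflection_def)
  then have "y - x \<in> pos \<or> x - y \<in> pos"
    using pos_or_neg by force
  moreover have False if "v - u \<in> pos" "u \<bullet> u = v \<bullet> v" "dominant u" "dominant v" for u v
  proof -
    have "(v - u) \<bullet> v \<ge> 0" "(v - u) \<bullet> u \<ge> 0"
      using dominant_pos that by blast+
    then have "(v - u) \<bullet> (v - u) = 0"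
      using that(2) by (simp add: inner_diff_left inner_diff_right inner_commute)
    then show False
      using pos_nonzero[OF that(1)] by simp
  qed
  ultimately show False
    using assms xy(3) by (metis norm_eq)
qed

lemma simple_reflection_nonneg_comb:
  assumes "x \<in> wts" "i \<in> idx" "\<alpha> i \<bullet> x < 0"
  shows "nonneg_comb \<alpha> (reflection (\<alpha> i) x - x)"
proof -
  have "- (coroot (\<alpha> i) \<bullet> x) \<in> \<nat>"
    using wts_coroot_Ints[OF assms(1) simple_root[OF assms(2)]]
      coroot_inner_pos_iff[OF simple_nonzero[OF assms(2)], of x] assms(3)
    by (force simp: Nats_altdef2)
  then have "nonneg_comb \<alpha> ((- (coroot (\<alpha> i) \<bullet> x)) *\<^sub>R \<alpha> i)"
    using nonneg_comb_scale posD(2)[OF simple_pos[OF assms(2)]] by blast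
  then show ?thesis
    by (simp add: reflection_def)
qed

lemma short_below_dominant:
  assumes "x \<in> short_roots R"
  shows "\<exists>y\<in>short_roots R. dominant y \<and> nonneg_comb \<alpha> (y - x)"
proof -
  define A where "A = {y\<in>short_roots R. nonneg_comb \<alpha> (y - x)}"
  have "finite A" "x \<in> A"
    using assms finite_R by (auto simp: A_def short_roots_def nonneg_comb_0)
  then obtain y where y: "y \<in> A" "\<And>z. z \<in> A \<Longrightarrow> ht z \<le> ht y"
    using finite_has_max[of A ht] by (metis empty_iff)
  have "dominant y"
    unfolding dominant_def
  proof (rule ballI, rule ccontr)
    fix i assume i: "i \<in> idx" "\<not> \<alpha> i \<bullet> y \<ge> 0"
    have yR: "y \<in> R" using y by (auto simp: A_def short_roots_def)
    have "nonneg_comb \<alpha> ((reflection (\<alpha> i) y - y) + (y - x))"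
      using i y(1) root_wts[OF yR]
      by (intro nonneg_comb_add simple_reflection_nonneg_comb) (auto simp: A_def)
    then have "reflection (\<alpha> i) y \<in> A"
      using y(1) reflection_root[OF simple_root[OF i(1)] yR] by (auto simp: A_def short_roots_def)
    then show False
      using y(2) simple_reflection_ht_less[of i y] i by force
  qed
  then show ?thesis
    using y(1) by (auto simp: A_def)
qed

abbreviation \<beta> :: 'a where "\<beta> \<equiv> highest_short_root R \<alpha>"

text \<open>Every short root lies below a dominant short root, and there is only one of the latter;
  this makes the description in \<open>highest_short_root\<close> denote it.\<close>

lemma beta_short: "\<beta> \<in> short_roots R" and beta_dominant: "dominant \<beta>"
proof -
  have "R \<noteq> {}"
    using irreducible by (simp add: irreducible_roots_def)
  then obtain x where "x \<in> R" "\<And>y. y \<in> R \<Longrightarrow> - norm y \<le> - norm x"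
    using finite_has_max[OF finite_R, of "\<lambda>x. - norm x"] by metis
  then have "x \<in> short_roots R"
    by (simp add: short_roots_def)
  then obtain b where b: "b \<in> short_roots R" "dominant b"
    using short_below_dominant by blast
  have "highest_short_root R \<alpha> = b"
    unfolding highest_short_root_def sum_of_pos_roots_iff
  proof (rule the_equality)
    show "b \<in> short_roots R \<and> (\<forall>x\<in>short_roots R. nonneg_comb \<alpha> (b - x))"
      using b short_below_dominant short_dominant_unique by metis
    then show "c = b" if "c \<in> short_roots R \<and> (\<forall>x\<in>short_roots R. nonneg_comb \<alpha> (c - x))" for c
      using that nonneg_comb_antisym[of "b - c"] by force
  qed
  then show "\<beta> \<in> short_roots R" "dominant \<beta>"
    using b by simp_all
qed

lemma beta_root: "\<beta> \<in> R" and beta_norm: "x \<in> R \<Longrightarrow> norm \<beta> \<le> norm x"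
  using beta_short by (auto simp: short_roots_def)

lemma beta_pos: "\<beta> \<in> pos"
  using dominant_root_pos beta_root beta_dominant by blast

lemma beta_nonzero: "\<beta> \<noteq> 0"
  using beta_pos pos_nonzero by blast

lemma coroot_beta_cases:
  assumes "x \<in> pos" "x \<noteq> \<beta>"
  shows "coroot x \<bullet> \<beta> = 0 \<or> coroot x \<bullet> \<beta> = 1"
proof -
  have "\<beta> \<noteq> - x"
    using pos_not_neg beta_pos assms(1) by metis
  then have "\<bar>coroot x \<bullet> \<beta>\<bar> < 2"
    using assms beta_root beta_norm posD(1)
    by (intro coroot_short_bound) auto
  moreover have "coroot x \<bullet> \<beta> \<ge> 0"
    using dominant_pos[OF beta_dominant assms(1)] coroot_inner_nonneg_iff pos_nonzero assms(1) by blast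
  moreover have "coroot x \<bullet> \<beta> \<in> \<int>"
    using coroot_Ints posD(1)[OF assms(1)] beta_root by blast
  ultimately show ?thesis
    by (auto elim!: Ints_cases)
qed

lemma beta_reflection_neg:
  assumes "x \<in> pos" "x \<bullet> \<beta> \<noteq> 0"
  shows "- reflection \<beta> x \<in> pos"
proof -
  have "reflection \<beta> x \<bullet> \<beta> < 0"
    using dominant_pos[OF beta_dominant assms(1)] assms(2)
    by (subst inner_reflection_swap) simp
  then have "reflection \<beta> x \<notin> pos"
    using dominant_pos[OF beta_dominant] by force
  then show ?thesis
    using pos_or_neg reflection_root[OF beta_root posD(1)[OF assms(1)]] by blast
qed

text \<open>Equivalently, the coroot of \<open>\<beta>\<close> is the highest root of the dual root system.\<close>

lemma dominant_coroot_le_beta: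
  assumes "dominant m" "x \<in> pos"
  shows "coroot x \<bullet> m \<le> coroot \<beta> \<bullet> m"
proof -
  obtain y where y: "y \<in> R" "\<And>z. z \<in> R \<Longrightarrow> coroot z \<bullet> m \<le> coroot y \<bullet> m"
    using finite_has_max[OF finite_R, of "\<lambda>z. coroot z \<bullet> m"] posD(1)[OF assms(2)] by (metis empty_iff)
  \<comment> \<open>Among the roots with the largest pairing one of maximal height is taken; it is
    dominant, because a simple reflection with negative pairing would raise the height without
    lowering the pairing with \<open>m\<close>.\<close>
  define A where "A = {z\<in>R. coroot z \<bullet> m = coroot y \<bullet> m}"
  have "finite A" "y \<in> A"
    using finite_R y by (auto simp: A_def)
  then obtain z where z: "z \<in> A" "\<And>u. u \<in> A \<Longrightarrow> ht u \<le> ht z"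
    using finite_has_max[of A ht] by (metis empty_iff)
  have zR: "z \<in> R" using z by (simp add: A_def)
  have "dominant z"
    unfolding dominant_def
  proof (rule ballI, rule ccontr)
    fix i assume i: "i \<in> idx" "\<not> \<alpha> i \<bullet> z \<ge> 0"
    have "\<alpha> i \<bullet> m \<ge> 0" using i assms(1) by (simp add: dominant_def)
    then have "coroot (\<alpha> i) \<bullet> m \<ge> 0"
      using coroot_inner_nonneg_iff simple_nonzero i by blast
    moreover have "coroot z \<bullet> \<alpha> i \<le> 0"
      using i coroot_inner_pos_iff[of z "\<alpha> i"] zR zero_notin_R by (force simp: inner_commute)
    moreover have "coroot (reflection (\<alpha> i) z) \<bullet> m
        = coroot z \<bullet> m - (coroot (\<alpha> i) \<bullet> m) * (coroot z \<bullet> \<alpha> i)"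
      by (simp add: coroot_reflection inner_reflection_swap) (simp add: reflection_def inner_diff_right)
    ultimately have "coroot (reflection (\<alpha> i) z) \<bullet> m \<ge> coroot z \<bullet> m"
      using mult_nonneg_nonpos by simp
    then have "reflection (\<alpha> i) z \<in> A"
      using z(1) y(2)[OF reflection_root[OF simple_root[OF i(1)] zR]]
        reflection_root[OF simple_root[OF i(1)] zR] by (simp add: A_def)
    then show False
      using z(2) simple_reflection_ht_less[of i z] i by force
  qed
  have "coroot z \<bullet> m \<le> coroot \<beta> \<bullet> m"
  proof (cases "z = \<beta>")
    case False
    have zp: "z \<in> pos" "z \<bullet> \<beta> > 0"
      using dominant_root_pos dominant_root_inner_pos zR \<open>dominant z\<close> beta_dominant beta_nonzero by blast+
    have "coroot z \<bullet> \<beta> > 0"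
      using zp coroot_inner_pos_iff pos_nonzero by blast
    then have one: "coroot z \<bullet> \<beta> = 1"
      using coroot_beta_cases[OF zp(1) False] by simp
    \<comment> \<open>As \<open>coroot z\<close> pairs to 1 with \<open>\<beta>\<close>, the coroot
      of this root pairs with \<open>m\<close> to the difference of the two sides, so its positivity
      gives the bound.\<close>
    have p: "- reflection \<beta> z \<in> pos"
      using beta_reflection_neg zp by simp
    have "coroot (- reflection \<beta> z) \<bullet> m = - (coroot z \<bullet> reflection \<beta> m)"
      by (simp add: coroot_reflection inner_reflection_swap)
    also have "\<dots> = coroot \<beta> \<bullet> m - coroot z \<bullet> m"
      using one by (simp add: reflection_def inner_diff_right)
    finally show ?thesis
      using dominant_pos[OF assms(1) p] coroot_inner_nonneg_iff[OF pos_nonzero[OF p], of m] by simp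
  qed simp
  then show ?thesis
    using y(2)[OF posD(1)[OF assms(2)]] z(1) by (simp add: A_def)
qed

end

section \<open>Simple affine reflections\<close>

text \<open>The sum is regrouped by the orbits of the involution \<open>p\<close>. Single terms of
  two-element orbits may lie outside \<open>P\<close>, which permits half-integral
  coefficients.\<close>

lemma involution_sum_mem:
  fixes f :: "'b \<Rightarrow> 'c::comm_monoid_add"
  assumes "finite A" "\<And>x. x \<in> A \<Longrightarrow> p x \<in> A" "\<And>x. x \<in> A \<Longrightarrow> p (p x) = x"
    and "0 \<in> P" "\<And>x y. x \<in> P \<Longrightarrow> y \<in> P \<Longrightarrow> x + y \<in> P"
    and "\<And>x. x \<in> A \<Longrightarrow> p x = x \<Longrightarrow> f x \<in> P"
    and "\<And>x. x \<in> A \<Longrightarrow> p x \<noteq> x \<Longrightarrow> f x + f (p x) \<in> P"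
  shows "sum f A \<in> P"
  using assms(1-3,6,7)
proof (induction "card A" arbitrary: A rule: less_induct)
  case less
  show ?case
  proof (cases "A = {}")
    case False
    then obtain x where x: "x \<in> A" by blast
    define B where "B = A - {x, p x}"
    have B: "B \<subset> A" "finite B"
      using x less.prems(1) by (auto simp: B_def)
    have pB: "p y \<in> B" if "y \<in> B" for y
      using that x less.prems(2,3) unfolding B_def by (metis Diff_iff insertCI insertE singletonD)
    have "sum f B \<in> P"
      by (rule less.hyps) (use B pB less.prems psubset_card_mono[of A B] in auto)
    moreover have "sum f {x, p x} \<in> P"
      using x less.prems by (cases "p x = x") auto
    moreover have "sum f A = sum f B + sum f {x, p x}"
      unfolding B_def using x less.prems by (intro sum.subset_diff) auto
    ultimately show ?thesis
      using assms(5) by simp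
  qed (simp add: assms(4))
qed

lemma inner_coroot_self: "x \<noteq> 0 \<Longrightarrow> x \<bullet> coroot x = 2"
  by (simp add: coroot_def)

context weyl_data
begin

definition gens :: "nat set" where "gens = insert 0 idx"

lemma gens_eq: "gens = {0..DIM('a)}"
  by (auto simp: gens_def idx_def)

text \<open>The positive root among \<open>refl_vec i\<close> and its negative, needed because the
  sums run over positive roots.\<close>

definition pos_vec :: "nat \<Rightarrow> 'a" where "pos_vec i = (if i = 0 then \<beta> else \<alpha> i)"

lemma pos_vec_pos: "i \<in> gens \<Longrightarrow> pos_vec i \<in> pos"
  using beta_pos simple_pos by (auto simp: gens_def pos_vec_def)

lemma refl_vec_root: "i \<in> gens \<Longrightarrow> refl_vec i \<in> R"
  using beta_root simple_root uminus_root by (auto simp: gens_def refl_vec_def)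

lemma refl_vec_nonzero: "i \<in> gens \<Longrightarrow> refl_vec i \<noteq> 0"
  using refl_vec_root zero_notin_R by metis

text \<open>Up to the sign \<open>perm_sign\<close>, the linear part of a simple affine reflection permutes the positive
  roots. For \<open>s\<^sub>0\<close> this rests on \<open>\<beta>\<close> being short and dominant, so that it pairs to \<open>0\<close> or \<open>1\<close> with
  the coroots of the other positive roots.\<close>

definition perm_sign :: "nat \<Rightarrow> 'a \<Rightarrow> real" where
  "perm_sign i x = (if i = 0 then if x \<bullet> \<beta> = 0 then 1 else - 1 else if x = \<alpha> i then - 1 else 1)"

definition perm :: "nat \<Rightarrow> 'a \<Rightarrow> 'a" where
  "perm i x = perm_sign i x *\<^sub>R reflection (refl_vec i) x"

text \<open>What the translation in \<open>S i\<close> adds to the pairing with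
  \<open>coroot x\<close>; see \<open>coroot_S\<close>.\<close>

definition offset :: "nat \<Rightarrow> 'a \<Rightarrow> real" where
  "offset i x = - refl_off i * (coroot x \<bullet> refl_vec i)"

lemma perm_sign_cases: "perm_sign i x = 1 \<or> perm_sign i x = - 1"
  by (simp add: perm_sign_def)

lemma perm_pos_vec: "i \<in> gens \<Longrightarrow> perm i (pos_vec i) = pos_vec i"
  and perm_sign_pos_vec: "i \<in> gens \<Longrightarrow> perm_sign i (pos_vec i) = - 1"
  and offset_pos_vec: "i \<in> gens \<Longrightarrow> offset i (pos_vec i) = 2 * refl_off i"
  using beta_nonzero
  by (auto simp: perm_def perm_sign_def pos_vec_def refl_vec_def offset_def refl_off_def coroot_inner_self)

text \<open>The dichotomy on which all sums over \<open>pos\<close> rest. The second case occurs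
  only for \<open>s\<^sub>0\<close>, at the roots whose coroots pair to 1 with
  \<open>\<beta>\<close>; no other nonzero value is possible since \<open>\<beta>\<close> is
  short.\<close>

lemma gens_cases:
  assumes "i \<in> gens" "x \<in> pos" "x \<noteq> pos_vec i"
  obtains "perm_sign i x = 1" "offset i x = 0" | "i = 0" "perm_sign i x = - 1" "offset i x = 1"
  using assms coroot_beta_cases[of x] coroot_inner_eq_0_iff[of x \<beta>] pos_nonzero[of x]
  by (auto simp: perm_sign_def offset_def refl_off_def refl_vec_def pos_vec_def split: if_splits)

lemma perm_pos: "i \<in> gens \<Longrightarrow> x \<in> pos \<Longrightarrow> perm i x \<in> pos"
proof (cases "i = 0")
  case True
  assume "x \<in> pos"
  then show ?thesis
    using True beta_reflection_neg[of x] reflection_eq_self_iff[of \<beta> x]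
    by (auto simp: perm_def perm_sign_def refl_vec_def inner_commute)
next
  case False
  assume "i \<in> gens" "x \<in> pos"
  then show ?thesis
    using False simple_reflection_pos[of i x] by (auto simp: gens_def perm_def perm_sign_def refl_vec_def)
qed

lemma perm_sign_perm: "i \<in> gens \<Longrightarrow> x \<in> pos \<Longrightarrow> perm_sign i (perm i x) = perm_sign i x"
proof (cases "i = 0")
  case True
  then show ?thesis
    by (simp add: perm_def perm_sign_def refl_vec_def inner_reflection_swap)
next
  case False
  assume "i \<in> gens" "x \<in> pos"
  moreover have "reflection (\<alpha> i) x \<noteq> \<alpha> i"
  proof
    assume "reflection (\<alpha> i) x = \<alpha> i"
    then have "x = - \<alpha> i"
      by (metis reflection_reflection reflection_self)
    then show False
      using \<open>x \<in> pos\<close> \<open>i \<in> gens\<close> False pos_not_neg simple_pos by (auto simp: gens_def)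
  qed
  ultimately show ?thesis
    using False by (auto simp: perm_def perm_sign_def refl_vec_def)
qed

lemma perm_perm: "i \<in> gens \<Longrightarrow> x \<in> pos \<Longrightarrow> perm i (perm i x) = x"
  unfolding perm_def[of i "perm i x"] using perm_sign_perm[of i x] perm_sign_cases[of i x]
  by (auto simp: perm_def reflection_uminus)

lemma bij_perm: "i \<in> gens \<Longrightarrow> bij_betw (perm i) pos pos"
  by (rule bij_betw_byWitness[where f' = "perm i"]) (auto simp: perm_perm perm_pos)

lemma param_perm: "i \<in> gens \<Longrightarrow> x \<in> pos \<Longrightarrow> param \<kappa> (perm i x) = param \<kappa> x"
  using perm_sign_cases[of i x] posD(1)[of x] refl_vec_root[of i] reflection_root[of "refl_vec i" x]
    param_W0[OF _ reflection_W0, of x "refl_vec i"] param_uminus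
  by (auto simp: perm_def)

lemma coroot_perm: "coroot (perm i x) = perm_sign i x *\<^sub>R reflection (refl_vec i) (coroot x)"
  using perm_sign_cases[of i x] by (auto simp: perm_def coroot_reflection)

lemma coroot_S: "coroot x \<bullet> S i m = perm_sign i x * (coroot (perm i x) \<bullet> m) + offset i x"
  using perm_sign_cases[of i x]
  by (auto simp: S_eq coroot_perm offset_def inner_diff_right inner_reflection_swap)

lemma reflection_refl_vec: "reflection (refl_vec i) y = y - (refl_vec i \<bullet> y) *\<^sub>R coroot (refl_vec i)"
  by (simp add: reflection_def coroot_def)

definition aff_val :: "nat \<Rightarrow> 'a \<Rightarrow> real" where
  "aff_val i m = refl_off i + coroot (refl_vec i) \<bullet> m"

lemma S_aff_val: "S i m = m - aff_val i m *\<^sub>R refl_vec i"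
  by (simp add: S_eq aff_val_def reflection_def algebra_simps)

lemma S_wts: "i \<in> gens \<Longrightarrow> m \<in> wts \<Longrightarrow> S i m \<in> wts"
  unfolding S_eq
  by (intro wts_diff wts_reflection wts_scale root_wts[OF refl_vec_root] refl_vec_root)
    (auto simp: refl_off_def)

lemma aff_val_Ints: "i \<in> gens \<Longrightarrow> m \<in> wts \<Longrightarrow> aff_val i m \<in> \<int>"
  unfolding aff_val_def by (intro Ints_add wts_coroot_Ints refl_vec_root) (auto simp: refl_off_def)

lemma S_eq_self_iff: "i \<in> gens \<Longrightarrow> S i m = m \<longleftrightarrow> aff_val i m = 0"
  by (simp add: S_aff_val refl_vec_nonzero)

lemma aff_val_pos_vec:
  "aff_val i m = (if i = 0 then 1 - coroot (pos_vec i) \<bullet> m else coroot (pos_vec i) \<bullet> m)"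
  by (simp add: aff_val_def refl_vec_def refl_off_def pos_vec_def)

text \<open>In the second case of \<open>gens_cases\<close> an integer \<open>t\<close> becomes
  \<open>1 - t\<close>, which exchanges \<open>t > 0\<close> with \<open>t \<le> 0\<close>; this is
  why the sign at 0 has to be -1. At \<open>pos_vec i\<close> the map is \<open>- t\<close> or
  \<open>2 - t\<close>, and its fixed point is excluded by \<open>S i m \<noteq> m\<close>.\<close>

lemma sign_eps_S:
  assumes "i \<in> gens" "x \<in> pos" "m \<in> wts" "S i m \<noteq> m"
  shows "sign_eps (coroot x \<bullet> S i m) = perm_sign i x * sign_eps (coroot (perm i x) \<bullet> m)"
proof -
  obtain t where t: "coroot (perm i x) \<bullet> m = of_int t"
    using wts_coroot_Ints[OF assms(3)] perm_pos[OF assms(1,2)] posD(1) by (auto elim!: Ints_cases)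
  show ?thesis
  proof (cases "x = pos_vec i")
    case True
    have "real_of_int t \<noteq> refl_off i"
      using assms(1,4) t by (auto simp: S_eq_self_iff aff_val_pos_vec True perm_pos_vec refl_off_def split: if_splits)
    then have "sign_eps (2 * refl_off i - of_int t) = - sign_eps (of_int t)"
      by (auto simp: sign_eps_def refl_off_def split: if_splits)
    then show ?thesis
      using assms(1) t by (simp add: coroot_S True perm_sign_pos_vec offset_pos_vec)
  next
    case False
    then show ?thesis
      by (rule gens_cases[OF assms(1,2)]) (use t in \<open>auto simp: coroot_S sign_eps_def\<close>)
  qed
qed

section \<open>Shifted weights\<close>

definition shifted_val :: "'a \<Rightarrow> 'a \<Rightarrow> 'i ratfun" where
  "shifted_val m y = const (m \<bullet> y) +
     (\<Sum>x\<in>pos. param \<kappa> x * const (sign_eps (coroot x \<bullet> m) * (x \<bullet> y) / 2))"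

lemma pairing_shifted: "pairing y (shifted R \<alpha> \<kappa> m) = shifted_val m y"
proof -
  have *: "(\<Sum>b\<in>Basis. const (y \<bullet> b) * const (c * (x \<bullet> b))) = const (c * (x \<bullet> y))" for c x
    by (simp add: const_sum[symmetric] const_mult[symmetric] euclidean_inner[of x y] sum_distrib_left mult_ac)
  have "pairing y (shifted R \<alpha> \<kappa> m) = (\<Sum>b\<in>Basis. const (y \<bullet> b) * const (1 * (m \<bullet> b)))
      + (\<Sum>x\<in>pos. param \<kappa> x *
          (\<Sum>b\<in>Basis. const (y \<bullet> b) * const ((sign_eps (coroot x \<bullet> m) / 2) * (x \<bullet> b))))"
    unfolding pairing_def shifted_def
    by (simp add: distrib_left sum.distrib sum_distrib_left sum.swap[of _ Basis] const_mult[symmetric] mult_ac)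
  also have "\<dots> = shifted_val m y"
    unfolding * by (simp add: shifted_val_def)
  finally show ?thesis .
qed

lemma shifted_val_add: "shifted_val m (x + y) = shifted_val m x + shifted_val m y"
  by (simp add: shifted_val_def inner_add_right const_add distrib_left add_divide_distrib sum.distrib)

lemma shifted_val_scaleR: "shifted_val m (c *\<^sub>R y) = const c * shifted_val m y"
proof -
  have *: "const (s * (x \<bullet> c *\<^sub>R y) / 2) = const c * const (s * (x \<bullet> y) / 2)" for s x
    by (simp flip: const_mult add: mult.left_commute)
  then show ?thesis
    unfolding shifted_val_def * by (simp add: const_mult distrib_left sum_distrib_left mult.left_commute)
qed

lemma shifted_val_diff: "shifted_val m (x - y) = shifted_val m x - shifted_val m y"
  using shifted_val_add[of m "x - y" y] by simp

definition shifted_aff_val :: "nat \<Rightarrow> 'a \<Rightarrow> 'i ratfun" where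
  "shifted_aff_val i m = const (refl_off i) + shifted_val m (coroot (refl_vec i))"

lemma aff_pairing_shifted: "aff_pairing (simple_aff R \<alpha> i) (shifted R \<alpha> \<kappa> m) = shifted_aff_val i m"
  by (simp add: aff_pairing_def simple_aff_eq pairing_shifted shifted_aff_val_def)

text \<open>The shift intertwines \<open>S i\<close> on the weights that \<open>S i\<close> moves:
  by \<open>sign_eps_S\<close> the sum over \<open>pos\<close> is only reindexed by
  \<open>perm i\<close>. On a fixed weight the sign at \<open>pos_vec i\<close> does not
  flip.\<close>

lemma shifted_val_S:
  assumes "i \<in> gens" "m \<in> wts" "S i m \<noteq> m"
  shows "shifted_val (S i m) y = shifted_val m (reflection (refl_vec i) y) - const (refl_off i * (y \<bullet> refl_vec i))"
proof -
  let ?y = "reflection (refl_vec i) y"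
  have "(\<Sum>x\<in>pos. param \<kappa> x * const (sign_eps (coroot x \<bullet> S i m) * (x \<bullet> y) / 2)) =
    (\<Sum>x\<in>pos. param \<kappa> (perm i x) * const (sign_eps (coroot (perm i x) \<bullet> m) * (perm i x \<bullet> ?y) / 2))"
    using assms by (intro sum.cong refl) (simp add: sign_eps_S param_perm, simp add: perm_def mult_ac)
  also have "\<dots> = (\<Sum>x\<in>pos. param \<kappa> x * const (sign_eps (coroot x \<bullet> m) * (x \<bullet> ?y) / 2))"
    by (rule sum.reindex_bij_betw[OF bij_perm[OF assms(1)]])
  finally have "(\<Sum>x\<in>pos. param \<kappa> x * const (sign_eps (coroot x \<bullet> S i m) * (x \<bullet> y) / 2)) = \<dots>" .
  moreover have "const (S i m \<bullet> y) = const (m \<bullet> ?y) - const (refl_off i * (y \<bullet> refl_vec i))"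
    by (simp add: S_eq inner_diff_left inner_reflection_swap const_diff inner_commute[of _ "refl_vec i"])
  ultimately show ?thesis
    by (simp add: shifted_val_def)
qed

text \<open>In this form the eigenvalues at \<open>m\<close> and \<open>S i m\<close> differ by a
  multiple of \<open>shifted_aff_val i m\<close>, the scalar of the recursion;
  \<open>eigenf_step\<close> depends on this.\<close>

lemma shifted_val_S':
  assumes "i \<in> gens" "m \<in> wts" "S i m \<noteq> m"
  shows "shifted_val (S i m) y = shifted_val m y - const (y \<bullet> refl_vec i) * shifted_aff_val i m"
  unfolding shifted_val_S[OF assms] shifted_aff_val_def reflection_refl_vec shifted_val_diff shifted_val_scaleR
  by (simp add: const_mult algebra_simps inner_commute)

lemma has_const_term_shifted_aff_val: "has_const_term (shifted_aff_val i m) (aff_val i m)"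
proof -
  have "has_const_term (const (refl_off i) + (const (m \<bullet> coroot (refl_vec i)) +
     (\<Sum>x\<in>pos. param \<kappa> x * const (sign_eps (coroot x \<bullet> m) * (x \<bullet> coroot (refl_vec i)) / 2))))
     (refl_off i + (m \<bullet> coroot (refl_vec i) + (\<Sum>x\<in>pos. 0)))"
    by (intro has_const_term_add has_const_term_const has_const_term_sum has_const_term_param_mult)
  then show ?thesis
    by (simp add: shifted_aff_val_def shifted_val_def aff_val_def inner_commute)
qed

lemma has_const_term_shifted_val: "has_const_term (shifted_val m y) (m \<bullet> y)"
proof -
  have "has_const_term (const (m \<bullet> y) +
     (\<Sum>x\<in>pos. param \<kappa> x * const (sign_eps (coroot x \<bullet> m) * (x \<bullet> y) / 2)))
     (m \<bullet> y + (\<Sum>x\<in>pos. 0))"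
    by (intro has_const_term_add has_const_term_const has_const_term_sum has_const_term_param_mult)
  then show ?thesis
    by (simp add: shifted_val_def)
qed

text \<open>At parameters zero the value is \<open>m \<bullet> y\<close>, which determines
  \<open>m\<close> when \<open>y\<close> varies.\<close>

lemma shifted_val_inject: "(\<And>y. shifted_val m y = shifted_val n y) \<Longrightarrow> m = n"
  using has_const_term_shifted_val has_const_term_unique vector_eq_rdot by (metis (no_types, lifting))

text \<open>The coefficients are half-integers that need not be non-negative one by one; they become
  non-negative integers when the roots \<open>x\<close> and \<open>perm i x\<close> are taken together.\<close>

lemma shifted_aff_val_nonneg:
  assumes i: "i \<in> gens" and m: "m \<in> wts" and pos: "aff_val i m > 0"
  shows "shifted_aff_val i m \<in> nonneg_int_polys"
proof -
  let ?b = "refl_vec i"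
  define f where
    "f x = param \<kappa> x * const (sign_eps (coroot x \<bullet> m) * (x \<bullet> coroot ?b) / 2)" for x
  have f_nonneg: "param \<kappa> x * const r \<in> nonneg_int_polys" if "r \<in> \<nat>" for x r
    using that by (intro nonneg_int_polys_mult nonneg_int_polys_param nonneg_int_polys_const)
  have "sum f pos \<in> nonneg_int_polys"
  proof (rule involution_sum_mem[where p = "perm i"])
    fix x assume x: "x \<in> pos"
    define p where "p = coroot ?b \<bullet> x"
    define p' where "p' = coroot x \<bullet> ?b"
    have pZ: "p \<in> \<int>"
      unfolding p_def using coroot_Ints refl_vec_root i posD(1) x by blast
    have pp': "p' > 0 \<longleftrightarrow> p > 0" "p' = 0 \<longleftrightarrow> p = 0"
      unfolding p_def p'_def
      using coroot_inner_pos_iff coroot_inner_eq_0_iff pos_nonzero x refl_vec_nonzero i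
      by (metis inner_commute)+
    have perm_inner: "perm i x \<bullet> coroot ?b = - perm_sign i x * p"
      by (simp add: perm_def inner_reflection_swap p_def coroot_reflection[symmetric]
          inner_commute[of _ x])
    have coroot_perm_m: "coroot (perm i x) \<bullet> m = perm_sign i x * (coroot x \<bullet> m - p' * (aff_val i m - refl_off i))"
      by (simp add: coroot_perm inner_reflection_swap)
         (simp add: reflection_def inner_diff_right p'_def aff_val_def mult_ac)
    show "f x \<in> nonneg_int_polys" if fp: "perm i x = x"
    proof (cases "x = pos_vec i")
      case True
      \<comment> \<open>The root \<open>pos_vec i\<close> contributes its parameter exactly once.
        For \<open>i = 0\<close> positivity says \<open>coroot \<beta> \<bullet> m < 1\<close>, and
        integrality turns this into the sign -1, which cancels that of
        \<open>refl_vec 0\<close>.\<close>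
      have "sign_eps (coroot x \<bullet> m) * (x \<bullet> coroot ?b) / 2 = 1"
      proof (cases "i = 0")
        case True
        have "coroot \<beta> \<bullet> m \<in> \<int>"
          using wts_coroot_Ints m beta_root by blast
        then have "coroot \<beta> \<bullet> m \<le> 0"
          using pos True by (auto simp: aff_val_def refl_off_def refl_vec_def elim!: Ints_cases)
        then show ?thesis
          using \<open>x = pos_vec i\<close> True beta_nonzero
          by (simp add: pos_vec_def refl_vec_def sign_eps_def inner_coroot_self)
      next
        case False
        then show ?thesis
          using \<open>x = pos_vec i\<close> pos i simple_nonzero
          by (simp add: pos_vec_def refl_vec_def aff_val_def refl_off_def sign_eps_def
              inner_coroot_self gens_def)
      qed
      then show ?thesis
        using f_nonneg[of 1 x] by (simp add: f_def)
    next
      case False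
      have "p = 0"
      proof (rule gens_cases[OF i x False])
        assume "perm_sign i x = 1"
        then show ?thesis
          using fp refl_vec_nonzero[OF i] by (simp add: perm_def reflection_def p_def)
      next
        assume *: "i = 0" "perm_sign i x = - 1" "offset i x = 1"
        then have "reflection \<beta> x = - x"
          using fp by (simp add: perm_def refl_vec_def) (metis minus_minus)
        then have "2 *\<^sub>R x = (coroot \<beta> \<bullet> x) *\<^sub>R \<beta>"
          by (simp add: reflection_def scaleR_2 algebra_simps)
        then have "(1/2) *\<^sub>R (2 *\<^sub>R x) = (1/2) *\<^sub>R ((coroot \<beta> \<bullet> x) *\<^sub>R \<beta>)"
          by simp
        then obtain t where t: "x = t *\<^sub>R \<beta>" by auto
        then have "t = 1 \<or> t = -1"
          using multiple_root[OF beta_root, of t] posD(1)[OF x] by simp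
        then show ?thesis
          using t False * x pos_not_neg[OF beta_pos] by (auto simp: pos_vec_def)
      qed
      then have "x \<bullet> coroot ?b = 0"
        by (simp add: p_def inner_commute)
      then show ?thesis
        by (simp add: f_def nonneg_int_polys_0)
    qed
    show "f x + f (perm i x) \<in> nonneg_int_polys" if fp: "perm i x \<noteq> x"
    proof -
      have np: "x \<noteq> pos_vec i"
        using fp perm_pos_vec[OF i] by auto
      let ?e = "sign_eps (coroot x \<bullet> m)" and ?e' = "sign_eps (coroot (perm i x) \<bullet> m)"
      \<comment> \<open>Half of \<open>?e - perm_sign i x * ?e'\<close> is 0, 1 or -1, and where it
        is nonzero its sign agrees with that of the integer \<open>p\<close>.\<close>
      have "f x + f (perm i x) = param \<kappa> x * const (p * ((?e - perm_sign i x * ?e') / 2))"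
        using i x unfolding f_def perm_inner param_perm[OF i x]
        by (simp add: distrib_left[symmetric] const_add[symmetric] p_def inner_commute field_simps)
      moreover have "p * ((?e - perm_sign i x * ?e') / 2) \<in> \<nat>"
      proof (rule gens_cases[OF i x np])
        assume *: "perm_sign i x = 1" "offset i x = 0"
        have a: "coroot (perm i x) \<bullet> m = coroot x \<bullet> m - p' * aff_val i m"
          using * coroot_perm_m by (auto simp: offset_def p'_def refl_off_def)
        consider "p = 0" | "p > 0" | "p < 0" by linarith
        then show ?thesis
        proof cases
          case 2
          then have "p' * aff_val i m > 0" using pp' pos by simp
          then have "(?e - ?e') / 2 = 0 \<or> (?e - ?e') / 2 = 1"
            using a by (simp add: sign_eps_def)
          moreover have "p \<in> \<nat>" using 2 pZ by (simp add: Nats_altdef2)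
          ultimately show ?thesis using *(1) by auto
        next
          case 3
          then have "p' < 0" using pp' by linarith
          then have "p' * aff_val i m < 0" using pos by (simp add: mult_neg_pos)
          then have "(?e - ?e') / 2 = 0 \<or> (?e - ?e') / 2 = - 1"
            using a by (simp add: sign_eps_def)
          moreover have "- p \<in> \<nat>" using 3 pZ by (simp add: Nats_altdef2)
          ultimately show ?thesis using *(1) by auto
        qed simp
      next
        assume *: "i = 0" "perm_sign i x = - 1" "offset i x = 1"
        have p'1: "p' = - 1"
          using * by (simp add: offset_def p'_def refl_off_def)
        then have "p < 0" using pp' by linarith
        then have np: "- p \<in> \<nat>" using pZ by (simp add: Nats_altdef2)
        \<comment> \<open>The right-hand side is below 1, so the two integers on the left cannot
          both be positive, and at least one sign is -1.\<close>
        have sum: "coroot x \<bullet> m + coroot (perm i x) \<bullet> m = 1 - aff_val i m"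
          using * coroot_perm_m p'1 by (simp add: refl_off_def)
        have "coroot x \<bullet> m \<in> \<int>" "coroot (perm i x) \<bullet> m \<in> \<int>"
          using wts_coroot_Ints m x perm_pos[OF i x] posD(1) by blast+
        then have "coroot x \<bullet> m \<le> 0 \<or> coroot (perm i x) \<bullet> m \<le> 0"
          using sum pos by (auto elim!: Ints_cases)
        then have "(?e + ?e') / 2 = 0 \<or> (?e + ?e') / 2 = - 1"
          by (auto simp: sign_eps_def)
        then show ?thesis using *(2) np by auto
      qed
      ultimately show ?thesis
        using f_nonneg by simp
    qed
  qed (use i in \<open>auto simp: finite_pos perm_pos perm_perm nonneg_int_polys_0 nonneg_int_polys_add\<close>)
  moreover have "aff_val i m \<in> \<nat>"
    using aff_val_Ints[OF i m] pos by (simp add: Nats_altdef2)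
  moreover have "shifted_aff_val i m = const (aff_val i m) + sum f pos"
    by (simp add: shifted_aff_val_def shifted_val_def f_def aff_val_def const_add inner_commute add.assoc)
  ultimately show ?thesis
    by (simp add: nonneg_int_polys_add nonneg_int_polys_const)
qed

end

section \<open>Length in the affine Weyl group\<close>

context weyl_data
begin

text \<open>The number of affine root hyperplanes that separate \<open>m\<close> from the fundamental alcove: with
  \<open>t = coroot x \<bullet> m\<close>, the root \<open>x\<close> contributes \<open>t - 1\<close> of them if \<open>t > 0\<close>, and \<open>- t\<close> otherwise.\<close>

definition separation :: "'a \<Rightarrow> real" where
  "separation m = (\<Sum>x\<in>pos. \<bar>coroot x \<bullet> m - 1/2\<bar> - 1/2)"

text \<open>The contribution \<open>h\<close> of a root is symmetric about 1/2, hence unchanged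
  under \<open>t\<close> and \<open>1 - t\<close>, the two cases of \<open>gens_cases\<close>. Only
  the hyperplane of the reflection itself is crossed.\<close>

lemma separation_S:
  assumes "i \<in> gens" "m \<in> wts"
  shows "separation (S i m) = separation m + sgn (aff_val i m)"
proof -
  define h :: "real \<Rightarrow> real" where "h t = \<bar>t - 1/2\<bar> - 1/2" for t
  have "h (coroot x \<bullet> S i m) =
      h (coroot (perm i x) \<bullet> m) + (if x = pos_vec i then sgn (aff_val i m) else 0)" if x: "x \<in> pos" for x
  proof (cases "x = pos_vec i")
    case True
    obtain t where t: "coroot (pos_vec i) \<bullet> m = of_int t"
      using wts_coroot_Ints[OF assms(2) posD(1)[OF pos_vec_pos[OF assms(1)]]] by (auto elim!: Ints_cases)
    have "h (2 * refl_off i - of_int t) = h (of_int t) + sgn (if i = 0 then 1 - of_int t else of_int t)"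
      by (auto simp: h_def refl_off_def sgn_real_def)
    moreover have "aff_val i m = (if i = 0 then 1 - of_int t else of_int t)"
      by (simp only: aff_val_pos_vec t)
    ultimately show ?thesis
      using assms(1) by (simp add: True coroot_S perm_sign_pos_vec offset_pos_vec perm_pos_vec t)
  next
    case False
    then show ?thesis
      by (rule gens_cases[OF assms(1) x]) (use False in \<open>auto simp: coroot_S h_def\<close>)
  qed
  then have "separation (S i m) =
      (\<Sum>x\<in>pos. h (coroot (perm i x) \<bullet> m)) + (\<Sum>x\<in>pos. if x = pos_vec i then sgn (aff_val i m) else 0)"
    by (simp add: separation_def sum.distrib h_def[symmetric])
  also have "(\<Sum>x\<in>pos. h (coroot (perm i x) \<bullet> m)) = separation m"
    unfolding separation_def h_def[symmetric] by (rule sum.reindex_bij_betw[OF bij_perm[OF assms(1)]])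
  also have "(\<Sum>x\<in>pos. if x = pos_vec i then sgn (aff_val i m) else 0) = sgn (aff_val i m)"
    using pos_vec_pos[OF assms(1)] by (simp add: finite_pos)
  finally show ?thesis .
qed

lemma separation_Nats:
  assumes "m \<in> wts" shows "separation m \<in> \<nat>"
proof -
  have "\<bar>coroot x \<bullet> m - 1/2\<bar> - 1/2 \<in> \<nat>" if x: "x \<in> pos" for x
  proof -
    obtain t where t: "coroot x \<bullet> m = of_int t"
      using wts_coroot_Ints[OF assms posD(1)[OF x]] by (auto elim!: Ints_cases)
    have "\<bar>real_of_int t - 1/2\<bar> - 1/2 = real (nat (if t > 0 then t - 1 else - t))"
      by auto
    then show ?thesis
      unfolding t by (metis of_nat_in_Nats)
  qed
  then show ?thesis
    unfolding separation_def by (rule sum_in_Nats)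
qed

lemma separation_orbit_reps:
  assumes "m \<in> orbit_reps R \<alpha>" shows "separation m = 0"
  unfolding separation_def using assms by (intro sum.neutral) (auto simp: orbit_reps_def)

text \<open>Otherwise the weight is dominant and pairs to at most 1 with
  \<open>coroot \<beta>\<close>. That coroot dominates all the others on dominant vectors, so by
  integrality every pairing is 0 or 1.\<close>

lemma exists_aff_val_neg:
  assumes "m \<in> wts" "m \<notin> orbit_reps R \<alpha>"
  shows "\<exists>i\<in>gens. aff_val i m < 0"
proof (rule ccontr)
  assume "\<not> ?thesis"
  then have *: "aff_val i m \<ge> 0" if "i \<in> gens" for i
    using that by force
  have "dominant m"
    unfolding dominant_def
  proof
    fix i assume i: "i \<in> idx"
    then show "\<alpha> i \<bullet> m \<ge> 0"
      using *[of i] zero_notin_idx coroot_inner_nonneg_iff[OF simple_nonzero[OF i]]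
      by (auto simp: aff_val_pos_vec pos_vec_def gens_def split: if_splits)
  qed
  have "coroot \<beta> \<bullet> m \<le> 1"
    using *[of 0] by (simp add: aff_val_pos_vec pos_vec_def gens_def)
  have "coroot x \<bullet> m \<in> {0, 1}" if x: "x \<in> pos" for x
  proof -
    have "coroot x \<bullet> m \<le> 1"
      using dominant_coroot_le_beta[OF \<open>dominant m\<close> x] \<open>coroot \<beta> \<bullet> m \<le> 1\<close> by simp
    moreover have "coroot x \<bullet> m \<ge> 0"
      using dominant_pos[OF \<open>dominant m\<close> x] coroot_inner_nonneg_iff[OF pos_nonzero[OF x]] by simp
    moreover obtain t where t: "coroot x \<bullet> m = of_int t"
      using wts_coroot_Ints[OF assms(1) posD(1)[OF x]] by (auto elim!: Ints_cases)
    ultimately have "t = 0 \<or> t = 1" by auto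
    then show ?thesis using t by auto
  qed
  then show False
    using assms by (auto simp: orbit_reps_def)
qed

text \<open>A reflection with negative value lowers the separation by exactly one, and the descent
  stops only at an orbit representative.\<close>

lemma exists_word_to_reps:
  "m \<in> wts \<Longrightarrow> \<exists>js. set js \<subseteq> gens \<and> wm js m \<in> orbit_reps R \<alpha> \<and> real (length js) = separation m"
proof (induction "nat \<lfloor>separation m\<rfloor>" arbitrary: m rule: less_induct)
  case less
  show ?case
  proof (cases "m \<in> orbit_reps R \<alpha>")
    case True
    then show ?thesis
      by (intro exI[of _ "[]"]) (simp add: separation_orbit_reps)
  next
    case False
    then obtain i where i: "i \<in> gens" "aff_val i m < 0"
      using exists_aff_val_neg less.prems by blast
    have separation: "separation (S i m) = separation m - 1"
      using separation_S[OF i(1) less.prems] i(2) by simp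
    have w: "S i m \<in> wts"
      using S_wts i less.prems by blast
    have "nat \<lfloor>separation (S i m)\<rfloor> < nat \<lfloor>separation m\<rfloor>"
      using separation separation_Nats[OF w] separation_Nats[OF less.prems] by (auto elim!: Nats_cases)
    then obtain js where "set js \<subseteq> gens" "wm js (S i m) \<in> orbit_reps R \<alpha>"
        "real (length js) = separation (S i m)"
      using less.hyps w by blast
    then show ?thesis
      using i separation by (intro exI[of _ "js @ [i]"]) (simp add: wm_append)
  qed
qed

lemma fold_S_wts: "set js \<subseteq> gens \<Longrightarrow> m \<in> wts \<Longrightarrow> fold S js m \<in> wts"
  by (induction js arbitrary: m) (auto intro: S_wts)

lemma fold_wm: "fold S js (wm js m) = m"
  by (induction js arbitrary: m) auto

lemma separation_fold: "set js \<subseteq> gens \<Longrightarrow> m \<in> wts \<Longrightarrow> separation (fold S js m) \<le> separation m + length js"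
proof (induction js arbitrary: m)
  case (Cons j js)
  then have "separation (fold S js (S j m)) \<le> separation (S j m) + length js"
    by (simp add: S_wts)
  moreover have "separation (S j m) \<le> separation m + 1"
    using Cons.prems by (simp add: separation_S sgn_real_def)
  ultimately show ?case by simp
qed simp

section \<open>Weights along a reduced word\<close>

abbreviation iw :: "nat list \<Rightarrow> 'a \<Rightarrow> nat \<Rightarrow> 'a" where
  "iw \<equiv> intermediate_weight R \<alpha>"

lemma iw_0: "iw js m 0 = wm js m"
  by (simp add: intermediate_weight_def)

lemma iw_Suc: "j < length js \<Longrightarrow> iw js m (Suc j) = S (js ! j) (iw js m j)"
  by (simp add: intermediate_weight_def take_Suc_conv_app_nth)

lemma iw_length: "iw js m (length js) = m"
  by (simp add: intermediate_weight_def fold_wm)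

lemma wm_wts: "set js \<subseteq> gens \<Longrightarrow> m \<in> wts \<Longrightarrow> wm js m \<in> wts"
  by (induction js) (auto intro: S_wts)

lemma iw_wts: "set js \<subseteq> gens \<Longrightarrow> m \<in> wts \<Longrightarrow> iw js m j \<in> wts"
  unfolding intermediate_weight_def
  by (intro fold_S_wts wm_wts) (auto dest: in_set_takeD)

text \<open>The descent bounds the length of a shortest word by \<open>separation m\<close>. Read
  from the representative back to \<open>m\<close>, the word must raise the separation from 0 to
  \<open>separation m\<close>, and each letter raises it by at most one; so none can fail to do
  so.\<close>

lemma reduced_aff_val_pos:
  assumes "shortest_to_rep R \<alpha> m w" "reduced_expression R \<alpha> js w" "m \<in> wts" and j: "j < length js"
  shows "aff_val (js ! j) (iw js m j) > 0"
proof -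
  have js: "set js \<subseteq> gens" "w = wm js" "length js = weyl_length R \<alpha> w"
    using assms(2) by (auto simp: reduced_expression_def gens_eq)
  obtain ks where ks: "set ks \<subseteq> gens" "wm ks m \<in> orbit_reps R \<alpha>" "real (length ks) = separation m"
    using exists_word_to_reps assms(3) by blast
  have "weyl_length R \<alpha> w \<le> weyl_length R \<alpha> (wm ks)"
    using assms(1) ks unfolding shortest_to_rep_def affine_weyl_def gens_eq by blast
  also have "\<dots> \<le> length ks"
    unfolding weyl_length_def using ks(1) gens_eq by (intro Least_le) auto
  finally have "real (length js) \<le> separation m"
    using ks js by simp
  define m0 where "m0 = wm js m"
  have m0: "m0 \<in> wts" "separation m0 = 0"
    using wm_wts js assms(1,3) separation_orbit_reps by (auto simp: m0_def shortest_to_rep_def)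
  have "separation (iw js m j) \<le> j"
    using separation_fold[of "take j js" m0] m0 js(1) j
    by (auto simp: intermediate_weight_def m0_def dest: in_set_takeD)
  moreover have "fold S (drop (Suc j) js) (iw js m (Suc j)) = m"
    using fold_wm[of js m]
    by (metis append_take_drop_id comp_apply fold_append intermediate_weight_def)
  then have "separation m \<le> separation (iw js m (Suc j)) + (length js - Suc j)"
    using separation_fold[of "drop (Suc j) js" "iw js m (Suc j)"] js(1) iw_wts[OF js(1) assms(3)]
    by (auto dest: in_set_dropD)
  moreover have "separation (iw js m (Suc j)) = separation (iw js m j) + sgn (aff_val (js ! j) (iw js m j))"
    unfolding iw_Suc[OF j] using js(1) j by (intro separation_S iw_wts assms(3)) (auto simp: subset_iff)
  ultimately have "sgn (aff_val (js ! j) (iw js m j)) \<ge> 1"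
    using \<open>real (length js) \<le> separation m\<close> j by (simp add: of_nat_diff)
  then show ?thesis
    by (simp add: sgn_real_def split: if_splits)
qed

end

section \<open>Divided differences on the group algebra\<close>

lemma scale_eq: "scale c f = Poly_Mapping.single 0 c * f"
  unfolding scale_def by (rule mult_map_scale_conv_mult)

lemma lookup_scale [simp]: "Poly_Mapping.lookup (scale c f) m = c * Poly_Mapping.lookup f m"
  by (simp add: scale_def map.rep_eq when_def)

lemma scale_add_right: "scale c (f + g) = scale c f + scale c g"
  and scale_diff_right: "scale c (f - g) = scale c f - scale c g"
  and scale_minus_right: "scale c (- f) = - scale c f"
  and scale_add_left: "scale (c + d) f = scale c f + scale d f"
  and scale_diff_left: "scale (c - d) f = scale c f - scale d f"
  and scale_scale: "scale c (scale d f) = scale (c * d) f"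
  and scale_mult_right: "scale c (f * g) = f * scale c g"
  and scale_left_commute: "scale c (scale d f) = scale d (scale c f)"
  by (simp_all add: scale_eq algebra_simps single_add single_diff mult_single flip: mult.assoc)

lemma scale_1 [simp]: "scale 1 f = f"
  by (simp add: scale_eq)

lemma scale_0 [simp]: "scale 0 f = 0" "scale c 0 = 0"
  by (simp_all add: scale_eq)

lemma scale_sum_right: "scale c (sum f A) = (\<Sum>x\<in>A. scale c (f x))"
  by (simp add: scale_eq sum_distrib_left)

lemma scale_sum_left: "scale (sum c A) f = (\<Sum>x\<in>A. scale (c x) f)"
  by (induction A rule: infinite_finite_induct) (simp_all add: scale_add_left)

lemma lookup_single_mult:
  fixes k :: "'b::ab_group_add" and c :: "'c::comm_semiring_1"
  shows "Poly_Mapping.lookup (Poly_Mapping.single k c * f) m = c * Poly_Mapping.lookup f (m - k)"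
proof -
  have "(m = l + q) = (q = m - l)" for l q by (auto simp: algebra_simps)
  then have "Poly_Mapping.lookup (Poly_Mapping.single k c * f) m
      = (\<Sum>l. (c * Poly_Mapping.lookup f (m - l)) when k = l)"
    by (simp add: lookup_mult lookup_single when_mult)
  then show ?thesis by simp
qed

lemma expo_mult: "expo x * expo y = expo (x + y)"
  by (simp add: expo_def mult_single)

lemma expo_0: "expo 0 = 1"
  by (simp add: expo_def)

lemma lookup_expo: "Poly_Mapping.lookup (expo x) y = (if x = y then 1 else 0)"
  by (simp add: expo_def lookup_single when_def)

lemma keys_expo: "Poly_Mapping.keys (expo x :: 'a::euclidean_space \<Rightarrow>\<^sub>0 'i::linorder ratfun) = {x}"
  by (simp add: expo_def)

lemma lookup_expo_mult: "Poly_Mapping.lookup (expo k * f) m = Poly_Mapping.lookup f (m - k)"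
  by (simp add: expo_def lookup_single_mult)

section \<open>Linear operators on the group algebra\<close>

definition lin_ext ::
    "('a::euclidean_space \<Rightarrow> 'a \<Rightarrow>\<^sub>0 'i::linorder ratfun) \<Rightarrow> ('a \<Rightarrow>\<^sub>0 'i ratfun) \<Rightarrow> 'a \<Rightarrow>\<^sub>0 'i ratfun" where
  "lin_ext g f = (\<Sum>m\<in>Poly_Mapping.keys f. scale (Poly_Mapping.lookup f m) (g m))"

lemma lin_ext_superset:
  assumes "finite A" "Poly_Mapping.keys f \<subseteq> A"
  shows "lin_ext g f = (\<Sum>m\<in>A. scale (Poly_Mapping.lookup f m) (g m))"
  unfolding lin_ext_def using assms
  by (intro sum.mono_neutral_left) (auto simp: in_keys_iff)

lemma lin_ext_add: "lin_ext g (f + h) = lin_ext g f + lin_ext g h"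
proof -
  let ?A = "Poly_Mapping.keys f \<union> Poly_Mapping.keys h"
  have "finite ?A" by simp
  then show ?thesis
    using keys_add[of f h] by (simp add: lin_ext_superset[of ?A] lookup_add scale_add_left sum.distrib)
qed

lemma lin_ext_scale: "lin_ext g (scale c f) = scale c (lin_ext g f)"
proof -
  have "Poly_Mapping.keys (scale c f) \<subseteq> Poly_Mapping.keys f"
    by (auto simp: in_keys_iff)
  then show ?thesis
    by (simp add: lin_ext_superset[of "Poly_Mapping.keys f"] scale_sum_right scale_scale)
qed

lemma lin_ext_expo: "lin_ext g (expo m) = g m"
  by (simp add: lin_ext_def keys_expo lookup_expo)

lemma lookup_lin_ext:
  "Poly_Mapping.lookup (lin_ext g f) m =
     (\<Sum>n\<in>Poly_Mapping.keys f. Poly_Mapping.lookup f n * Poly_Mapping.lookup (g n) m)"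
  by (simp add: lin_ext_def lookup_sum)

definition scalar_linear ::
    "(('a::euclidean_space \<Rightarrow>\<^sub>0 'i::linorder ratfun) \<Rightarrow> 'a \<Rightarrow>\<^sub>0 'i ratfun) \<Rightarrow> bool" where
  "scalar_linear F \<longleftrightarrow> (\<forall>f g. F (f + g) = F f + F g) \<and> (\<forall>c f. F (scale c f) = scale c (F f))"

lemma scalar_linear_add: "scalar_linear F \<Longrightarrow> F (f + g) = F f + F g"
  and scalar_linear_scale: "scalar_linear F \<Longrightarrow> F (scale c f) = scale c (F f)"
  by (simp_all add: scalar_linear_def)

lemma scalar_linear_0: "scalar_linear F \<Longrightarrow> F 0 = 0"
  using scalar_linear_scale[of F 0 0] by simp

lemma scalar_linear_diff: "scalar_linear F \<Longrightarrow> F (f - g) = F f - F g"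
  using scalar_linear_add[of F "f - g" g] by simp

lemma scalar_linear_sum: "scalar_linear F \<Longrightarrow> F (sum h A) = (\<Sum>x\<in>A. F (h x))"
  by (induction A rule: infinite_finite_induct) (simp_all add: scalar_linear_0 scalar_linear_add)

lemma scalar_linear_intros:
  "scalar_linear (\<lambda>f. f)"
  "scalar_linear (lin_ext g)"
  "scalar_linear ((*) h)"
  "scalar_linear F \<Longrightarrow> scalar_linear G \<Longrightarrow> scalar_linear (\<lambda>f. F (G f))"
  "scalar_linear F \<Longrightarrow> scalar_linear G \<Longrightarrow> scalar_linear (\<lambda>f. F f + G f)"
  "scalar_linear F \<Longrightarrow> scalar_linear G \<Longrightarrow> scalar_linear (\<lambda>f. F f - G f)"
  "scalar_linear F \<Longrightarrow> scalar_linear (\<lambda>f. scale c (F f))"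
  by (simp_all add: scalar_linear_def lin_ext_add lin_ext_scale distrib_left scale_mult_right
      scale_add_right scale_diff_right scale_left_commute)

lemma scalar_linear_sum_intro:
  "(\<And>x. x \<in> A \<Longrightarrow> scalar_linear (F x)) \<Longrightarrow> scalar_linear (\<lambda>f. \<Sum>x\<in>A. F x f)"
  by (simp add: scalar_linear_def sum.distrib scale_sum_right)

lemma expo_expansion: "f = (\<Sum>m\<in>Poly_Mapping.keys f. scale (Poly_Mapping.lookup f m) (expo m))"
proof (rule poly_mapping_eqI)
  fix k
  have "Poly_Mapping.lookup f k =
      (\<Sum>m\<in>Poly_Mapping.keys f. if m = k then Poly_Mapping.lookup f m else 0)"
    by (simp add: in_keys_iff)
  also have "\<dots> = (\<Sum>m\<in>Poly_Mapping.keys f. Poly_Mapping.lookup f m * Poly_Mapping.lookup (expo m) k)"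
    by (intro sum.cong) (auto simp: lookup_expo)
  finally show "Poly_Mapping.lookup f k =
      Poly_Mapping.lookup (\<Sum>m\<in>Poly_Mapping.keys f. scale (Poly_Mapping.lookup f m) (expo m)) k"
    by (simp add: lookup_sum)
qed

text \<open>Operator identities are checked on exponentials. Only those in the support of
  \<open>f\<close> matter, which keeps integrality of the weights available.\<close>

lemma scalar_linear_eqI:
  assumes "scalar_linear F" "scalar_linear G"
    and "\<And>m. m \<in> Poly_Mapping.keys f \<Longrightarrow> F (expo m) = G (expo m)"
  shows "F f = G f"
  by (subst (1 2) expo_expansion)
    (simp add: assms scalar_linear_sum scalar_linear_scale)

lemma weyl_act_eq: "weyl_act w = lin_ext (\<lambda>m. expo (w m))"
  by (simp add: fun_eq_iff weyl_act_def lin_ext_def)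

lemma dderiv_eq: "dderiv y = lin_ext (\<lambda>m. scale (const (y \<bullet> m)) (expo m))"
  by (simp add: fun_eq_iff dderiv_def lin_ext_def scale_scale)

lemma scalar_linear_weyl_act: "scalar_linear (weyl_act w)"
  and scalar_linear_dderiv: "scalar_linear (dderiv y)"
  by (simp_all add: weyl_act_eq dderiv_eq scalar_linear_intros)

lemma weyl_act_expo: "weyl_act w (expo m) = expo (w m)"
  by (simp add: weyl_act_eq lin_ext_expo)

lemma dderiv_expo: "dderiv y (expo m) = scale (const (y \<bullet> m)) (expo m)"
  by (simp add: dderiv_eq lin_ext_expo)

lemma lookup_dderiv: "Poly_Mapping.lookup (dderiv y f) m = const (y \<bullet> m) * Poly_Mapping.lookup f m"
proof -
  have "Poly_Mapping.lookup (dderiv y f) m =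
      (\<Sum>n\<in>Poly_Mapping.keys f. if n = m then const (y \<bullet> n) * Poly_Mapping.lookup f n else 0)"
    unfolding dderiv_eq lookup_lin_ext by (intro sum.cong) (auto simp: lookup_expo)
  then show ?thesis
    by (simp add: in_keys_iff)
qed

lemmas weyl_act_add = scalar_linear_add[OF scalar_linear_weyl_act]
  and weyl_act_diff = scalar_linear_diff[OF scalar_linear_weyl_act]
  and weyl_act_scale = scalar_linear_scale[OF scalar_linear_weyl_act]
  and weyl_act_sum = scalar_linear_sum[OF scalar_linear_weyl_act]

lemma weyl_act_comp: "weyl_act v (weyl_act w f) = weyl_act (v \<circ> w) f"
  by (rule scalar_linear_eqI[where F = "\<lambda>f. weyl_act v (weyl_act w f)"])
    (auto intro: scalar_linear_intros scalar_linear_weyl_act simp: weyl_act_expo)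

lemma weyl_act_id: "weyl_act id f = f"
  by (rule scalar_linear_eqI[where G = "\<lambda>f. f"])
    (auto intro: scalar_linear_intros scalar_linear_weyl_act simp: weyl_act_expo)

lemma weyl_act_expo_mult:
  assumes "\<And>x. w (k + x) = l + w x"
  shows "weyl_act w (expo k * f) = expo l * weyl_act w f"
  by (rule scalar_linear_eqI[where F = "\<lambda>f. weyl_act w (expo k * f)" and G = "\<lambda>f. expo l * weyl_act w f"])
    (auto intro: scalar_linear_intros scalar_linear_weyl_act simp: weyl_act_expo expo_mult assms)

lemma lookup_weyl_act:
  assumes "inj w" shows "Poly_Mapping.lookup (weyl_act w f) (w m) = Poly_Mapping.lookup f m"
proof -
  have "Poly_Mapping.lookup (weyl_act w f) (w m) =
      (\<Sum>n\<in>Poly_Mapping.keys f. if n = m then Poly_Mapping.lookup f n else 0)"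
    unfolding weyl_act_eq lookup_lin_ext
    by (intro sum.cong) (auto simp: lookup_expo inj_eq[OF assms])
  then show ?thesis
    by (simp add: in_keys_iff)
qed

text \<open>The difference of \<open>p\<close> and \<open>q\<close> has coefficients constant along
  \<open>m + j k\<close>. As its support is finite and \<open>k \<noteq> 0\<close>, it
  vanishes.\<close>

lemma one_minus_expo_cancel:
  assumes "k \<noteq> 0" "(1 - expo (- k)) * p = (1 - expo (- k)) * q"
  shows "p = q"
proof -
  define d where "d = p - q"
  have "d = expo (- k) * d"
    using assms(2) by (simp add: d_def algebra_simps)
  then have step: "Poly_Mapping.lookup d m = Poly_Mapping.lookup d (m + k)" for m
    using lookup_expo_mult[of "- k" d m] by simp
  have shift: "Poly_Mapping.lookup d (m + real j *\<^sub>R k) = Poly_Mapping.lookup d m" for m j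
    by (induction j) (simp_all add: step[symmetric] scaleR_add_left add_ac(1)[symmetric] add.commute[of k])
  have "Poly_Mapping.lookup d m = 0" for m
  proof (rule ccontr)
    assume "Poly_Mapping.lookup d m \<noteq> 0"
    then have "range (\<lambda>j::nat. m + real j *\<^sub>R k) \<subseteq> Poly_Mapping.keys d"
      by (auto simp: in_keys_iff shift)
    moreover have "inj (\<lambda>j::nat. m + real j *\<^sub>R k)"
      using assms(1) by (auto simp: inj_on_def)
    ultimately show False
      using finite_subset finite_keys finite_imageD infinite_UNIV_nat by metis
  qed
  then have "d = 0"
    by (intro poly_mapping_eqI) simp
  then show ?thesis
    by (simp add: d_def)
qed

text \<open>The quotient of \<open>e\<^sup>m - e\<^sup>s\<^sup>m\<close> by \<open>1 - e\<^sup>-\<^sup>x\<close>, where \<open>s\<close> is the reflection in \<open>x\<close>, for integral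
  \<open>coroot x \<bullet> m\<close>.\<close>

definition string_sum :: "'a::euclidean_space \<Rightarrow> 'a \<Rightarrow> 'a \<Rightarrow>\<^sub>0 'i::linorder ratfun" where
  "string_sum x m = (let t = \<lfloor>coroot x \<bullet> m\<rfloor> in
     if t > 0 then \<Sum>j<nat t. expo (m - real j *\<^sub>R x)
     else - (\<Sum>j\<in>{1..nat (- t)}. expo (m + real j *\<^sub>R x)))"

definition diff_quot :: "'a::euclidean_space \<Rightarrow> ('a \<Rightarrow>\<^sub>0 'i::linorder ratfun) \<Rightarrow> 'a \<Rightarrow>\<^sub>0 'i ratfun" where
  "diff_quot x = lin_ext (string_sum x)"

lemma scalar_linear_diff_quot: "scalar_linear (diff_quot x)"
  by (simp add: diff_quot_def scalar_linear_intros)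

lemmas diff_quot_scale = scalar_linear_scale[OF scalar_linear_diff_quot]

lemma string_sum_telescope:
  fixes x m :: "'a::euclidean_space"
  assumes "coroot x \<bullet> m \<in> \<int>"
  shows "(1 - expo (- x)) * string_sum x m =
    (expo m - expo (reflection x m) :: 'a \<Rightarrow>\<^sub>0 'i::linorder ratfun)"
proof -
  obtain t where t: "coroot x \<bullet> m = of_int t"
    using assms by (auto elim!: Ints_cases)
  have up: "(1 - expo (- x)) * (\<Sum>j<n. expo (m - real j *\<^sub>R x)) =
      (expo m - expo (m - real n *\<^sub>R x) :: 'a \<Rightarrow>\<^sub>0 'i ratfun)" for n
  proof (induction n)
    case (Suc n)
    have eq: "(1 - expo (- x)) * expo (m - real n *\<^sub>R x) =
        expo (m - real n *\<^sub>R x) - expo (m - real (Suc n) *\<^sub>R x)"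
      by (simp add: left_diff_distrib expo_mult algebra_simps)
    show ?case
      by (simp only: sum.lessThan_Suc distrib_left Suc eq) simp
  qed simp
  have down: "(1 - expo (- x)) * (\<Sum>j\<in>{1..n}. expo (m + real j *\<^sub>R x)) =
      (expo (m + real n *\<^sub>R x) - expo m :: 'a \<Rightarrow>\<^sub>0 'i ratfun)" for n
  proof (induction n)
    case (Suc n)
    have eq1: "(1 - expo (- x)) * expo (m + real (Suc n) *\<^sub>R x) =
        expo (m + real (Suc n) *\<^sub>R x) - expo (m + real n *\<^sub>R x)"
      by (simp add: left_diff_distrib expo_mult algebra_simps)
    have eq2: "(\<Sum>j\<in>{1..Suc n}. expo (m + real j *\<^sub>R x)) =
        (\<Sum>j\<in>{1..n}. expo (m + real j *\<^sub>R x)) + expo (m + real (Suc n) *\<^sub>R x)"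
      by simp
    show ?case
      by (simp only: eq2 distrib_left Suc eq1) simp
  qed simp
  show ?thesis
    using up[of "nat t"] down[of "nat (- t)"] unfolding string_sum_def Let_def t reflection_def
    by auto
qed

text \<open>Exchanges the divisors \<open>1 - e^x\<close> and \<open>1 - e^-x\<close>, for
  reflections that send a positive root to a negative one.\<close>

lemma one_minus_unit_mult:
  fixes e :: "'b::comm_ring_1"
  assumes "e * x = 1" "(1 - x) * y = z"
  shows "(1 - e) * y = - (e * z)"
proof -
  have "e * ((1 - x) * y) = e * y - e * x * y"
    by (simp add: algebra_simps)
  then show ?thesis
    using assms by (simp add: left_diff_distrib)
qed

context weyl_data
begin

abbreviation GA :: "('a \<Rightarrow>\<^sub>0 'i ratfun) set" where "GA \<equiv> group_algebra R"

lemma GA_iff: "f \<in> GA \<longleftrightarrow> Poly_Mapping.keys f \<subseteq> wts"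
  by (simp add: group_algebra_def)

lemma GA_iff': "f \<in> GA \<longleftrightarrow> (\<forall>m. m \<notin> wts \<longrightarrow> Poly_Mapping.lookup f m = 0)"
  by (auto simp: GA_iff in_keys_iff)

lemma GA_add: "f \<in> GA \<Longrightarrow> g \<in> GA \<Longrightarrow> f + g \<in> GA"
  and GA_diff: "f \<in> GA \<Longrightarrow> g \<in> GA \<Longrightarrow> f - g \<in> GA"
  and GA_uminus: "f \<in> GA \<Longrightarrow> - f \<in> GA"
  and GA_scale: "f \<in> GA \<Longrightarrow> scale c f \<in> GA"
  and GA_expo: "m \<in> wts \<Longrightarrow> expo m \<in> GA"
  and GA_0: "0 \<in> GA"
  and GA_dderiv: "f \<in> GA \<Longrightarrow> dderiv y f \<in> GA"
  by (auto simp: GA_iff' lookup_add lookup_minus lookup_expo lookup_dderiv)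

lemma GA_sum: "(\<And>x. x \<in> A \<Longrightarrow> f x \<in> GA) \<Longrightarrow> sum f A \<in> GA"
  by (induction A rule: infinite_finite_induct) (auto intro: GA_0 GA_add)

lemma GA_lin_ext: "f \<in> GA \<Longrightarrow> (\<And>m. m \<in> wts \<Longrightarrow> g m \<in> GA) \<Longrightarrow> lin_ext g f \<in> GA"
  unfolding lin_ext_def by (intro GA_sum GA_scale) (auto simp: GA_iff)

lemma GA_weyl_act: "f \<in> GA \<Longrightarrow> (\<And>m. m \<in> wts \<Longrightarrow> w m \<in> wts) \<Longrightarrow> weyl_act w f \<in> GA"
  unfolding weyl_act_eq by (intro GA_lin_ext GA_expo)

lemma GA_diff_quot: "f \<in> GA \<Longrightarrow> x \<in> R \<Longrightarrow> diff_quot x f \<in> GA"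
  unfolding diff_quot_def string_sum_def Let_def
  by (rule GA_lin_ext) (auto intro!: GA_sum GA_uminus GA_expo wts_add wts_diff wts_scale root_wts[of x])

lemma diff_quot_eq:
  assumes "f \<in> GA" "x \<in> R"
  shows "(1 - expo (- x)) * diff_quot x f = f - weyl_act (reflection x) f"
proof (rule scalar_linear_eqI[where F = "\<lambda>f. (1 - expo (- x)) * diff_quot x f"
      and G = "\<lambda>f. f - weyl_act (reflection x) f"])
  show "scalar_linear (\<lambda>f. (1 - expo (- x)) * diff_quot x f)"
    by (rule scalar_linear_intros(4)[OF scalar_linear_intros(3) scalar_linear_diff_quot])
  show "scalar_linear (\<lambda>f. f - weyl_act (reflection x) f)"
    by (intro scalar_linear_intros(1,6) scalar_linear_weyl_act)
  fix m assume "m \<in> Poly_Mapping.keys f"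
  then have "coroot x \<bullet> m \<in> \<int>"
    using assms wts_coroot_Ints by (auto simp: GA_iff)
  then show "(1 - expo (- x)) * diff_quot x (expo m) = expo m - weyl_act (reflection x) (expo m)"
    by (simp add: diff_quot_def lin_ext_expo weyl_act_expo string_sum_telescope)
qed

lemma S_add: "S i (k + x) = reflection (refl_vec i) k + S i x"
  by (simp add: S_eq reflection_add)

text \<open>The defining equation of the quotient, transported by \<open>S i\<close>. The
  translation part affects the function but not the divisor.\<close>

lemma diff_quot_S_aux:
  assumes "i \<in> gens" "f \<in> GA" "x \<in> R"
  shows "(1 - expo (- reflection (refl_vec i) x)) * weyl_act (S i) (diff_quot x f) =
    weyl_act (S i) f - weyl_act (S i \<circ> reflection x) f"
proof -
  have "weyl_act (S i) ((1 - expo (- x)) * diff_quot x f) =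
      (1 - expo (- reflection (refl_vec i) x)) * weyl_act (S i) (diff_quot x f)"
    using weyl_act_expo_mult[of "S i" "- x" "- reflection (refl_vec i) x" "diff_quot x f"] S_add[of i "- x"]
    by (simp add: left_diff_distrib weyl_act_diff reflection_uminus)
  then show ?thesis
    by (simp add: diff_quot_eq[OF assms(2,3)] weyl_act_diff weyl_act_comp)
qed

lemma weyl_act_translate: "(\<And>x. v x = k + w x) \<Longrightarrow> weyl_act v f = expo k * weyl_act w f"
  by (rule scalar_linear_eqI[where G = "\<lambda>f. expo k * weyl_act w f"])
    (auto intro: scalar_linear_intros scalar_linear_weyl_act simp: weyl_act_expo expo_mult)

lemma reflection_S:
  "reflection x (S i m) = S i (reflection (reflection (refl_vec i) x) m) - offset i x *\<^sub>R x"
proof -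
  have "coroot x \<bullet> S i m = coroot (reflection (refl_vec i) x) \<bullet> m + offset i x"
    by (simp add: S_eq offset_def inner_diff_right coroot_reflection inner_reflection_swap)
  then show ?thesis
    by (simp add: reflection_def[of x] reflection_def[of "reflection (refl_vec i) x"] S_eq
        reflection_diff reflection_scaleR algebra_simps)
qed

text \<open>The commutation rules are checked after multiplication by \<open>1 - e\<^sup>-\<^sup>x\<close>, which can be cancelled.\<close>

lemma diff_quot_S_plus:
  assumes "i \<in> gens" "f \<in> GA" "x \<in> pos" "perm_sign i x = 1" "offset i x = 0"
  shows "diff_quot x (weyl_act (S i) f) = weyl_act (S i) (diff_quot (perm i x) f)"
proof (rule one_minus_expo_cancel[OF pos_nonzero[OF assms(3)]])
  have px: "perm i x = reflection (refl_vec i) x" "perm i x \<in> R"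
    using assms posD(1)[OF perm_pos[OF assms(1,3)]] by (simp_all add: perm_def)
  have "weyl_act (reflection x \<circ> S i) f = weyl_act (S i \<circ> reflection (perm i x)) f"
    using reflection_S[of x i] assms(5) px by (simp add: o_def)
  then show "(1 - expo (- x)) * diff_quot x (weyl_act (S i) f) =
      (1 - expo (- x)) * weyl_act (S i) (diff_quot (perm i x) f)"
    using diff_quot_S_aux[OF assms(1,2) px(2)] diff_quot_eq[OF GA_weyl_act[OF assms(2) S_wts[OF assms(1)]] posD(1)[OF assms(3)]]
    by (simp add: px(1) weyl_act_comp)
qed

text \<open>The linear part of \<open>S i\<close> sends \<open>perm i x\<close> to
  \<open>- x\<close>, so the transported quotient has divisor \<open>1 - e^x\<close>. Inverting it
  costs a factor \<open>- e^-x\<close>, matched by the translation hidden in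
  \<open>reflection x \<circ> S i\<close>.\<close>

lemma diff_quot_S_minus:
  assumes "i \<in> gens" "f \<in> GA" "x \<in> pos" "perm_sign i x = - 1" "offset i x = 1"
  shows "diff_quot x (weyl_act (S i) f) = weyl_act (S i) f - weyl_act (S i) (diff_quot (perm i x) f)"
proof (rule one_minus_expo_cancel[OF pos_nonzero[OF assms(3)]])
  have px: "perm i x = - reflection (refl_vec i) x" "perm i x \<in> R"
    using assms posD(1)[OF perm_pos[OF assms(1,3)]] by (simp_all add: perm_def)
  let ?A = "weyl_act (S i) f" and ?X = "weyl_act (S i) (diff_quot (perm i x) f)"
    and ?Z = "weyl_act (S i \<circ> reflection (perm i x)) f"
  have 1: "(1 - expo x) * ?X = ?A - ?Z"
    using diff_quot_S_aux[OF assms(1,2) px(2)] by (simp add: px(1) reflection_uminus)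
  have "weyl_act (reflection x \<circ> S i) f = expo (- x) * ?Z"
    by (rule weyl_act_translate) (use assms(5) px(1) in \<open>simp add: reflection_S\<close>)
  then have 2: "(1 - expo (- x)) * diff_quot x ?A = ?A - expo (- x) * ?Z"
    using diff_quot_eq[OF GA_weyl_act[OF assms(2) S_wts[OF assms(1)]] posD(1)[OF assms(3)]]
    by (simp add: weyl_act_comp)
  have 3: "expo (- x) * expo x = (1 :: 'a \<Rightarrow>\<^sub>0 'i ratfun)"
    by (simp add: expo_mult expo_0)
  show "(1 - expo (- x)) * diff_quot x ?A = (1 - expo (- x)) * (?A - ?X)"
    using one_minus_unit_mult[OF 3 1] 2 by (simp add: algebra_simps)
qed

text \<open>Here \<open>S i\<close> and the reflection in \<open>pos_vec i\<close> agree up to a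
  translation, so both of their composites act on \<open>f\<close> as translations. This is the
  source of the term in \<open>f\<close> itself, which becomes the parameter term of the
  recursion.\<close>

lemma diff_quot_S_pos_vec:
  assumes "i \<in> gens" "f \<in> GA"
  shows "diff_quot (pos_vec i) (weyl_act (S i) f) =
    weyl_act (S i) f + scale (if i = 0 then 1 else - 1) f - weyl_act (S i) (diff_quot (pos_vec i) f)"
proof (rule one_minus_expo_cancel[OF pos_nonzero[OF pos_vec_pos[OF assms(1)]]])
  let ?x = "pos_vec i" and ?c = "scale (if i = 0 then 1 else - 1) f"
  let ?A = "weyl_act (S i) f" and ?X = "weyl_act (S i) (diff_quot ?x f)"
    and ?Z = "weyl_act (S i \<circ> reflection ?x) f"
  have x: "?x \<in> R" "reflection (refl_vec i) ?x = - ?x" "reflection ?x = reflection (refl_vec i)"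
    using posD(1) pos_vec_pos assms(1) by (auto simp: pos_vec_def refl_vec_def)
  have 1: "(1 - expo ?x) * ?X = ?A - ?Z"
    using diff_quot_S_aux[OF assms x(1)] by (simp add: x(2))
  have m1: "scale (- 1) f = - f"
    by (rule poly_mapping_eqI) simp
  have Z: "(1 - expo (- ?x)) * ?c = expo (- ?x) * ?Z - weyl_act (reflection ?x \<circ> S i) f"
  proof (cases "i = 0")
    case True
    have "?Z = expo ?x * weyl_act id f"
      by (rule weyl_act_translate) (simp add: True S_eq refl_vec_def refl_off_def pos_vec_def)
    moreover have "weyl_act (reflection ?x \<circ> S i) f = expo (- ?x) * weyl_act id f"
      by (rule weyl_act_translate)
        (simp add: True S_eq refl_vec_def refl_off_def pos_vec_def reflection_add)
    moreover have "expo (- ?x) * expo ?x = (1 :: 'a \<Rightarrow>\<^sub>0 'i ratfun)"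
      by (simp add: expo_mult expo_0)
    ultimately show ?thesis
      using True by (simp add: weyl_act_id left_diff_distrib flip: mult.assoc)
  next
    case False
    then have "S i \<circ> reflection ?x = id" "reflection ?x \<circ> S i = id"
      using assms(1) by (auto simp: fun_eq_iff gens_def S_idx pos_vec_def)
    then show ?thesis
      using False by (simp add: weyl_act_id m1 left_diff_distrib algebra_simps)
  qed
  have 2: "(1 - expo (- ?x)) * diff_quot ?x ?A = ?A - weyl_act (reflection ?x \<circ> S i) f"
    using diff_quot_eq[OF GA_weyl_act[OF assms(2) S_wts[OF assms(1)]] x(1)]
    by (simp add: weyl_act_comp)
  have 3: "expo (- ?x) * expo ?x = (1 :: 'a \<Rightarrow>\<^sub>0 'i ratfun)"
    by (simp add: expo_mult expo_0)
  show "(1 - expo (- ?x)) * diff_quot ?x ?A = (1 - expo (- ?x)) * (?A + ?c - ?X)"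
    unfolding right_diff_distrib distrib_left one_minus_unit_mult[OF 3 1] 2 Z
    by (simp add: algebra_simps)
qed

end

section \<open>Cherednik operators\<close>

lemma scale_half_add:
  fixes f :: "'a::euclidean_space \<Rightarrow>\<^sub>0 'i::linorder ratfun"
  shows "scale (const (1/2)) f + scale (const (1/2)) f = f"
  unfolding scale_add_left[symmetric] using const_half_add[of "1 :: 'i ratfun"]
  by (simp only: mult_1_right scale_1)

lemma scale_uminus_1: "scale (- 1) f = - f"
  by (rule poly_mapping_eqI) simp

lemma scale_uminus_left: "scale (- c) f = - scale c f"
  by (rule poly_mapping_eqI) simp

lemma dderiv_weyl_act:
  assumes "\<And>m. y \<bullet> w m = z \<bullet> m - c"
  shows "dderiv y (weyl_act w f) = weyl_act w (dderiv z f) - scale (const c) (weyl_act w f)"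
  by (rule scalar_linear_eqI[where F = "\<lambda>f. dderiv y (weyl_act w f)"
        and G = "\<lambda>f. weyl_act w (dderiv z f) - scale (const c) (weyl_act w f)"])
    (auto intro!: scalar_linear_intros(4-7)[OF scalar_linear_weyl_act]
        scalar_linear_intros(4)[OF scalar_linear_dderiv]
        scalar_linear_intros(6,7) scalar_linear_weyl_act scalar_linear_dderiv
      simp: weyl_act_expo dderiv_expo weyl_act_scale assms const_diff scale_diff_left)

lemma dderiv_add: "dderiv (x + y) f = dderiv x f + dderiv y f"
  by (rule poly_mapping_eqI) (simp add: lookup_dderiv lookup_add inner_add_left const_add distrib_right)

lemma dderiv_scaleR: "dderiv (c *\<^sub>R y) f = scale (const c) (dderiv y f)"
  by (rule poly_mapping_eqI) (simp add: lookup_dderiv const_mult mult.assoc)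

lemma dderiv_Basis: "dderiv y f = (\<Sum>b\<in>Basis. scale (const (b \<bullet> y)) (dderiv b f))"
proof (rule poly_mapping_eqI)
  fix m
  have "y \<bullet> m = (\<Sum>b\<in>Basis. (b \<bullet> y) * (b \<bullet> m))"
    by (subst euclidean_inner) (simp add: inner_commute)
  then show "Poly_Mapping.lookup (dderiv y f) m =
      Poly_Mapping.lookup (\<Sum>b\<in>Basis. scale (const (b \<bullet> y)) (dderiv b f)) m"
    by (simp add: lookup_dderiv lookup_sum const_sum const_mult sum_distrib_right mult.assoc)
qed

text \<open>The string stops short of the reflected weight when the pairing is positive and includes
  it otherwise. This asymmetry makes the operators triangular inside an orbit.\<close>

lemma string_sum_support:
  assumes "coroot x \<bullet> n \<in> \<int>" "m \<noteq> n" "Poly_Mapping.lookup (string_sum x n) m \<noteq> 0"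
  obtains j :: nat where "j > 0" "m = n - real j *\<^sub>R x" "real j < coroot x \<bullet> n"
  | j :: nat where "j > 0" "m = n + real j *\<^sub>R x" "real j \<le> - (coroot x \<bullet> n)"
proof -
  obtain t where t: "coroot x \<bullet> n = of_int t"
    using assms(1) by (auto elim!: Ints_cases)
  show ?thesis
  proof (cases "t > 0")
    case True
    then have "(\<Sum>j<nat t. if n - real j *\<^sub>R x = m then 1 else 0 :: 'b ratfun) \<noteq> 0"
      using assms(3) by (simp add: string_sum_def t lookup_sum lookup_expo)
    then obtain j where "j < nat t" "n - real j *\<^sub>R x = m"
      by (rule sum.not_neutral_contains_not_neutral) (auto split: if_splits)
    moreover from this have "j > 0"
      using assms(2) by (cases j) auto
    ultimately show ?thesis
      using that(1)[of j] t by auto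
  next
    case False
    then have "(\<Sum>j\<in>{1..nat (- t)}. if n + real j *\<^sub>R x = m then 1 else 0 :: 'b ratfun) \<noteq> 0"
      using assms(3) by (simp add: string_sum_def t lookup_sum lookup_expo)
    then obtain j where "j \<in> {1..nat (- t)}" "n + real j *\<^sub>R x = m"
      by (rule sum.not_neutral_contains_not_neutral) (auto split: if_splits)
    then show ?thesis
      using that(2)[of j] t False by auto
  qed
qed

text \<open>Subtracting 1/2 leaves half of \<open>sign_eps\<close>: the shift of the weights is read
  off the diagonal, and the value at 0 reflects the empty string.\<close>

lemma string_sum_diag:
  assumes "coroot x \<bullet> n \<in> \<int>" "x \<noteq> 0"
  shows "Poly_Mapping.lookup (string_sum x n) n = (if coroot x \<bullet> n > 0 then 1 else 0)"
proof -
  obtain t where t: "coroot x \<bullet> n = of_int t"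
    using assms(1) by (auto elim!: Ints_cases)
  have "(\<Sum>j<nat t. if n - real j *\<^sub>R x = n then 1 else 0) = (1 :: 'b ratfun)" if "t > 0"
  proof -
    have "(\<Sum>j<nat t. if n - real j *\<^sub>R x = n then 1 else 0) =
        (\<Sum>j<nat t. if j = 0 then 1 else 0 :: 'b ratfun)"
      using assms(2) by (intro sum.cong) auto
    then show ?thesis using that by simp
  qed
  moreover have "(\<Sum>j\<in>{1..nat (- t)}. if n + real j *\<^sub>R x = n then 1 else 0) = (0 :: 'b ratfun)"
    using assms(2) by (intro sum.neutral) auto
  ultimately show ?thesis
    using assms(2) by (simp add: string_sum_def t lookup_sum lookup_expo)
qed

context weyl_data
begin

text \<open>Removing half the identity absorbs the extra summand of
  \<open>diff_quot_S_minus\<close>, so that \<open>perm_sign\<close> enters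
  \<open>sym_diff_quot_S\<close> as a mere factor.\<close>

definition sym_diff_quot :: "'a \<Rightarrow> ('a \<Rightarrow>\<^sub>0 'i ratfun) \<Rightarrow> 'a \<Rightarrow>\<^sub>0 'i ratfun" where
  "sym_diff_quot x f = diff_quot x f - scale (const (1/2)) f"

definition cherednik :: "'a \<Rightarrow> ('a \<Rightarrow>\<^sub>0 'i ratfun) \<Rightarrow> 'a \<Rightarrow>\<^sub>0 'i ratfun" where
  "cherednik y f = dderiv y f + (\<Sum>x\<in>pos. scale (param \<kappa> x * const (y \<bullet> x)) (sym_diff_quot x f))"

lemma scalar_linear_sym_diff_quot: "scalar_linear (sym_diff_quot x)"
  unfolding sym_diff_quot_def[abs_def] by (intro scalar_linear_intros(6,7,1) scalar_linear_diff_quot)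

lemma scalar_linear_cherednik: "scalar_linear (cherednik y)"
  unfolding cherednik_def[abs_def]
  by (intro scalar_linear_intros(5,7) scalar_linear_sum_intro scalar_linear_dderiv scalar_linear_sym_diff_quot)

lemmas cherednik_add = scalar_linear_add[OF scalar_linear_cherednik]
  and cherednik_diff = scalar_linear_diff[OF scalar_linear_cherednik]
  and cherednik_scale = scalar_linear_scale[OF scalar_linear_cherednik]
  and cherednik_sum = scalar_linear_sum[OF scalar_linear_cherednik]

lemma GA_cherednik: "f \<in> GA \<Longrightarrow> cherednik y f \<in> GA"
  unfolding cherednik_def sym_diff_quot_def
  by (intro GA_add GA_sum GA_scale GA_diff GA_dderiv GA_diff_quot) (auto dest: posD)

lemma cherednik_dir_add: "cherednik (x + y) f = cherednik x f + cherednik y f"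
  by (simp add: cherednik_def dderiv_add inner_add_left const_add distrib_left scale_add_left sum.distrib)

lemma cherednik_dir_scaleR: "cherednik (c *\<^sub>R y) f = scale (const c) (cherednik y f)"
  by (simp add: cherednik_def dderiv_scaleR const_mult scale_add_right scale_sum_right scale_scale mult.left_commute)

lemma cherednik_dir_sum: "cherednik (sum g A) f = (\<Sum>x\<in>A. cherednik (g x) f)"
proof -
  have "cherednik 0 f = 0"
    using cherednik_dir_scaleR[of 0 0 f] by simp
  then show ?thesis
    by (induction A rule: infinite_finite_induct) (simp_all add: cherednik_dir_add)
qed

lemma cherednik_Basis: "(\<Sum>b\<in>Basis. scale (const (y \<bullet> b)) (cherednik b f)) = cherednik y f"
  by (subst (2) euclidean_representation[of y, symmetric]) (simp add: cherednik_dir_sum cherednik_dir_scaleR)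

lemma cherednik_dir_diff: "cherednik (x - y) f = cherednik x f - cherednik y f"
  using cherednik_dir_add[of "x - y" y f] by simp

lemma sym_diff_quot_S:
  assumes "i \<in> gens" "f \<in> GA" "x \<in> pos"
  shows "sym_diff_quot x (weyl_act (S i) f) = scale (const (perm_sign i x)) (weyl_act (S i) (sym_diff_quot (perm i x) f)) +
    (if x = pos_vec i then scale (if i = 0 then 1 else - 1) f else 0)"
proof -
  let ?A = "weyl_act (S i) f" and ?h = "\<lambda>f. scale (const (1/2)) f :: 'a \<Rightarrow>\<^sub>0 'i ratfun"
  have half: "?A = ?h ?A + ?h ?A" by (simp only: scale_half_add)
  have m1: "const (- 1) = (- 1 :: 'i ratfun)" by (simp add: const_uminus)
  show ?thesis
  proof (cases "x = pos_vec i")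
    case True
    then show ?thesis
      using half assms
      by (simp add: sym_diff_quot_def diff_quot_S_pos_vec perm_pos_vec perm_sign_pos_vec weyl_act_diff weyl_act_scale
          m1 scale_uminus_1 algebra_simps)
  next
    case False
    then show ?thesis
    proof (rule gens_cases[OF assms(1,3)])
      assume "perm_sign i x = 1" "offset i x = 0"
      then show ?thesis
        using False diff_quot_S_plus[OF assms] by (simp add: sym_diff_quot_def weyl_act_diff weyl_act_scale)
    next
      assume "i = 0" "perm_sign i x = - 1" "offset i x = 1"
      then show ?thesis
        using half False diff_quot_S_minus[OF assms]
        by (simp add: sym_diff_quot_def weyl_act_diff weyl_act_scale m1 scale_uminus_1 algebra_simps)
    qed
  qed
qed

text \<open>The sign in \<open>sym_diff_quot_S\<close> cancels the one in
  \<open>?y \<bullet> perm i x\<close>, so the sum is reindexed by \<open>perm i\<close>. Only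
  \<open>pos_vec i\<close> leaves a remainder.\<close>

lemma cherednik_S:
  assumes i: "i \<in> gens" and f: "f \<in> GA"
  shows "cherednik y (weyl_act (S i) f) = weyl_act (S i) (cherednik (reflection (refl_vec i) y) f)
    - scale (const (refl_off i * (y \<bullet> refl_vec i))) (weyl_act (S i) f)
    - scale (param \<kappa> (refl_vec i) * const (y \<bullet> refl_vec i)) f"
proof -
  let ?y = "reflection (refl_vec i) y" and ?A = "weyl_act (S i) f"
  let ?k = "\<lambda>x. param \<kappa> x" and ?c = "if i = 0 then 1 else - 1 :: 'i ratfun"
  have "y \<bullet> S i m = ?y \<bullet> m - refl_off i * (y \<bullet> refl_vec i)" for m
    by (simp add: S_eq inner_diff_right inner_reflection_swap)
  then have 1: "dderiv y ?A =
      weyl_act (S i) (dderiv ?y f) - scale (const (refl_off i * (y \<bullet> refl_vec i))) ?A"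
    by (rule dderiv_weyl_act)
  have "(\<Sum>x\<in>pos. scale (?k x * const (y \<bullet> x)) (sym_diff_quot x ?A)) =
      (\<Sum>x\<in>pos. scale (?k (perm i x) * const (?y \<bullet> perm i x)) (weyl_act (S i) (sym_diff_quot (perm i x) f))
        + (if x = pos_vec i then scale (?k x * const (y \<bullet> x)) (scale ?c f) else 0))"
  proof (rule sum.cong[OF refl])
    fix x assume x: "x \<in> pos"
    have "?y \<bullet> perm i x = (y \<bullet> x) * perm_sign i x"
      by (simp add: perm_def)
    then have "scale (?k x * const (y \<bullet> x)) (scale (const (perm_sign i x)) g) =
        scale (?k (perm i x) * const (?y \<bullet> perm i x)) g" for g :: "'a \<Rightarrow>\<^sub>0 'i ratfun"
      by (simp add: param_perm[OF i x] scale_scale const_mult mult.assoc)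
    then show "scale (?k x * const (y \<bullet> x)) (sym_diff_quot x ?A) =
      scale (?k (perm i x) * const (?y \<bullet> perm i x)) (weyl_act (S i) (sym_diff_quot (perm i x) f))
        + (if x = pos_vec i then scale (?k x * const (y \<bullet> x)) (scale ?c f) else 0)"
      unfolding sym_diff_quot_S[OF i f x] scale_add_right by simp
  qed
  also have "\<dots> = (\<Sum>x\<in>pos. scale (?k x * const (?y \<bullet> x)) (weyl_act (S i) (sym_diff_quot x f)))
      + scale (?k (pos_vec i) * const (y \<bullet> pos_vec i)) (scale ?c f)"
    using sum.reindex_bij_betw[OF bij_perm[OF i],
        of "\<lambda>x. scale (?k x * const (?y \<bullet> x)) (weyl_act (S i) (sym_diff_quot x f))"] pos_vec_pos[OF i]
    by (simp add: sum.distrib finite_pos)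
  \<comment> \<open>For \<open>i = 0\<close> the sign of \<open>?c\<close> compensates
    \<open>pos_vec 0 = - refl_vec 0\<close>, so that one formula covers all generators.\<close>
  also have "scale (?k (pos_vec i) * const (y \<bullet> pos_vec i)) (scale ?c f) =
      - scale (?k (refl_vec i) * const (y \<bullet> refl_vec i)) f"
    using param_uminus[OF beta_root]
    by (auto simp: pos_vec_def refl_vec_def scale_scale const_uminus scale_uminus_left)
  finally show ?thesis
    unfolding cherednik_def[of y] cherednik_def[of ?y]
    by (simp add: 1 weyl_act_add weyl_act_sum weyl_act_scale)
qed

definition eigenf :: "'a \<Rightarrow> ('a \<Rightarrow>\<^sub>0 'i ratfun) \<Rightarrow> bool" where
  "eigenf m f \<longleftrightarrow> f \<in> GA \<and> (\<forall>y. cherednik y f = scale (shifted_val m y) f)"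

text \<open>Two unwanted multiples of \<open>f\<close> cancel: one from the commutation rule, the
  other from the eigenvalue of \<open>f\<close> differing from the new one. Each is the product of
  parameter, pairing and \<open>shifted_aff_val i m\<close>.\<close>

lemma eigenf_step:
  assumes i: "i \<in> gens" and m: "m \<in> wts" "S i m \<noteq> m" and f: "eigenf m f"
  shows "eigenf (S i m)
    (scale (shifted_aff_val i m) (weyl_act (S i) f) + scale (param \<kappa> (refl_vec i)) f)"
proof -
  let ?A = "weyl_act (S i) f" and ?k = "param \<kappa> (refl_vec i)" and ?a = "shifted_aff_val i m"
  have fGA: "f \<in> GA" and D: "cherednik y f = scale (shifted_val m y) f" for y
    using f by (auto simp: eigenf_def)
  have "cherednik y (scale ?a ?A + scale ?k f) = scale (shifted_val (S i m) y) (scale ?a ?A + scale ?k f)" for y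
  proof -
    let ?y = "reflection (refl_vec i) y"
    have "cherednik y ?A = scale (shifted_val (S i m) y) ?A - scale (?k * const (y \<bullet> refl_vec i)) f"
      unfolding cherednik_S[OF i fGA] D shifted_val_S[OF i m] by (simp add: weyl_act_scale scale_diff_left)
    moreover have "cherednik y f = scale (shifted_val (S i m) y) f + scale (const (y \<bullet> refl_vec i) * ?a) f"
      unfolding D shifted_val_S'[OF i m] by (simp add: scale_diff_left)
    ultimately show ?thesis
      by (simp add: cherednik_add cherednik_scale scale_add_right scale_diff_right scale_scale mult_ac)
  qed
  moreover have "scale ?a ?A + scale ?k f \<in> GA"
    using fGA S_wts[OF i] by (intro GA_add GA_scale GA_weyl_act)
  ultimately show ?thesis
    by (simp add: eigenf_def)
qed

text \<open>For pairings 0 and 1 the string is empty or a single term, so no other exponential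
  arises.\<close>

lemma eigenf_orbit_reps:
  assumes "m \<in> orbit_reps R \<alpha>"
  shows "eigenf m (expo m)"
proof -
  have m: "m \<in> wts" and c: "coroot x \<bullet> m = 0 \<or> coroot x \<bullet> m = 1" if "x \<in> pos" for x
    using assms that by (auto simp: orbit_reps_def)
  have mw: "m \<in> wts"
    using assms by (auto simp: orbit_reps_def)
  have "sym_diff_quot x (expo m) = scale (const (sign_eps (coroot x \<bullet> m) / 2)) (expo m)" if x: "x \<in> pos" for x
  proof -
    have "scale (const (1/2)) (expo m) + scale (const (1/2)) (expo m) = (expo m :: 'a \<Rightarrow>\<^sub>0 'i ratfun)"
      by (rule scale_half_add)
    moreover have "const (- 1 / 2) = (- const (1/2) :: 'i ratfun)"
      by (simp flip: const_uminus)
    ultimately show ?thesis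
      using c[OF x]
      by (auto simp: sym_diff_quot_def diff_quot_def lin_ext_expo string_sum_def sign_eps_def scale_uminus_left
          algebra_simps)
  qed
  then have "cherednik y (expo m) = scale (shifted_val m y) (expo m)" for y
    by (simp add: cherednik_def shifted_val_def dderiv_expo scale_add_left scale_sum_left scale_scale mult.assoc
        inner_commute flip: const_mult) (simp add: mult_ac)
  then show ?thesis
    using mw by (simp add: eigenf_def GA_expo)
qed

text \<open>The weights \<open>m \<noteq> n\<close> for which \<open>e\<^sup>m\<close> can occur in \<open>cherednik y (expo n)\<close>.\<close>

definition below :: "'a \<Rightarrow> 'a \<Rightarrow> bool" where
  "below m n \<longleftrightarrow> (\<exists>x\<in>pos. \<exists>j::nat. j > 0 \<and>
     (m = n - real j *\<^sub>R x \<and> real j < coroot x \<bullet> n \<or> m = n + real j *\<^sub>R x \<and> real j \<le> - (coroot x \<bullet> n)))"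

lemma norm_string:
  assumes "x \<noteq> 0"
  shows "(norm (n + r *\<^sub>R x))\<^sup>2 = (norm n)\<^sup>2 + r * (r + coroot x \<bullet> n) * (norm x)\<^sup>2"
proof -
  have "(norm (n + r *\<^sub>R x))\<^sup>2 = (norm n)\<^sup>2 + r * r * (norm x)\<^sup>2 + r * (2 * (x \<bullet> n))"
    by (simp add: power2_norm_eq_inner inner_add_left inner_add_right inner_commute algebra_simps)
  also have "2 * (x \<bullet> n) = (coroot x \<bullet> n) * (norm x)\<^sup>2"
    using assms by (simp add: power2_norm_eq_inner coroot_inner)
  finally show ?thesis
    by (simp add: algebra_simps)
qed

text \<open>The squared norm is quadratic along a string, smaller strictly inside than at its ends.
  An equal norm is possible only at the reflected end, which is reached only by adding multiples of
  a positive root.\<close>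

lemma below_norm:
  assumes "below m n" shows "norm m \<le> norm n" and "norm m = norm n \<Longrightarrow> ht n < ht m"
proof -
  obtain x j where x: "x \<in> pos" "j > (0::nat)"
    and *: "m = n - real j *\<^sub>R x \<and> real j < coroot x \<bullet> n \<or>
      m = n + real j *\<^sub>R x \<and> real j \<le> - (coroot x \<bullet> n)"
    using assms unfolding below_def by blast
  have x0: "x \<noteq> 0" "(norm x)\<^sup>2 > 0" using pos_nonzero x by auto
  have "norm m < norm n \<or> norm m \<le> norm n \<and> ht n < ht m"
    using *
  proof
    assume a: "m = n - real j *\<^sub>R x \<and> real j < coroot x \<bullet> n"
    have "(norm m)\<^sup>2 = (norm n)\<^sup>2 + (- real j) * (- real j + coroot x \<bullet> n) * (norm x)\<^sup>2"
      using norm_string[OF x0(1), of n "- real j"] a by simp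
    moreover have "(- real j) * (- real j + coroot x \<bullet> n) * (norm x)\<^sup>2 < 0"
      using a x(2) x0 by (intro mult_neg_pos) auto
    ultimately have "(norm m)\<^sup>2 < (norm n)\<^sup>2" by linarith
    then show ?thesis
      by (simp add: power2_less_imp_less)
  next
    assume a: "m = n + real j *\<^sub>R x \<and> real j \<le> - (coroot x \<bullet> n)"
    have "(norm m)\<^sup>2 = (norm n)\<^sup>2 + real j * (real j + coroot x \<bullet> n) * (norm x)\<^sup>2"
      using norm_string[OF x0(1), of n "real j"] a by simp
    moreover have "real j * (real j + coroot x \<bullet> n) * (norm x)\<^sup>2 \<le> 0"
      using a x(2) x0 by (intro mult_nonpos_nonneg mult_nonneg_nonpos) auto
    ultimately have "(norm m)\<^sup>2 \<le> (norm n)\<^sup>2" by linarith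
    then have "norm m \<le> norm n"
      by (rule power2_le_imp_le) simp
    moreover have "ht n < ht m"
      using a x ht_pos by (simp add: ht_add ht_scaleR)
    ultimately show ?thesis by simp
  qed
  then show "norm m \<le> norm n" "norm m = norm n \<Longrightarrow> ht n < ht m" by auto
qed

lemma lookup_cherednik_top:
  assumes "f \<in> GA" "m \<in> wts" "\<And>n. n \<in> Poly_Mapping.keys f \<Longrightarrow> \<not> below m n"
  shows "Poly_Mapping.lookup (cherednik y f) m = shifted_val m y * Poly_Mapping.lookup f m"
proof -
  have T: "Poly_Mapping.lookup (sym_diff_quot x f) m =
      const (sign_eps (coroot x \<bullet> m) / 2) * Poly_Mapping.lookup f m" if x: "x \<in> pos" for x
  proof -
    have "Poly_Mapping.lookup (diff_quot x f) m = (\<Sum>n\<in>Poly_Mapping.keys f.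
        if n = m then Poly_Mapping.lookup f m * (if coroot x \<bullet> m > 0 then 1 else 0) else 0)"
      unfolding diff_quot_def lookup_lin_ext
    proof (rule sum.cong[OF refl])
      fix n assume n: "n \<in> Poly_Mapping.keys f"
      then have int: "coroot x \<bullet> n \<in> \<int>"
        using assms(1) wts_coroot_Ints posD(1)[OF x] by (auto simp: GA_iff)
      show "Poly_Mapping.lookup f n * Poly_Mapping.lookup (string_sum x n) m =
        (if n = m then Poly_Mapping.lookup f m * (if coroot x \<bullet> m > 0 then 1 else 0) else 0)"
      proof (cases "n = m")
        case True
        moreover have "Poly_Mapping.lookup (string_sum x n :: 'a \<Rightarrow>\<^sub>0 'i ratfun) n =
            (if coroot x \<bullet> n > 0 then 1 else 0)"
          by (rule string_sum_diag[OF int pos_nonzero[OF x]])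
        ultimately show ?thesis by simp
      next
        case False
        have "Poly_Mapping.lookup (string_sum x n :: 'a \<Rightarrow>\<^sub>0 'i ratfun) m = 0"
        proof (rule ccontr)
          assume "\<not> ?thesis"
          then have "below m n"
            using x False by (elim string_sum_support[OF int False[symmetric]]) (auto simp: below_def)
          then show False
            using assms(3) n by blast
        qed
        then show ?thesis
          using False by simp
      qed
    qed
    also have "\<dots> = (if coroot x \<bullet> m > 0 then 1 else 0) * Poly_Mapping.lookup f m"
      by (simp add: in_keys_iff)
    finally have "Poly_Mapping.lookup (sym_diff_quot x f) m =
        ((if coroot x \<bullet> m > 0 then const 1 else const 0) - const (1/2)) * Poly_Mapping.lookup f m"
      by (simp add: sym_diff_quot_def lookup_minus left_diff_distrib)
    moreover have "(if coroot x \<bullet> m > 0 then const 1 else const 0) - const (1/2) =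
        (const (sign_eps (coroot x \<bullet> m) / 2) :: 'i ratfun)"
      by (simp add: sign_eps_def del: const_0 const_1 flip: const_diff)
    ultimately show ?thesis by simp
  qed
  have "Poly_Mapping.lookup (cherednik y f) m = const (y \<bullet> m) * Poly_Mapping.lookup f m +
      (\<Sum>x\<in>pos. param \<kappa> x * const (y \<bullet> x) * (const (sign_eps (coroot x \<bullet> m) / 2) * Poly_Mapping.lookup f m))"
    by (simp add: cherednik_def lookup_add lookup_dderiv lookup_sum T)
  also have "\<dots> = shifted_val m y * Poly_Mapping.lookup f m"
    unfolding shifted_val_def distrib_right sum_distrib_right
    by (simp add: inner_commute mult.assoc const_mult[symmetric]) (simp add: mult_ac flip: const_mult)
  finally show ?thesis .
qed

text \<open>At an extreme weight of the support outside \<open>T\<close> nothing else contributes: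
  contributors in \<open>T\<close> stay in \<open>T\<close>, and others would be more extreme. So
  the diagonal entry there equals the eigenvalue at \<open>l\<close>, and the weight is
  \<open>l\<close>.\<close>

lemma eigenf_keys:
  assumes "eigenf l f" "l \<in> T" "\<And>m n. below m n \<Longrightarrow> n \<in> T \<Longrightarrow> m \<in> T"
  shows "Poly_Mapping.keys f \<subseteq> T"
proof (rule ccontr)
  assume *: "\<not> ?thesis"
  define A where "A = Poly_Mapping.keys f - T"
  have "finite A" "A \<noteq> {}"
    using * by (auto simp: A_def)
  then obtain m1 where m1: "m1 \<in> A" "\<And>n. n \<in> A \<Longrightarrow> norm n \<le> norm m1"
    using finite_has_max[of A norm] by metis
  define B where "B = {n\<in>A. norm n = norm m1}"
  have "finite B" "B \<noteq> {}"
    using \<open>finite A\<close> m1 by (auto simp: B_def)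
  \<comment> \<open>The order is by larger norm and then smaller height, opposite to the direction
    of \<open>below\<close>.\<close>
  then obtain m where m: "m \<in> B" "\<And>n. n \<in> B \<Longrightarrow> - ht n \<le> - ht m"
    using finite_has_max[of B "\<lambda>n. - ht n"] by metis
  have mA: "m \<in> A" "norm m = norm m1"
    using m by (auto simp: B_def)
  have fGA: "f \<in> GA" using assms(1) by (simp add: eigenf_def)
  have mw: "m \<in> wts" using mA fGA by (auto simp: A_def GA_iff)
  have "\<not> below m n" if n: "n \<in> Poly_Mapping.keys f" for n
  proof
    assume b: "below m n"
    then have "n \<notin> T" using assms(3) mA by (auto simp: A_def)
    then have "n \<in> A" using n by (simp add: A_def)
    then have "norm n = norm m"
      using m1 mA below_norm(1)[OF b] by force
    then have "n \<in> B" using \<open>n \<in> A\<close> mA by (simp add: B_def)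
    then show False
      using m(2)[of n] below_norm(2)[OF b] \<open>norm n = norm m\<close> by simp
  qed
  then have "Poly_Mapping.lookup (cherednik y f) m = shifted_val m y * Poly_Mapping.lookup f m" for y
    by (rule lookup_cherednik_top[OF fGA mw])
  then have "shifted_val l y * Poly_Mapping.lookup f m = shifted_val m y * Poly_Mapping.lookup f m" for y
    using assms(1) by (simp add: eigenf_def)
  moreover have "Poly_Mapping.lookup f m \<noteq> 0"
    using mA by (simp add: A_def in_keys_iff)
  ultimately have "l = m"
    by (intro shifted_val_inject) simp
  then show False
    using assms(2) mA by (simp add: A_def)
qed

end

section \<open>The Heckman--Opdam operator on invariants\<close>

context weyl_data
begin

definition cherednik_sq :: "('a \<Rightarrow>\<^sub>0 'i ratfun) \<Rightarrow> 'a \<Rightarrow>\<^sub>0 'i ratfun" where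
  "cherednik_sq f = (\<Sum>b\<in>Basis. cherednik b (cherednik b f))"

lemma scalar_linear_cherednik_sq: "scalar_linear cherednik_sq"
  unfolding cherednik_sq_def[abs_def]
  by (intro scalar_linear_sum_intro) (rule scalar_linear_intros(4)[OF scalar_linear_cherednik scalar_linear_cherednik])

text \<open>Invariance of a trace under a change of orthonormal basis: each mixed term gives
  \<open>2 / (x \<bullet> x)\<close> times \<open>?Q\<close>, and the quadratic term gives twice
  that with the opposite sign.\<close>

lemma cherednik_sq_reflection_sum:
  assumes "x \<noteq> 0"
  shows "(\<Sum>b\<in>Basis. cherednik (reflection x b) (cherednik (reflection x b) f)) = cherednik_sq f"
proof -
  let ?c = "\<lambda>b. const (coroot x \<bullet> b) :: 'i ratfun"
  let ?Q = "cherednik x (cherednik x f)"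
  have r: "cherednik (reflection x b) g = cherednik b g - scale (?c b) (cherednik x g)" for b g
    by (simp add: reflection_def cherednik_dir_diff cherednik_dir_scaleR)
  have cr: "cherednik (coroot x) g = scale (const (2 / (x \<bullet> x))) (cherednik x g)" for g
    by (simp add: coroot_def cherednik_dir_scaleR)
  have "(\<Sum>b\<in>Basis. cherednik (reflection x b) (cherednik (reflection x b) f)) =
      cherednik_sq f - cherednik x (\<Sum>b\<in>Basis. scale (?c b) (cherednik b f)) - (\<Sum>b\<in>Basis. scale (?c b) (cherednik b (cherednik x f)))
      + scale (\<Sum>b\<in>Basis. ?c b * ?c b) ?Q"
    unfolding r cherednik_sq_def
    by (simp add: cherednik_diff cherednik_scale cherednik_sum scale_diff_right scale_scale scale_sum_left
        sum.distrib sum_subtractf algebra_simps)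
  also have "(\<Sum>b\<in>Basis. ?c b * ?c b) = const (coroot x \<bullet> coroot x)"
    by (subst euclidean_inner) (simp add: const_sum const_mult)
  also have "const (coroot x \<bullet> coroot x) = const (2 / (x \<bullet> x)) + (const (2 / (x \<bullet> x)) :: 'i ratfun)"
    using assms by (simp add: coroot_def flip: const_add)
  finally show ?thesis
    unfolding cherednik_Basis cr cherednik_scale scale_add_left by simp
qed

text \<open>Moving the reflection through both factors leaves an error proportional to the sum over
  \<open>b\<close> of \<open>(\<alpha> i \<bullet> b)\<close> times the operators in directions
  \<open>b\<close> and \<open>?r b\<close>. It is the operator in direction
  \<open>\<alpha> i + ?r (\<alpha> i) = 0\<close>.\<close>

lemma cherednik_sq_simple:
  assumes i: "i \<in> idx" and f: "f \<in> GA"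
  shows "cherednik_sq (weyl_act (reflection (\<alpha> i)) f) = weyl_act (reflection (\<alpha> i)) (cherednik_sq f)"
proof -
  let ?s = "weyl_act (reflection (\<alpha> i)) :: ('a \<Rightarrow>\<^sub>0 'i ratfun) \<Rightarrow> _" and ?r = "reflection (\<alpha> i)"
  let ?k = "param \<kappa> (\<alpha> i)"
  have i': "i \<in> gens" "refl_vec i = \<alpha> i" "refl_off i = 0" "S i = ?r"
    using i zero_notin_idx
    by (cases "i = 0"; simp add: gens_def refl_vec_def refl_off_def S_idx)+
  have D: "cherednik y (?s g) = ?s (cherednik (?r y) g) - scale (?k * const (y \<bullet> \<alpha> i)) g" if "g \<in> GA" for y g
    using cherednik_S[OF i'(1) that, of y] by (simp add: i')
  have "cherednik y (cherednik y (?s f)) = ?s (cherednik (?r y) (cherednik (?r y) f))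
      - scale ?k (scale (const (\<alpha> i \<bullet> y)) (cherednik (?r y) f + cherednik y f))" for y
    by (simp add: D[OF f] cherednik_diff cherednik_scale D[OF GA_cherednik[OF f]] scale_add_right scale_scale
        inner_commute[of y] algebra_simps)
  moreover have "(\<Sum>b\<in>Basis. scale (const (\<alpha> i \<bullet> b)) (cherednik (?r b) f + cherednik b f)) = 0"
  proof -
    have r: "cherednik (?r b) f = cherednik b f - scale (const (coroot (\<alpha> i) \<bullet> b)) (cherednik (\<alpha> i) f)" for b
      by (simp add: reflection_def cherednik_dir_diff cherednik_dir_scaleR)
    have "(\<Sum>b\<in>Basis. const (\<alpha> i \<bullet> b) * const (coroot (\<alpha> i) \<bullet> b)) = (const (\<alpha> i \<bullet> coroot (\<alpha> i)) :: 'i ratfun)"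
      by (subst euclidean_inner) (simp add: const_sum const_mult)
    also have "\<dots> = const 1 + const 1"
      unfolding inner_coroot_self[OF simple_nonzero[OF i]] const_add[symmetric] by simp
    finally have c: "(\<Sum>b\<in>Basis. const (\<alpha> i \<bullet> b) * const (coroot (\<alpha> i) \<bullet> b)) = (1 + 1 :: 'i ratfun)"
      by simp
    have "(\<Sum>b\<in>Basis. scale (const (\<alpha> i \<bullet> b)) (cherednik (?r b) f + cherednik b f)) =
        (\<Sum>b\<in>Basis. scale (const (\<alpha> i \<bullet> b)) (cherednik b f)) + (\<Sum>b\<in>Basis. scale (const (\<alpha> i \<bullet> b)) (cherednik b f))
        - scale (\<Sum>b\<in>Basis. const (\<alpha> i \<bullet> b) * const (coroot (\<alpha> i) \<bullet> b)) (cherednik (\<alpha> i) f)"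
      unfolding r scale_add_right scale_diff_right scale_scale scale_sum_left sum.distrib sum_subtractf
      by simp
    then show ?thesis
      unfolding c by (simp only: cherednik_Basis scale_add_left scale_1) simp
  qed
  ultimately have "cherednik_sq (?s f) = ?s (\<Sum>b\<in>Basis. cherednik (?r b) (cherednik (?r b) f))"
    by (simp add: cherednik_sq_def sum_subtractf weyl_act_sum flip: scale_sum_right)
  then show ?thesis
    by (simp add: cherednik_sq_reflection_sum[OF simple_nonzero[OF i]])
qed

lemma GA_W0: "w \<in> W0 \<Longrightarrow> f \<in> GA \<Longrightarrow> weyl_act w f \<in> GA"
  using GA_weyl_act[of f w] wts_W0[of w] by simp

lemma cherednik_sq_W0:
  assumes "w \<in> W0" and f: "f \<in> GA"
  shows "cherednik_sq (weyl_act w f) = weyl_act w (cherednik_sq f)"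
  using assms(1)
proof (induction rule: W0_induct)
  case id
  show ?case unfolding weyl_act_id ..
next
  case (step i w)
  show ?case
    unfolding weyl_act_comp[symmetric] cherednik_sq_simple[OF step(1) GA_W0[OF step(2) f]] step(3) ..
qed

section \<open>Invariants and the quotients in the Heckman-Opdam operator\<close>

abbreviation Inv :: "('a \<Rightarrow>\<^sub>0 'i ratfun) set" where "Inv \<equiv> invariants R \<alpha>"

lemma Inv_GA: "f \<in> Inv \<Longrightarrow> f \<in> GA" and Inv_W0: "f \<in> Inv \<Longrightarrow> w \<in> W0 \<Longrightarrow> weyl_act w f = f"
  by (simp_all add: invariants_def)

lemma InvI: "f \<in> GA \<Longrightarrow> (\<And>w. w \<in> W0 \<Longrightarrow> weyl_act w f = f) \<Longrightarrow> f \<in> Inv"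
  by (simp add: invariants_def)

lemma Inv_diff: "f \<in> Inv \<Longrightarrow> g \<in> Inv \<Longrightarrow> f - g \<in> Inv"
  and Inv_scale: "f \<in> Inv \<Longrightarrow> scale c f \<in> Inv"
  by (auto intro!: InvI GA_diff GA_scale simp: Inv_GA weyl_act_diff weyl_act_scale Inv_W0)

lemma Inv_lookup: "f \<in> Inv \<Longrightarrow> w \<in> W0 \<Longrightarrow> Poly_Mapping.lookup f (w m) = Poly_Mapping.lookup f m"
  using lookup_weyl_act[OF W0_inj, of w f m] by (simp add: Inv_W0)

lemma diff_quot_Inv:
  assumes "f \<in> Inv" "x \<in> R" shows "diff_quot x f = 0"
proof (rule one_minus_expo_cancel[of x])
  show "x \<noteq> 0" using assms zero_notin_R by auto
  show "(1 - expo (- x)) * diff_quot x f = (1 - expo (- x)) * 0"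
    using diff_quot_eq[OF Inv_GA[OF assms(1)] assms(2)] Inv_W0[OF assms(1) reflection_W0[OF assms(2)]] by simp
qed

text \<open>The derivative \<open>h\<close> of an invariant along \<open>x\<close> is antisymmetric
  under the reflection. So \<open>diff_quot\<close> times the divisor is \<open>2 h\<close>, and
  \<open>2 h - (1 - e^-x) h = (1 + e^-x) h\<close>.\<close>

lemma root_quotient_spec:
  assumes "f \<in> Inv" "x \<in> R"
  shows "(1 - expo (- x)) * (diff_quot x (dderiv x f) - dderiv x f) = (1 + expo (- x)) * dderiv x f"
proof -
  let ?h = "dderiv x f"
  have hGA: "?h \<in> GA" by (intro GA_dderiv Inv_GA assms)
  have "x \<bullet> reflection x m = - x \<bullet> m - 0" for m
    using inner_reflection_swap[of x x m] by simp
  then have "dderiv x (weyl_act (reflection x) f) =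
      weyl_act (reflection x) (dderiv (- x) f) - scale (const 0) (weyl_act (reflection x) f)"
    by (rule dderiv_weyl_act)
  moreover have "dderiv (- x) f = - ?h"
    by (rule poly_mapping_eqI) (simp add: lookup_dderiv const_uminus)
  ultimately have "weyl_act (reflection x) (- ?h) = ?h"
    using Inv_W0[OF assms(1) reflection_W0[OF assms(2)]] by simp
  then have h: "weyl_act (reflection x) ?h = - ?h"
    using weyl_act_diff[of "reflection x" 0 ?h] scalar_linear_0[OF scalar_linear_weyl_act, of "reflection x"]
    by (metis diff_0 minus_minus)
  show ?thesis
    unfolding right_diff_distrib diff_quot_eq[OF hGA assms(2)] h by (simp add: algebra_simps)
qed

lemma root_quotient_Inv:
  assumes "f \<in> Inv" "x \<in> R"
  shows "root_quotient R x ((1 + expo (- x)) * dderiv x f) = diff_quot x (dderiv x f) - dderiv x f"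
  unfolding root_quotient_def
proof (rule the_equality)
  let ?q = "diff_quot x (dderiv x f) - dderiv x f"
  have "?q \<in> GA"
    using assms by (intro GA_diff GA_diff_quot GA_dderiv Inv_GA)
  then show "?q \<in> GA \<and> (1 - expo (- x)) * ?q = (1 + expo (- x)) * dderiv x f"
    using root_quotient_spec[OF assms] by simp
  fix q assume "q \<in> GA \<and> (1 - expo (- x)) * q = (1 + expo (- x)) * dderiv x f"
  then show "q = ?q"
    using one_minus_expo_cancel[of x q ?q] root_quotient_spec[OF assms] assms(2) zero_notin_R by force
qed

abbreviation HO :: "('a \<Rightarrow>\<^sub>0 'i ratfun) \<Rightarrow> 'a \<Rightarrow>\<^sub>0 'i ratfun" where "HO \<equiv> HO_operator R \<alpha> \<kappa>"

text \<open>An everywhere linear operator that agrees with \<open>HO\<close> on invariants, where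
  the quotients are explicit.\<close>

definition HO_lin :: "('a \<Rightarrow>\<^sub>0 'i ratfun) \<Rightarrow> 'a \<Rightarrow>\<^sub>0 'i ratfun" where
  "HO_lin f = (\<Sum>b\<in>Basis. dderiv b (dderiv b f)) +
     (\<Sum>x\<in>pos. scale (param \<kappa> x) (diff_quot x (dderiv x f) - dderiv x f))"

lemma HO_Inv: "f \<in> Inv \<Longrightarrow> HO f = HO_lin f"
  unfolding HO_operator_def HO_lin_def using root_quotient_Inv posD(1) by simp

lemma scalar_linear_HO_lin: "scalar_linear HO_lin"
  unfolding HO_lin_def[abs_def]
  by (intro scalar_linear_intros(5,6,7) scalar_linear_sum_intro scalar_linear_dderiv
      scalar_linear_intros(4)[OF scalar_linear_diff_quot scalar_linear_dderiv]
      scalar_linear_intros(4)[OF scalar_linear_dderiv scalar_linear_dderiv])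

lemma HO_diff: "f \<in> Inv \<Longrightarrow> g \<in> Inv \<Longrightarrow> HO (f - g) = HO f - HO g"
  and HO_scale: "f \<in> Inv \<Longrightarrow> HO (scale c f) = scale c (HO f)"
  by (simp_all add: HO_Inv Inv_diff Inv_scale scalar_linear_diff[OF scalar_linear_HO_lin]
      scalar_linear_scale[OF scalar_linear_HO_lin])

definition rho_val :: "'a \<Rightarrow> 'i ratfun" where
  "rho_val y = (\<Sum>x\<in>pos. param \<kappa> x * const (y \<bullet> x) * const (1/2))"

text \<open>On an invariant the difference quotients vanish, so the first operator is the derivative
  minus \<open>rho_val\<close>. The second gives two equal terms \<open>rho_val\<close> times
  derivative, and summing over the basis turns weighted derivatives into derivatives along
  roots.\<close>

lemma cherednik_sq_Inv:
  assumes "f \<in> Inv"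
  shows "cherednik_sq f = HO f + scale (\<Sum>b\<in>Basis. rho_val b * rho_val b) f"
proof -
  have D: "cherednik y f = dderiv y f - scale (rho_val y) f" for y
    using diff_quot_Inv[OF assms posD(1)]
    by (simp add: cherednik_def sym_diff_quot_def rho_val_def scale_sum_left scale_scale scale_minus_right sum_negf)
  have D2: "cherednik y (dderiv y f) = dderiv y (dderiv y f)
      + (\<Sum>x\<in>pos. scale (param \<kappa> x * const (y \<bullet> x)) (diff_quot x (dderiv y f))) - scale (rho_val y) (dderiv y f)" for y
    by (simp add: cherednik_def sym_diff_quot_def rho_val_def scale_sum_left scale_scale scale_diff_right sum_subtractf)
  have two: "scale (rho_val y) g + scale (rho_val y) g = (\<Sum>x\<in>pos. scale (param \<kappa> x) (scale (const (y \<bullet> x)) g))"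
    for y g
  proof -
    have "rho_val y + rho_val y = (\<Sum>x\<in>pos. param \<kappa> x * const (y \<bullet> x))"
      unfolding rho_val_def sum.distrib[symmetric]
      by (intro sum.cong refl) (metis const_half_add mult.commute)
    then show ?thesis
      by (simp add: scale_sum_left scale_scale flip: scale_add_left)
  qed
  have DD: "cherednik y (cherednik y f) = dderiv y (dderiv y f)
      + (\<Sum>x\<in>pos. scale (param \<kappa> x) (diff_quot x (scale (const (y \<bullet> x)) (dderiv y f))))
      - (\<Sum>x\<in>pos. scale (param \<kappa> x) (scale (const (y \<bullet> x)) (dderiv y f)))
      + scale (rho_val y * rho_val y) f" for y
    unfolding two[symmetric]
    by (simp add: D cherednik_diff cherednik_scale D2 scale_diff_right scale_scale diff_quot_scale algebra_simps)
  have "cherednik_sq f = (\<Sum>b\<in>Basis. dderiv b (dderiv b f))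
      + (\<Sum>b\<in>Basis. \<Sum>x\<in>pos. scale (param \<kappa> x) (diff_quot x (scale (const (b \<bullet> x)) (dderiv b f))))
      - (\<Sum>b\<in>Basis. \<Sum>x\<in>pos. scale (param \<kappa> x) (scale (const (b \<bullet> x)) (dderiv b f)))
      + (\<Sum>b\<in>Basis. scale (rho_val b * rho_val b) f)"
    by (simp only: cherednik_sq_def DD sum.distrib sum_subtractf)
  also have "\<dots> = (\<Sum>b\<in>Basis. dderiv b (dderiv b f))
      + (\<Sum>x\<in>pos. scale (param \<kappa> x) (diff_quot x (\<Sum>b\<in>Basis. scale (const (b \<bullet> x)) (dderiv b f))))
      - (\<Sum>x\<in>pos. scale (param \<kappa> x) (\<Sum>b\<in>Basis. scale (const (b \<bullet> x)) (dderiv b f)))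
      + scale (\<Sum>b\<in>Basis. rho_val b * rho_val b) f"
    unfolding scale_sum_left scale_sum_right scalar_linear_sum[OF scalar_linear_diff_quot]
    by (subst (2 4) sum.swap) (rule refl)
  finally show ?thesis
    unfolding dderiv_Basis[symmetric] HO_Inv[OF assms] HO_lin_def
    by (simp add: scale_diff_right sum_subtractf)
qed

section \<open>Leading coefficients of the Heckman-Opdam operator\<close>

definition HO_eigval :: "'a \<Rightarrow> 'i ratfun" where
  "HO_eigval m = const (m \<bullet> m) + (\<Sum>x\<in>pos. param \<kappa> x * const (x \<bullet> m))"

lemma HO_eigval_pairing:
  "pairing m (\<lambda>b. const (m \<bullet> b) + const 2 * rho R \<alpha> \<kappa> b) = HO_eigval m"
proof -
  have two: "const 2 * (const (1/2) * c) = (c :: 'i ratfun)" for c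
    by (simp flip: mult.assoc const_mult)
  have "pairing m (\<lambda>b. const (m \<bullet> b) + const 2 * rho R \<alpha> \<kappa> b) =
      (\<Sum>b\<in>Basis. const (m \<bullet> b) * const (m \<bullet> b)) +
      (\<Sum>b\<in>Basis. \<Sum>x\<in>pos. param \<kappa> x * (const (m \<bullet> b) * const (x \<bullet> b)))"
    unfolding pairing_def rho_def two
    by (simp add: distrib_left sum.distrib sum_distrib_left mult_ac)
  also have "(\<Sum>b\<in>Basis. const (m \<bullet> b) * const (m \<bullet> b)) = (const (m \<bullet> m) :: 'i ratfun)"
    by (subst (3) euclidean_inner) (simp add: const_sum const_mult)
  also have "(\<Sum>b\<in>Basis. \<Sum>x\<in>pos. param \<kappa> x * (const (m \<bullet> b) * const (x \<bullet> b))) =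
      (\<Sum>x\<in>pos. param \<kappa> x * const (x \<bullet> m))"
    by (subst sum.swap, intro sum.cong refl, subst (3) euclidean_inner)
      (simp add: const_sum const_mult sum_distrib_left mult_ac)
  finally show ?thesis
    by (simp add: HO_eigval_def)
qed

lemma has_const_term_HO_eigval: "has_const_term (HO_eigval m) (m \<bullet> m)"
proof -
  have "has_const_term (const (m \<bullet> m) + (\<Sum>x\<in>pos. param \<kappa> x * const (x \<bullet> m))) (m \<bullet> m + (\<Sum>x\<in>pos. 0))"
    by (intro has_const_term_add has_const_term_const has_const_term_sum has_const_term_param_mult)
  then show ?thesis by (simp add: HO_eigval_def)
qed

text \<open>Beyond \<open>m\<close> the coefficients of \<open>q\<close> along \<open>x\<close> are
  constant, hence zero by finiteness, and the recurrence at \<open>m\<close> reads off the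
  value.\<close>

lemma lookup_shift_top:
  fixes q p :: "'a \<Rightarrow>\<^sub>0 'i ratfun"
  assumes "x \<noteq> 0" "(1 - expo (- x)) * q = p" "\<And>j::nat. j > 0 \<Longrightarrow> Poly_Mapping.lookup p (m + real j *\<^sub>R x) = 0"
  shows "Poly_Mapping.lookup q m = Poly_Mapping.lookup p m"
proof -
  have step: "Poly_Mapping.lookup q n - Poly_Mapping.lookup q (n + x) = Poly_Mapping.lookup p n" for n
    using lookup_expo_mult[of "- x" q n] by (simp add: assms(2)[symmetric] left_diff_distrib lookup_minus)
  have shift: "Poly_Mapping.lookup q (m + real (Suc j) *\<^sub>R x) = Poly_Mapping.lookup q (m + x)" for j
  proof (induction j)
    case (Suc j)
    have "real (Suc (Suc j)) = real (Suc j) + 1" by simp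
    then have eq: "m + real (Suc (Suc j)) *\<^sub>R x = m + real (Suc j) *\<^sub>R x + x"
      by (simp only: scaleR_add_left scaleR_one add.assoc)
    show ?case
      unfolding eq using Suc step[of "m + real (Suc j) *\<^sub>R x"] assms(3)[of "Suc j"]
      by (simp del: of_nat_Suc)
  qed simp
  have "Poly_Mapping.lookup q (m + x) = 0"
  proof (rule ccontr)
    assume "Poly_Mapping.lookup q (m + x) \<noteq> 0"
    then have "range (\<lambda>j::nat. m + real (Suc j) *\<^sub>R x) \<subseteq> Poly_Mapping.keys q"
      unfolding in_keys_iff image_subset_iff shift by simp
    moreover have "inj (\<lambda>j::nat. m + real (Suc j) *\<^sub>R x)"
      using assms(1) by (auto simp: inj_on_def)
    ultimately show False
      using finite_subset finite_keys finite_imageD infinite_UNIV_nat by metis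
  qed
  then show ?thesis
    using step[of m] by simp
qed

text \<open>Adding a positive multiple of a positive root to a dominant weight makes it longer. Such
  exponentials are absent from \<open>f\<close>, so \<open>lookup_shift_top\<close> applies.\<close>

lemma lookup_HO_top:
  assumes f: "f \<in> Inv" and m: "dominant m" "\<And>n. n \<in> Poly_Mapping.keys f \<Longrightarrow> norm n \<le> norm m"
  shows "Poly_Mapping.lookup (HO f) m = HO_eigval m * Poly_Mapping.lookup f m"
proof -
  have T: "Poly_Mapping.lookup (diff_quot x (dderiv x f) - dderiv x f) m = const (x \<bullet> m) * Poly_Mapping.lookup f m"
    if x: "x \<in> pos" for x
  proof -
    let ?h = "dderiv x f" and ?q = "diff_quot x (dderiv x f) - dderiv x f"
    have xR: "x \<in> R" "x \<noteq> 0" using x posD(1) pos_nonzero by blast+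
    have z: "Poly_Mapping.lookup ?h (m + real j *\<^sub>R x) = 0" if "j > 0" for j :: nat
    proof -
      have "(norm (m + real j *\<^sub>R x))\<^sup>2 = (norm m)\<^sup>2 + real j * (real j + coroot x \<bullet> m) * (norm x)\<^sup>2"
        by (rule norm_string[OF xR(2)])
      moreover have "real j * (real j + coroot x \<bullet> m) * (norm x)\<^sup>2 > 0"
        using that xR dominant_pos[OF m(1) x] coroot_inner_nonneg_iff[OF xR(2), of m]
        by (intro mult_pos_pos add_pos_nonneg) auto
      ultimately have "(norm m)\<^sup>2 < (norm (m + real j *\<^sub>R x))\<^sup>2"
        by linarith
      then have "norm m < norm (m + real j *\<^sub>R x)"
        by (rule power2_less_imp_less) simp
      then have "m + real j *\<^sub>R x \<notin> Poly_Mapping.keys f"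
        using m(2) by force
      then show ?thesis
        by (simp add: lookup_dderiv in_keys_iff)
    qed
    have hGA: "?h \<in> GA" by (intro GA_dderiv Inv_GA f)
    have "(1 - expo (- x)) * ?q = (1 + expo (- x)) * ?h"
      by (rule root_quotient_spec[OF f xR(1)])
    then have "Poly_Mapping.lookup ?q m = Poly_Mapping.lookup ((1 + expo (- x)) * ?h) m"
    proof (rule lookup_shift_top[OF xR(2)])
      fix j :: nat assume "j > 0"
      have "m + real j *\<^sub>R x + x = m + real (Suc j) *\<^sub>R x"
        by (simp add: algebra_simps)
      then show "Poly_Mapping.lookup ((1 + expo (- x)) * ?h) (m + real j *\<^sub>R x) = 0"
        using z[OF \<open>j > 0\<close>] z[of "Suc j"]
        by (simp only: distrib_right lookup_add lookup_expo_mult diff_minus_eq_add mult_1) simp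
    qed
    also have "\<dots> = Poly_Mapping.lookup ?h m"
      using z[of 1] by (simp add: distrib_right lookup_add lookup_expo_mult)
    finally show ?thesis
      by (simp add: lookup_dderiv)
  qed
  have "Poly_Mapping.lookup (HO f) m = (\<Sum>b\<in>Basis. const (b \<bullet> m) * const (b \<bullet> m)) * Poly_Mapping.lookup f m
      + (\<Sum>x\<in>pos. param \<kappa> x * const (x \<bullet> m)) * Poly_Mapping.lookup f m"
    unfolding HO_Inv[OF f] HO_lin_def
    by (simp add: lookup_add lookup_sum T lookup_dderiv sum_distrib_right mult.assoc del: lookup_minus)
  also have "(\<Sum>b\<in>Basis. const (b \<bullet> m) * const (b \<bullet> m)) = (const (m \<bullet> m) :: 'i ratfun)"
    by (subst (3) euclidean_inner) (simp add: const_sum const_mult inner_commute)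
  finally show ?thesis
    by (simp add: HO_eigval_def distrib_right)
qed

end

section \<open>Heckman--Opdam polynomials\<close>

lemma of_nat_ratfun_eq_0_iff: "(of_nat n :: 'i::linorder ratfun) = 0 \<longleftrightarrow> n = 0"
proof
  assume "(of_nat n :: 'i ratfun) = 0"
  then have "has_const_term (0 :: 'i ratfun) (real n)"
    using has_const_term_const[of "real n", where ?'a = 'i] by (simp add: const_of_nat)
  then show "n = 0"
    using has_const_term_unique[OF has_const_term_0] by fastforce
qed simp

context weyl_data
begin

lemma finite_wts_bounded: "finite {x\<in>wts. norm x \<le> K}"
proof (rule finite_imageD)
  let ?A = "{x\<in>wts. norm x \<le> K}"
  let ?g = "\<lambda>x. restrict (\<lambda>i. coroot (\<alpha> i) \<bullet> x) idx"
  define C where "C = (\<Sum>i\<in>idx. norm (coroot (\<alpha> i)))"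
  have C: "norm (coroot (\<alpha> i)) \<le> C" if "i \<in> idx" for i
    unfolding C_def using that by (intro member_le_sum) auto
  have "?g x \<in> PiE idx (\<lambda>_. {t\<in>\<int>. \<bar>t\<bar> \<le> C * K})" if "x \<in> ?A" for x
  proof -
    have "\<bar>coroot (\<alpha> i) \<bullet> x\<bar> \<le> C * K" if i: "i \<in> idx" for i
    proof -
      have "\<bar>coroot (\<alpha> i) \<bullet> x\<bar> \<le> norm (coroot (\<alpha> i)) * norm x"
        by (rule Cauchy_Schwarz_ineq2)
      also have "\<dots> \<le> C * K"
        using C[OF i] \<open>x \<in> ?A\<close> by (intro mult_mono) (auto intro: order_trans[OF norm_ge_zero])
      finally show ?thesis .
    qed
    then show ?thesis
      using that wts_coroot_Ints simple_root by auto
  qed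
  moreover have "finite (PiE idx (\<lambda>_. {t\<in>\<int>. \<bar>t\<bar> \<le> C * K}))"
    by (intro finite_PiE finite_idx finite_abs_int_segment)
  ultimately show "finite (?g ` ?A)"
    by (elim finite_subset[rotated]) blast
  show "inj_on ?g ?A"
  proof (rule inj_onI)
    fix x y assume "?g x = ?g y"
    then have "coroot (\<alpha> i) \<bullet> x = coroot (\<alpha> i) \<bullet> y" if "i \<in> idx" for i
      using that by (metis restrict_apply')
    then have "coroot (\<alpha> i) \<bullet> (x - y) = 0" if "i \<in> idx" for i
      using that by (simp add: inner_diff_right)
    then have "\<alpha> i \<bullet> (x - y) = 0" if "i \<in> idx" for i
      using that coroot_inner_eq_0_iff[OF simple_nonzero] by blast
    then have "(x - y) \<bullet> (x - y) = 0"
      by (subst inner_coef) simp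
    then show "x = y" by simp
  qed
qed

lemma dominance_less_iff: "dominance_less R \<alpha> m l \<longleftrightarrow> m \<noteq> l \<and> nonneg_comb \<alpha> (l - m)"
  by (auto simp: dominance_less_def sum_of_pos_roots_iff)

lemma dominance_less_norm:
  assumes "dominance_less R \<alpha> m l" "dominant m" "dominant l"
  shows "norm m < norm l"
proof -
  have *: "nonneg_comb \<alpha> (l - m)" "l \<noteq> m"
    using assms(1) by (auto simp: dominance_less_iff)
  have "(norm l)\<^sup>2 = (norm m)\<^sup>2 + 2 * ((l - m) \<bullet> m) + (l - m) \<bullet> (l - m)"
    by (simp add: power2_norm_eq_inner algebra_simps inner_commute)
  moreover have "(l - m) \<bullet> m \<ge> 0"
    using dominant_nonneg_comb assms(2) *(1) by blast
  moreover have "(l - m) \<bullet> (l - m) > 0"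
    using *(2) by simp
  ultimately have "(norm m)\<^sup>2 < (norm l)\<^sup>2" by linarith
  then show ?thesis
    by (rule power2_less_imp_less) simp
qed

lemma lookup_orbit_sum:
  "Poly_Mapping.lookup (orbit_sum R \<alpha> m :: 'a \<Rightarrow>\<^sub>0 'i ratfun) n = (if n \<in> orb m then 1 else 0)"
  by (simp add: orbit_sum_def lookup_sum lookup_expo finite_orb)

definition dom_below :: "'a \<Rightarrow> 'a set" where
  "dom_below l = {m. m \<in> dominant_weights R \<alpha> \<and> dominance_less R \<alpha> m l}"

lemma dom_belowD:
  assumes "m \<in> dom_below l" shows "m \<in> wts" "dominant m" "dominance_less R \<alpha> m l"
  using assms by (auto simp: dom_below_def dominant_weights_iff)

lemma finite_dom_below:
  assumes "dominant l" shows "finite (dom_below l)"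
  by (rule finite_subset[OF _ finite_wts_bounded[of "norm l"]])
    (use dom_belowD dominance_less_norm assms in \<open>fastforce intro: less_imp_le\<close>)

lemma lookup_triangular:
  assumes l: "dominant l" and n: "dominant n"
  shows "Poly_Mapping.lookup (orbit_sum R \<alpha> l + (\<Sum>m\<in>dom_below l. scale (d m) (orbit_sum R \<alpha> m))) n =
    (if n = l then 1 else 0) + (if n \<in> dom_below l then d n else (0 :: 'i ratfun))"
proof -
  have *: "n \<in> orb m \<longleftrightarrow> n = m" if "dominant m" for m
    using dominant_orb_unique[OF _ that n] orb_self by blast
  have "Poly_Mapping.lookup (\<Sum>m\<in>dom_below l. scale (d m) (orbit_sum R \<alpha> m)) n =
      (\<Sum>m\<in>dom_below l. if m = n then d m else 0)"
    unfolding lookup_sum by (intro sum.cong refl) (auto simp: lookup_orbit_sum * dom_belowD)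
  then show ?thesis
    using finite_dom_below[OF l] by (simp add: lookup_add lookup_orbit_sum * l)
qed

lemma Inv_eqI:
  assumes "f \<in> Inv" "g \<in> Inv"
    and "\<And>m. m \<in> wts \<Longrightarrow> dominant m \<Longrightarrow> Poly_Mapping.lookup f m = Poly_Mapping.lookup g m"
  shows "f = g"
proof (rule poly_mapping_eqI)
  fix n
  show "Poly_Mapping.lookup f n = Poly_Mapping.lookup g n"
  proof (cases "n \<in> wts")
    case True
    obtain w where w: "w \<in> W0" "dominant (w n)"
      using exists_dominant_orb[of n] by (auto simp: orb_iff)
    then have "Poly_Mapping.lookup f (w n) = Poly_Mapping.lookup g (w n)"
      using assms(3) wts_W0 True by blast
    then show ?thesis
      using Inv_lookup w assms(1,2) by simp
  next
    case False
    then show ?thesis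
      using Inv_GA[OF assms(1)] Inv_GA[OF assms(2)] by (simp add: GA_iff')
  qed
qed

lemma orbit_sum_Inv:
  assumes "m \<in> wts" shows "orbit_sum R \<alpha> m \<in> Inv"
proof (rule InvI)
  show "orbit_sum R \<alpha> m \<in> GA"
    unfolding orbit_sum_def using assms wts_W0 by (intro GA_sum GA_expo) (auto simp: orb_iff)
  fix w assume w: "w \<in> W0"
  obtain v where v: "v \<in> W0" "v \<circ> w = id" "w \<circ> v = id"
    using W0_inverse[OF w] by blast
  have "bij_betw w (orb m) (orb m)"
    by (rule bij_betw_byWitness[where f' = v])
      (use v w orb_W0 in \<open>auto simp: fun_eq_iff\<close>)
  then show "weyl_act w (orbit_sum R \<alpha> m) = orbit_sum R \<alpha> m"
    unfolding orbit_sum_def by (simp add: weyl_act_sum weyl_act_expo sum.reindex_bij_betw)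
qed

lemma Inv_sum: "(\<And>x. x \<in> A \<Longrightarrow> f x \<in> Inv) \<Longrightarrow> sum f A \<in> Inv"
  by (intro InvI GA_sum) (auto simp: weyl_act_sum Inv_W0 Inv_GA)

lemma Inv_add: "f \<in> Inv \<Longrightarrow> g \<in> Inv \<Longrightarrow> f + g \<in> Inv"
  by (intro InvI GA_add) (auto simp: weyl_act_add Inv_W0 Inv_GA)

lemma is_HO_polynomial_iff:
  "is_HO_polynomial R \<alpha> \<kappa> l p \<longleftrightarrow> p \<in> Inv \<and>
     (\<exists>d. p = orbit_sum R \<alpha> l + (\<Sum>m\<in>dom_below l. scale (d m) (orbit_sum R \<alpha> m))) \<and>
     HO p = scale (HO_eigval l) p"
  unfolding is_HO_polynomial_def HO_eigval_pairing dom_below_def by simp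

text \<open>A nonzero difference is again an eigenvector. At a dominant weight of maximal norm in
  its support the eigenvalue, at parameters zero, forces the norm of \<open>l\<close>, whereas all
  such weights lie strictly below \<open>l\<close> and are shorter.\<close>

lemma HO_polynomial_unique:
  assumes l: "l \<in> wts" "dominant l"
    and p: "is_HO_polynomial R \<alpha> \<kappa> l p" and q: "is_HO_polynomial R \<alpha> \<kappa> l q"
  shows "p = q"
proof (rule ccontr)
  assume "p \<noteq> q"
  define f where "f = p - q"
  have Inv: "p \<in> Inv" "q \<in> Inv" "f \<in> Inv"
    using p q Inv_diff by (auto simp: f_def is_HO_polynomial_iff)
  have "HO f = scale (HO_eigval l) f"
    using p q unfolding f_def HO_diff[OF Inv(1,2)] by (simp add: is_HO_polynomial_iff scale_diff_right)
  have "finite (Poly_Mapping.keys f)" "Poly_Mapping.keys f \<noteq> {}"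
    using \<open>p \<noteq> q\<close> by (auto simp: f_def)
  then obtain n where n: "n \<in> Poly_Mapping.keys f" "\<And>k. k \<in> Poly_Mapping.keys f \<Longrightarrow> norm k \<le> norm n"
    using finite_has_max[of "Poly_Mapping.keys f" norm] by metis
  obtain w where w: "w \<in> W0" "dominant (w n)"
    using exists_dominant_orb[of n] by (auto simp: orb_iff)
  define m where "m = w n"
  have m: "dominant m" "Poly_Mapping.lookup f m \<noteq> 0" "\<And>k. k \<in> Poly_Mapping.keys f \<Longrightarrow> norm k \<le> norm m"
    using n w Inv_lookup[OF Inv(3) w(1)] by (auto simp: m_def in_keys_iff W0_norm)
  have "HO_eigval l * Poly_Mapping.lookup f m = HO_eigval m * Poly_Mapping.lookup f m"
    using lookup_HO_top[OF Inv(3) m(1,3)] \<open>HO f = scale (HO_eigval l) f\<close> by simp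
  then have "HO_eigval l = HO_eigval m"
    using m(2) by simp
  then have "l \<bullet> l = m \<bullet> m"
    using has_const_term_HO_eigval has_const_term_unique by metis
  then have "norm l = norm m"
    by (simp add: norm_eq_sqrt_inner)
  moreover have "m \<in> dom_below l"
  proof (rule ccontr)
    assume "m \<notin> dom_below l"
    then have "Poly_Mapping.lookup p m = Poly_Mapping.lookup q m"
      using p q lookup_triangular[OF l(2) m(1)] unfolding is_HO_polynomial_iff by auto
    then show False
      using m(2) by (simp add: f_def lookup_minus)
  qed
  ultimately show False
    using dominance_less_norm[OF dom_belowD(3) _ l(2)] m(1) by fastforce
qed

text \<open>The eigenvalue \<open>e\<close> need not be known: comparing the coefficients at \<open>l\<close> determines it.\<close>

lemma HO_polynomial_eqI:
  assumes l: "l \<in> wts" "dominant l" and F: "F \<in> Inv" "HO F = scale e F"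
    and c: "Poly_Mapping.lookup F l = c" "c \<noteq> 0"
    and top: "\<And>n. n \<in> Poly_Mapping.keys F \<Longrightarrow> norm n \<le> norm l"
    and below: "\<And>n. n \<in> Poly_Mapping.keys F \<Longrightarrow> dominant n \<Longrightarrow> n \<noteq> l \<Longrightarrow> dominance_less R \<alpha> n l"
  shows "scale c (HO_polynomial R \<alpha> \<kappa> l) = F"
proof -
  define P where "P = scale (inverse c) F"
  have "e * c = HO_eigval l * c"
    using lookup_HO_top[OF F(1) l(2) top] F(2) c(1) by simp
  then have e: "e = HO_eigval l" using c(2) by simp
  have PI: "P \<in> Inv" using F(1) by (simp add: P_def Inv_scale)
  have "HO P = scale (HO_eigval l) P"
    using F by (simp add: P_def HO_scale e scale_scale mult.commute)
  moreover have "P = orbit_sum R \<alpha> l +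
      (\<Sum>m\<in>dom_below l. scale (Poly_Mapping.lookup P m) (orbit_sum R \<alpha> m))"
  proof (rule Inv_eqI[OF PI])
    show "orbit_sum R \<alpha> l + (\<Sum>m\<in>dom_below l. scale (Poly_Mapping.lookup P m) (orbit_sum R \<alpha> m)) \<in> Inv"
      using l dom_belowD(1) by (intro Inv_add Inv_sum Inv_scale orbit_sum_Inv)
    fix n assume n: "n \<in> wts" "dominant n"
    have "l \<notin> dom_below l"
      by (simp add: dom_below_def dominance_less_iff)
    moreover have "Poly_Mapping.lookup P l = 1"
      using c by (simp add: P_def)
    moreover have "Poly_Mapping.lookup P n = 0" if "n \<noteq> l" "n \<notin> dom_below l"
      using that n below[of n] by (auto simp: P_def in_keys_iff dom_below_def dominant_weights_iff)
    ultimately show "Poly_Mapping.lookup P n = Poly_Mapping.lookup (orbit_sum R \<alpha> l +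
        (\<Sum>m\<in>dom_below l. scale (Poly_Mapping.lookup P m) (orbit_sum R \<alpha> m))) n"
      unfolding lookup_triangular[OF l(2) n(2)] by auto
  qed
  ultimately have "is_HO_polynomial R \<alpha> \<kappa> l P"
    using PI unfolding is_HO_polynomial_iff by blast
  then have "HO_polynomial R \<alpha> \<kappa> l = P"
    unfolding HO_polynomial_def using HO_polynomial_unique[OF l] by (intro the_equality)
  then show ?thesis
    using c(2) by (simp add: P_def scale_scale)
qed

section \<open>Eigenvectors along a reduced word and their symmetrization\<close>

lemma lookup_S_zero:
  assumes i: "i \<in> gens" and pos: "aff_val i m > 0" and f: "eigenf m f"
  shows "Poly_Mapping.lookup f (S i m) = 0"
proof -
  define T where "T = {n. n = m \<or> norm n < norm m \<or> norm n = norm m \<and> ht m < ht n}"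
  have "Poly_Mapping.keys f \<subseteq> T"
  proof (rule eigenf_keys[OF f])
    show "m \<in> T" by (simp add: T_def)
    show "k \<in> T" if "below k n" "n \<in> T" for k n
      using below_norm[OF that(1)] that(2) by (auto simp: T_def)
  qed
  moreover have "S i m \<notin> T"
  proof (cases "i = 0")
    case True
    have "S i m = m + aff_val i m *\<^sub>R \<beta>"
      by (simp add: S_aff_val True refl_vec_def)
    moreover have "coroot \<beta> \<bullet> m = 1 - aff_val i m"
      by (simp add: True aff_val_pos_vec pos_vec_def)
    ultimately have "(norm (S i m))\<^sup>2 = (norm m)\<^sup>2 + aff_val i m * (norm \<beta>)\<^sup>2"
      using norm_string[OF beta_nonzero, of m "aff_val i m"] by simp
    moreover have "aff_val i m * (norm \<beta>)\<^sup>2 > 0"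
      using pos beta_nonzero by simp
    ultimately have "(norm m)\<^sup>2 < (norm (S i m))\<^sup>2" by linarith
    then have "norm m < norm (S i m)"
      by (rule power2_less_imp_less) simp
    then show ?thesis by (auto simp: T_def)
  next
    case False
    then have i': "i \<in> idx" using i by (simp add: gens_def)
    have a: "aff_val i m = coroot (\<alpha> i) \<bullet> m"
      using False by (simp add: aff_val_pos_vec pos_vec_def)
    have S: "S i m = m - aff_val i m *\<^sub>R \<alpha> i"
      using False by (simp add: S_aff_val refl_vec_def)
    have "ht (S i m) < ht m"
      unfolding S using pos ht_pos[OF simple_pos[OF i']] by (simp add: ht_diff ht_scaleR)
    moreover have "norm (S i m) = norm m"
      by (simp add: S_idx[OF i'])
    moreover have "S i m \<noteq> m"
      using pos by (simp add: S_eq_self_iff[OF i])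
    ultimately show ?thesis by (auto simp: T_def)
  qed
  ultimately show ?thesis
    by (auto simp: in_keys_iff)
qed

lemma S_inj: "inj (S i)"
  by (metis S_S injI)

text \<open>At the new weight the summand with the parameter vanishes by
  \<open>lookup_S_zero\<close>, so the leading coefficient picks up exactly one factor per
  letter.\<close>

lemma exists_eigenf:
  assumes js: "set js \<subseteq> gens" and l: "l \<in> wts" and rep: "wm js l \<in> orbit_reps R \<alpha>"
    and pos: "\<And>j. j < length js \<Longrightarrow> aff_val (js ! j) (iw js l j) > 0"
  shows "j \<le> length js \<Longrightarrow> \<exists>f. eigenf (iw js l j) f \<and>
    (\<forall>m. Poly_Mapping.lookup f m \<in> nonneg_int_polys) \<and>
    Poly_Mapping.lookup f (iw js l j) = (\<Prod>k<j. shifted_aff_val (js ! k) (iw js l k))"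
proof (induction j)
  case 0
  have "eigenf (iw js l 0) (expo (iw js l 0))"
    using eigenf_orbit_reps rep by (simp add: iw_0)
  moreover have "Poly_Mapping.lookup (expo (iw js l 0)) m \<in> (nonneg_int_polys :: 'i ratfun set)" for m
  proof -
    have "0 \<in> (nonneg_int_polys :: 'i ratfun set)" "of_nat 1 \<in> (nonneg_int_polys :: 'i ratfun set)"
      by (rule nonneg_int_polys_0, rule nonneg_int_polys_of_nat)
    then show ?thesis
      by (simp add: lookup_expo)
  qed
  ultimately show ?case
    by (intro exI[of _ "expo (iw js l 0)"]) (simp add: lookup_expo)
next
  case (Suc j)
  then obtain f where f: "eigenf (iw js l j) f" "\<And>m. Poly_Mapping.lookup f m \<in> nonneg_int_polys"
    "Poly_Mapping.lookup f (iw js l j) = (\<Prod>k<j. shifted_aff_val (js ! k) (iw js l k))"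
    by auto
  define i m where "i = js ! j" and "m = iw js l j"
  have i: "i \<in> gens" and m: "m \<in> wts" and a: "aff_val i m > 0"
    using Suc.prems js iw_wts[OF js l] pos by (auto simp: i_def m_def subset_iff)
  have Sm: "iw js l (Suc j) = S i m" "S i m \<noteq> m"
    using Suc.prems a S_eq_self_iff[OF i] by (simp_all add: iw_Suc i_def m_def)
  let ?A = "weyl_act (S i) f"
  define g where "g = scale (shifted_aff_val i m) ?A + scale (param \<kappa> (refl_vec i)) f"
  have "eigenf (S i m) g"
    unfolding g_def using eigenf_step[OF i m Sm(2)] f(1) by (simp add: m_def)
  moreover have A: "Poly_Mapping.lookup ?A n = Poly_Mapping.lookup f (S i n)" for n
    using lookup_weyl_act[OF S_inj, of i f "S i n"] by simp
  moreover have "Poly_Mapping.lookup g n \<in> nonneg_int_polys" for n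
    unfolding g_def lookup_add lookup_scale A
    by (intro nonneg_int_polys_add nonneg_int_polys_mult shifted_aff_val_nonneg[OF i m a] nonneg_int_polys_param f(2))
  moreover have "Poly_Mapping.lookup g (S i m) = (\<Prod>k<Suc j. shifted_aff_val (js ! k) (iw js l k))"
    using f(3) lookup_S_zero[OF i a] f(1) A[of "S i m"]
    by (simp add: g_def lookup_add i_def[symmetric] m_def[symmetric] mult.commute)
  ultimately show ?case
    unfolding Sm(1) by blast
qed

text \<open>\<open>eigenf_keys\<close> is applied to the saturated set below \<open>l\<close>, cut
  down to weights shorter than \<open>l\<close> together with \<open>l\<close> itself.\<close>

lemma eigenf_dominant_keys:
  assumes l: "l \<in> wts" "dominant l" and f: "eigenf l f" and n: "n \<in> Poly_Mapping.keys f" "n \<noteq> l"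
  shows "norm n < norm l" and "w \<in> W0 \<Longrightarrow> nonneg_comb \<alpha> (l - w n)"
proof -
  define A where "A = {n\<in>wts. \<forall>w\<in>W0. nonneg_comb \<alpha> (l - w n)}"
  define T where "T = A \<inter> {n. n = l \<or> norm n < norm l}"
  have "Poly_Mapping.keys f \<subseteq> T"
  proof (rule eigenf_keys[OF f])
    show "l \<in> T"
      using l dominant_diff_orb[OF l] by (auto simp: T_def A_def orb_iff)
    fix m n assume b: "below m n" and nT: "n \<in> T"
    obtain x j where x: "x \<in> pos" "j > (0::nat)"
      and *: "m = n - real j *\<^sub>R x \<and> real j < coroot x \<bullet> n \<or>
        m = n + real j *\<^sub>R x \<and> real j \<le> - (coroot x \<bullet> n)"
      using b unfolding below_def by blast
    have xR: "x \<in> R" "x \<noteq> 0" using x posD(1) pos_nonzero by blast+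
    have nw: "n \<in> wts" and nA: "\<And>w. w \<in> W0 \<Longrightarrow> nonneg_comb \<alpha> (l - w n)"
      using nT by (auto simp: T_def A_def)
    obtain t where t: "coroot x \<bullet> n = of_int t"
      using wts_coroot_Ints[OF nw xR(1)] by (auto elim!: Ints_cases)
    have "m \<in> wts"
      using * wts_add[OF nw] wts_diff[OF nw] wts_scale[OF root_wts[OF xR(1)]] by fastforce
    moreover have "nonneg_comb \<alpha> (l - w m)" if w: "w \<in> W0" for w
    proof -
      note lin = linear_add[OF W0_linear[OF w]] linear_diff[OF W0_linear[OF w]] linear_cmul[OF W0_linear[OF w]]
      have sx: "w \<circ> reflection x \<in> W0"
        using W0_comp w reflection_W0[OF xR(1)] by blast
      have wx: "w x \<in> pos \<or> - w x \<in> pos"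
        using pos_or_neg W0_root w xR(1) by blast
      \<comment> \<open>A weight on a string can be reached from either end. Depending on the sign
        of \<open>w x\<close>, the end \<open>n\<close> or \<open>reflection x n\<close> is used, so
        that its image lies above \<open>w m\<close>.\<close>
      have up: "nonneg_comb \<alpha> (l - w n + real k *\<^sub>R y)" if "y \<in> pos" for k y
        using that nA[OF w] posD(2) by (intro nonneg_comb_add nonneg_comb_scale) auto
      have up': "nonneg_comb \<alpha> (l - w (reflection x n) + real k *\<^sub>R y)" if "y \<in> pos" for k y
        using that nA[OF sx] posD(2) by (intro nonneg_comb_add nonneg_comb_scale) auto
      from * show ?thesis
      proof
        assume a: "m = n - real j *\<^sub>R x \<and> real j < coroot x \<bullet> n"
        show ?thesis
          using wx
        proof
          assume "w x \<in> pos"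
          then show ?thesis
            unfolding a[THEN conjunct1] lin using up[of "w x" j] by (simp add: algebra_simps)
        next
          assume p: "- w x \<in> pos"
          have "real (nat (t - int j)) = real_of_int t - real j"
            using a t by simp
          then show ?thesis
            unfolding a[THEN conjunct1] lin using up'[OF p, of "nat (t - int j)"] t
            by (simp add: lin reflection_def algebra_simps)
        qed
      next
        assume a: "m = n + real j *\<^sub>R x \<and> real j \<le> - (coroot x \<bullet> n)"
        show ?thesis
          using wx
        proof
          assume p: "w x \<in> pos"
          have "real (nat (- t - int j)) = - real_of_int t - real j"
            using a t by simp
          then show ?thesis
            unfolding a[THEN conjunct1] lin using up'[OF p, of "nat (- t - int j)"] t
            by (simp add: lin reflection_def algebra_simps)
        next
          assume "- w x \<in> pos"
          then show ?thesis
            unfolding a[THEN conjunct1] lin using up[of "- w x" j] by (simp add: algebra_simps)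
        qed
      qed
    qed
    moreover have "norm m < norm l"
    \<comment> \<open>From the dominant weight itself only the first alternative of
      \<open>below\<close> is open, and it stays strictly inside the string; other members of the
      orbit of \<open>l\<close> are thereby excluded.\<close>
    proof (cases "n = l")
      case True
      have "coroot x \<bullet> l \<ge> 0"
        using dominant_pos[OF l(2) x(1)] coroot_inner_nonneg_iff[OF xR(2)] by blast
      then have a: "m = l + (- real j) *\<^sub>R x" "real j < coroot x \<bullet> l"
        using * x(2) True by auto
      have "(norm m)\<^sup>2 = (norm l)\<^sup>2 + (- real j) * (- real j + coroot x \<bullet> l) * (norm x)\<^sup>2"
        unfolding a(1) by (rule norm_string[OF xR(2)])
      moreover have "(- real j) * (- real j + coroot x \<bullet> l) * (norm x)\<^sup>2 < 0"
        using a(2) x(2) xR(2) by (intro mult_neg_pos) auto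
      ultimately have "(norm m)\<^sup>2 < (norm l)\<^sup>2" by linarith
      then show ?thesis
        by (rule power2_less_imp_less) simp
    next
      case False
      then show ?thesis
        using below_norm(1)[OF b] nT by (auto simp: T_def)
    qed
    ultimately show "m \<in> T"
      by (simp add: T_def A_def)
  qed
  then show "norm n < norm l" "w \<in> W0 \<Longrightarrow> nonneg_comb \<alpha> (l - w n)"
    using n by (auto simp: T_def A_def)
qed

lemma card_W0: "card W0 = card (orb l) * card {w\<in>W0. w l = l}"
proof -
  have "card {w\<in>W0. w l = y} = card {w\<in>W0. w l = l}" if y: "y \<in> orb l" for y
  proof -
    obtain v where v: "v \<in> W0" "y = v l"
      using y by (auto simp: orb_iff)
    obtain u where u: "u \<in> W0" "u \<circ> v = id" "v \<circ> u = id"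
      using W0_inverse[OF v(1)] by blast
    have uv: "u (v x) = x" "v (u x) = x" for x
      using u by (auto simp: fun_eq_iff)
    have "bij_betw (\<lambda>w. v \<circ> w) {w\<in>W0. w l = l} {w\<in>W0. w l = y}"
      by (rule bij_betw_byWitness[where f' = "\<lambda>w. u \<circ> w"])
        (auto simp: fun_eq_iff uv v(2) intro: W0_comp[OF v(1)] W0_comp[OF u(1)])
    then show ?thesis
      using bij_betw_same_card by fastforce
  qed
  then have "(\<Sum>y\<in>orb l. card {w\<in>W0. w l = y}) = card (orb l) * card {w\<in>W0. w l = l}"
    by simp
  moreover have "card W0 = (\<Sum>y\<in>orb l. card {w\<in>W0. w l = y})"
    using sum.image_gen[OF finite_W0, of "\<lambda>_. 1::nat" "\<lambda>w. w l"] by (simp add: finite_orbit_def)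
  ultimately show ?thesis by simp
qed

lemma c_const_HO_polynomial:
  assumes l: "l \<in> wts" "dominant l" and js: "set js \<subseteq> gens" "wm js l \<in> orbit_reps R \<alpha>"
    and pos: "\<And>j. j < length js \<Longrightarrow> aff_val (js ! j) (iw js l j) > 0"
  shows "c_const R \<alpha> \<kappa> js l \<in> nonneg_int_polys"
    and "Poly_Mapping.lookup (scale (c_const R \<alpha> \<kappa> js l) (HO_polynomial R \<alpha> \<kappa> l)) m \<in> nonneg_int_polys"
proof -
  define stab where "stab = {w\<in>W0. w l = l}"
  define A where "A = (\<Prod>k<length js. shifted_aff_val (js ! k) (iw js l k))"
  obtain f where f: "eigenf l f" "\<And>m. Poly_Mapping.lookup f m \<in> nonneg_int_polys"
      "Poly_Mapping.lookup f l = A"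
    using
      exists_eigenf[OF js(1) l(1) js(2) pos order_refl] by (auto simp: iw_length A_def)
  have fGA: "f \<in> GA" using f(1) by (simp add: eigenf_def)
  have stab: "id \<in> stab" "finite stab"
    using W0_id finite_W0 by (auto simp: stab_def)
  have orb0: "card (orb l) \<noteq> 0"
    using finite_orb orb_self by auto
  \<comment> \<open>By orbit-stabilizer the quotient of orders is the order of the stabilizer, which
    symmetrization produces as a multiplicity.\<close>
  have c: "c_const R \<alpha> \<kappa> js l = of_nat (card stab) * A"
    unfolding c_const_def aff_pairing_shifted A_def card_W0[of l] stab_def
    using orb0 by (simp add: of_nat_ratfun_eq_0_iff del: card_eq_0_iff)
  have avF: "shifted_aff_val (js ! k) (iw js l k) \<in> nonneg_int_polys" "shifted_aff_val (js ! k) (iw js l k) \<noteq> 0"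
    if "k < length js" for k
  proof -
    have "js ! k \<in> gens" using that js(1) by (auto simp: subset_iff)
    then show "shifted_aff_val (js ! k) (iw js l k) \<in> nonneg_int_polys"
      using shifted_aff_val_nonneg iw_wts[OF js(1) l(1)] pos that by blast
    show "shifted_aff_val (js ! k) (iw js l k) \<noteq> 0"
      using has_const_term_shifted_aff_val[of "js ! k" "iw js l k"] has_const_term_unique[OF has_const_term_0]
        pos[OF that] by fastforce
  qed
  show "c_const R \<alpha> \<kappa> js l \<in> nonneg_int_polys"
    unfolding c A_def using avF(1)
    by (intro nonneg_int_polys_mult nonneg_int_polys_of_nat nonneg_int_polys_prod) auto
  have c0: "c_const R \<alpha> \<kappa> js l \<noteq> 0"
    unfolding c A_def using avF(2) stab by (auto simp: of_nat_ratfun_eq_0_iff)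
  define F where "F = (\<Sum>w\<in>W0. weyl_act w f)"
  have FI: "F \<in> Inv"
  proof (rule InvI)
    show "F \<in> GA" unfolding F_def using GA_W0 fGA by (intro GA_sum)
    fix v assume v: "v \<in> W0"
    obtain u where u: "u \<in> W0" "u \<circ> v = id" "v \<circ> u = id"
      using W0_inverse[OF v] by blast
    have uv: "u (v x) = x" "v (u x) = x" for x
      using u by (auto simp: fun_eq_iff)
    have "bij_betw (\<lambda>w. v \<circ> w) W0 W0"
      by (rule bij_betw_byWitness[where f' = "\<lambda>w. u \<circ> w"])
        (auto simp: fun_eq_iff uv intro: W0_comp[OF v] W0_comp[OF u(1)])
    then show "weyl_act v F = F"
      unfolding F_def weyl_act_sum weyl_act_comp
      by (rule sum.reindex_bij_betw[where g = "\<lambda>w. weyl_act w f"])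
  qed
  define e where "e = (\<Sum>b\<in>Basis. shifted_val l b * shifted_val l b)"
  have Omf: "cherednik_sq f = scale e f"
    using f(1) by (simp add: cherednik_sq_def e_def eigenf_def cherednik_scale scale_scale scale_sum_left)
  have "cherednik_sq F = scale e F"
    unfolding F_def scalar_linear_sum[OF scalar_linear_cherednik_sq] scale_sum_right
    by (intro sum.cong refl) (simp add: cherednik_sq_W0[OF _ fGA] Omf weyl_act_scale)
  then have HOF: "HO F = scale (e - (\<Sum>b\<in>Basis. rho_val b * rho_val b)) F"
    using cherednik_sq_Inv[OF FI] by (simp add: scale_diff_left algebra_simps)
  have lookF: "\<exists>n. m = w n \<and> Poly_Mapping.lookup (weyl_act w f) m = Poly_Mapping.lookup f n"
    if w: "w \<in> W0" for w m
  proof -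
    obtain v where "v \<in> W0" "w \<circ> v = id"
      using W0_inverse[OF w] by blast
    then have "m = w (v m)" by (metis comp_apply id_apply)
    then show ?thesis
      using lookup_weyl_act[OF W0_inj[OF w], of f "v m"] by metis
  qed
  have keysF: "\<exists>w\<in>W0. \<exists>n\<in>Poly_Mapping.keys f. m = w n" if "m \<in> Poly_Mapping.keys F" for m
  proof -
    have "(\<Sum>w\<in>W0. Poly_Mapping.lookup (weyl_act w f) m) \<noteq> 0"
      using that by (simp add: F_def in_keys_iff lookup_sum)
    then obtain w where w: "w \<in> W0" "Poly_Mapping.lookup (weyl_act w f) m \<noteq> 0"
      by (rule sum.not_neutral_contains_not_neutral)
    moreover obtain n where "m = w n" "Poly_Mapping.lookup (weyl_act w f) m = Poly_Mapping.lookup f n"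
      using lookF[OF w(1)] by blast
    ultimately show ?thesis
      using w(1) by (intro bexI[of _ w] bexI[of _ n]) (auto simp: in_keys_iff)
  qed
  \<comment> \<open>The other exponentials of \<open>f\<close> are shorter than \<open>l\<close> and
    cannot be moved onto it, so only stabilizing elements contribute.\<close>
  have "Poly_Mapping.lookup (weyl_act w f) l = (if w l = l then A else 0)" if w: "w \<in> W0" for w
  proof -
    obtain n where n: "l = w n" "Poly_Mapping.lookup (weyl_act w f) l = Poly_Mapping.lookup f n"
      using lookF[OF w] by blast
    show ?thesis
    proof (cases "n = l")
      case True
      then show ?thesis using n f(3) by simp
    next
      case False
      have "norm n = norm l"
        using n(1) W0_norm[OF w] by metis
      then have "Poly_Mapping.lookup f n = 0"
        using eigenf_dominant_keys(1)[OF l f(1) _ False] by (auto simp: in_keys_iff)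
      moreover have "w l \<noteq> l"
        using False n(1) W0_inj[OF w] by (metis injD)
      ultimately show ?thesis using n by simp
    qed
  qed
  then have "Poly_Mapping.lookup F l = (\<Sum>w\<in>W0. if w l = l then A else 0)"
    by (simp add: F_def lookup_sum)
  also have "\<dots> = of_nat (card stab) * A"
    by (simp add: stab_def finite_W0 flip: sum.inter_filter)
  finally have "Poly_Mapping.lookup F l = c_const R \<alpha> \<kappa> js l"
    by (simp add: c)
  then have "scale (c_const R \<alpha> \<kappa> js l) (HO_polynomial R \<alpha> \<kappa> l) = F"
  proof (rule HO_polynomial_eqI[OF l FI HOF _ c0])
    fix m assume "m \<in> Poly_Mapping.keys F"
    then obtain w n where wn: "w \<in> W0" "n \<in> Poly_Mapping.keys f" "m = w n"
      using keysF by blast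
    have n: "norm n \<le> norm l"
      using eigenf_dominant_keys(1)[OF l f(1) wn(2)] by (cases "n = l") auto
    then show "norm m \<le> norm l"
      using wn by (simp add: W0_norm)
    assume m: "dominant m" "m \<noteq> l"
    have "n \<noteq> l"
      using m wn dominant_orbit_unique[OF wn(1) l(2)] by auto
    then show "dominance_less R \<alpha> m l"
      using eigenf_dominant_keys(2)[OF l f(1) wn(2) _ wn(1)] m wn by (simp add: dominance_less_iff)
  qed
  moreover have "Poly_Mapping.lookup F m \<in> nonneg_int_polys"
    unfolding F_def lookup_sum using lookF f(2) by (intro nonneg_int_polys_sum) metis
  ultimately show "Poly_Mapping.lookup (scale (c_const R \<alpha> \<kappa> js l) (HO_polynomial R \<alpha> \<kappa> l)) m \<in> nonneg_int_polys"
    by simp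
qed

end

theorem theorem1p4:
  fixes R :: "'a::euclidean_space set"
    and \<alpha> :: "nat \<Rightarrow> 'a"
    and \<kappa> :: "'a \<Rightarrow> 'i::linorder"
    and \<nu> :: 'a
    and w :: "'a \<Rightarrow> 'a"
    and js :: "nat list"
  assumes "root_system R" and "irreducible_roots R"
    and "simple_roots R \<alpha>"
    and "orbit_labelling R \<alpha> \<kappa>"
    and "\<nu> \<in> dominant_weights R \<alpha>"
    and "shortest_to_rep R \<alpha> \<nu> w"
    and "reduced_expression R \<alpha> js w"
  shows "c_const R \<alpha> \<kappa> js \<nu> \<in> nonneg_int_polys \<and>
    (\<forall>\<mu>\<in>weight_lattice R.
       Poly_Mapping.lookup (scale (c_const R \<alpha> \<kappa> js \<nu>) (HO_polynomial R \<alpha> \<kappa> \<nu>)) \<mu>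
         \<in> nonneg_int_polys)"
proof -
  interpret weyl_data R \<alpha> \<kappa>
    using assms(1-4) by unfold_locales
  have l: "\<nu> \<in> wts" "dominant \<nu>"
    using assms(5) by (simp_all add: dominant_weights_iff)
  have js: "set js \<subseteq> gens" "wm js \<nu> \<in> orbit_reps R \<alpha>"
    using assms(6,7) by (auto simp: reduced_expression_def shortest_to_rep_def gens_eq)
  show ?thesis
    using c_const_HO_polynomial[OF l js reduced_aff_val_pos[OF assms(6,7) l(1)]] by blast
qed

end
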